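(* Let $w$ and $w'$ be words over $\Omega$ of lengths $k$ and $k'$ respectively, and suppose $\mathrm{cor}(w) > \mathrm{cor}(w')$ (this forces $k \ge k'$). Then there exists an integer $N > k$ such that $h_w(n) - h_{w'}(n) \le 0$ for all $n < N$ and $h_w(n) - h_{w'}(n) > 0$ for all $n > N$.
   Context: Let $\Omega$ be a finite alphabet with $q \ge 2$ letters. A word $w$ of length $k\ge 1$ is written $w = w_k w_{k-1}\dots w_1$ with $w_i \in \Omega$. For an integer $n$, $h_w(n)$ denotes the number of strings of length $n$ over $\Omega$ whose last $k$ characters form $w$ and which contain $w$ as a block of $k$ consecutive characters nowhere else (so $h_w(n)=0$ for $n<k$, $h_w(k)=1$). Autocorrelation: for $1 \le i \le k$ let $b_i = 1$ if $w_j = w_{k-i+j}$ for all $j = 1,\dots,i$ (i.e. the suffix of length $i$ equals the prefix of length $i$), and $b_i = 0$ otherwise; so $b_k=1$. Set $\mathrm{cor}(w) = \sum_{i=1}^k b_i 2^{i-1}$ (the binary string $b_k b_{k-1}\dots b_1$ read as a base-2 integer); autocorrelations are compared as integers. (Interpretation: in a full Bernoulli shift on $q$ equiprobable symbols, e.g. an FDL dynamical system with its basic Markov partition, the cylinder coded by $w$ is first hit at time $n$ with probability $h_w(n+k)/q^{n+k}$.) *)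

theory Defs
  imports Main
begin

text \<open>Words are lists; the word w = w_k ... w_1 is the list [w_k, ..., w_1],
so w_1 is the last list element. A string s of length n contains w at
(0-based) position j iff j + length w \<le> n and take (length w) (drop j s) = w.\<close>

definition occurs_at :: "'a list \<Rightarrow> 'a list \<Rightarrow> nat \<Rightarrow> bool" where
  "occurs_at w s j \<longleftrightarrow> j + length w \<le> length s \<and> take (length w) (drop j s) = w"

definition h :: "'a set \<Rightarrow> 'a list \<Rightarrow> nat \<Rightarrow> nat" where
  "h \<Omega> w n = card {s. set s \<subseteq> \<Omega> \<and> length s = n \<and> length w \<le> n
      \<and> occurs_at w s (n - length w)
      \<and> (\<forall>j. j \<noteq> n - length w \<longrightarrow> \<not> occurs_at w s j)}"

definition cor :: "'a list \<Rightarrow> nat" where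
  "cor w = (\<Sum>i\<in>{1..length w}.
      if take i w = drop (length w - i) w then 2 ^ (i - 1) else 0)"

end

theory Submission
  imports Defs Complex_Main "HOL-Library.Multiset" "HOL-Computational_Algebra.Formal_Power_Series"
begin

text \<open>
  Let \<open>c L\<close> count the strings of length \<open>k + L\<close> in which \<open>w\<close> occurs exactly at positions \<open>0\<close>
  and \<open>L\<close>. Prepending a letter to a string gives \<open>h (n + 1) = q * h n - c (n + 1 - k)\<close>, and
  cutting \<open>w @ u\<close> at its last occurrence of \<open>w\<close> before the final one expresses \<open>h\<close> as the
  convolution of \<open>c\<close> with the set of periods \<open>P\<close> of \<open>w\<close>. These two recursions, two facts about
  overlaps of periodic words, and a comparison of the first period at which \<open>P\<close> and \<open>P'\<close> differ
  determine the sign of \<open>D = h - h'\<close>.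

  For large \<open>y\<close> the difference \<open>\<delta> = c - c'\<close> satisfies
  \<open>\<delta> y \<le> (q - 1) * (D (y - 1) + \<dots> + D (y - s))\<close> up to controlled corrections, where \<open>s\<close> is the
  first differing period. Hence, once \<open>D\<close> becomes positive, its positive part dominates the sum
  of its \<open>k - 1\<close> predecessors, and this invariant keeps \<open>D\<close> positive. For small \<open>n\<close> one has the
  generating function identity \<open>H - H' = - (C - C') * (1 - F) * H'\<close>, where the coefficients of
  \<open>(1 - F) * H'\<close> grow so fast that the leading term of \<open>C - C'\<close> decides the sign. Finally \<open>D\<close>
  cannot stay nonpositive, because \<open>\<Sum>n. h n / q ^ n = 1\<close> for every word.
\<close>

section \<open>The recursions of a single word\<close>

text \<open>The two overlap facts: if p < s are periods with p + s \<le> k + 1, then s - p is a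
  period, so that every prime except the least period p is at least k + 2 - p; and for a first-hit
  string u at most one letter a creates an unwanted occurrence in w @ a # u, so that (q - 1) * h n
  \<le> c (n + 1). The obstacle is that the two ranges have to meet. In general h is shown to
  dominate the sum of its k - 1 predecessors only from 3 * k on, so the estimate of \<delta> starts
  at a multiple of k, up to 6 * k if the words share a period below s. In the initial range the
  coefficients of (1 - F) * H', measured against q ^ z, lose only a term of order 1 / q ^ k per
  step, so the sign argument lasts for a time exponential in k. This reaches the linear thresholds
  except for a few binary words of length 5 and 6, which are settled by evaluating the recursions. A
  first difference at 1 is kept apart, because the weight bound on the primes excludes period 1;
  then w is a power of one letter and c y = (q - 1) * h (y - 1) for y > k.\<close>

lemma window_shift:
  fixes f :: "nat \<Rightarrow> int"
  assumes "m \<le> y"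
  shows "(\<Sum>i=1..<Suc m. f (Suc y - i)) = (\<Sum>i=1..<Suc m. f (y - i)) + f y - f (y - m)"
  using assms
proof (induction m)
  case (Suc m)
  then have "Suc (y - Suc m) = y - m" by simp
  then show ?case using Suc by simp
qed simp

text \<open>By induction \<open>f (t - l) \<ge> 2 ^ (i - l - 1) * f (t - i)\<close> for
  \<open>l < i\<close>; these powers together with the last term of the window add up to
  \<open>2 ^ (i - 1)\<close>. Domination is required only for
  \<open>t - i < m \<le> t\<close>.\<close>

lemma superadditive_double:
  fixes f :: "nat \<Rightarrow> int"
  assumes nn: "\<And>n. 0 \<le> f n"
  shows "1 \<le> i \<Longrightarrow> i < k \<Longrightarrow> (\<And>m. m \<le> t \<Longrightarrow> t < m + i \<Longrightarrow> (\<Sum>l=1..<k. f (m - l)) \<le> f m) \<Longrightarrow> i \<le> t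
    \<Longrightarrow> 2 ^ (i - 1) * f (t - i) \<le> f t"
proof (induction i arbitrary: t rule: less_induct)
  case (less i)
  have e: "(\<Sum>l=1..<i. 2 ^ (i - l - 1)) = (2::int) ^ (i - 1) - 1"
  proof -
    have "(\<Sum>l=1..<i. 2 ^ (i - l - 1)) = (\<Sum>l<i - 1. (2::int) ^ l)"
      by (rule sum.reindex_bij_witness[of _ "\<lambda>l. i - l - 1" "\<lambda>l. i - l - 1"]) auto
    moreover have "(\<Sum>l<n. (2::int) ^ l) = 2 ^ n - 1" for n by (induction n) auto
    ultimately show ?thesis by simp
  qed
  have "2 ^ (i - 1) * f (t - i) = (\<Sum>l=1..<i. 2 ^ (i - l - 1) * f (t - i)) + f (t - i)"
    unfolding sum_distrib_right[symmetric] e by (simp add: algebra_simps)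
  also have "(\<Sum>l=1..<i. 2 ^ (i - l - 1) * f (t - i)) \<le> (\<Sum>l=1..<i. f (t - l))"
  proof (intro sum_mono)
    fix l assume l: "l \<in> {1..<i}"
    have "2 ^ (i - l - 1) * f (t - l - (i - l)) \<le> f (t - l)"
      using l less.prems by (intro less.IH) auto
    then show "2 ^ (i - l - 1) * f (t - i) \<le> f (t - l)" using l by simp
  qed
  also have "(\<Sum>l=1..<i. f (t - l)) + f (t - i) = (\<Sum>l=1..<Suc i. f (t - l))"
    using less.prems by simp
  also have "\<dots> \<le> (\<Sum>l=1..<k. f (t - l))" using less.prems nn by (intro sum_mono2) auto
  also have "\<dots> \<le> f t" using less.prems by auto
  finally show ?case by simp
qed

text \<open>
  Here \<open>P\<close> is the set of periods \<open>s\<close> of a word of length \<open>k\<close> with \<open>0 < s < k\<close>. Below \<open>k\<close> the function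
  \<open>c\<close> is the indicator of the periods that are not sums of smaller ones, called primes in the
  names of lemmas. The value \<open>c 0\<close> is irrelevant.
\<close>

locale corr =
  fixes q :: int and k :: nat and P :: "nat set" and h c :: "nat \<Rightarrow> int"
  assumes q2: "2 \<le> q"
    and k1: "1 \<le> k"
    and P_sub: "P \<subseteq> {1..<k}"
    and h_zero: "n < k \<Longrightarrow> h n = 0"
    and h_k: "h k = 1"
    and h_step: "k \<le> n \<Longrightarrow> h (Suc n) = q * h n - c (Suc n - k)"
    and h_conv: "k \<le> n \<Longrightarrow> h n = c n + (\<Sum>s\<in>P. c (n - s))"
    and P_conv: "1 \<le> n \<Longrightarrow> n < k \<Longrightarrow> of_bool (n \<in> P) = c n + (\<Sum>s\<in>{s\<in>P. s < n}. c (n - s))"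
    and c_nonneg: "0 \<le> c n"
    and fw: "p \<in> P \<Longrightarrow> s \<in> P \<Longrightarrow> p < s \<Longrightarrow> p + s \<le> k + 1 \<Longrightarrow> s - p \<in> P"
    and c_lower: "k \<le> n \<Longrightarrow> (q - 1) * h n \<le> c (Suc n)"
begin

lemma fin_P [simp]: "finite P"
  using P_sub finite_subset by blast

lemma P_bounds: "s \<in> P \<Longrightarrow> 1 \<le> s \<and> s < k"
  using P_sub by auto

lemma c_le_bool: "1 \<le> n \<Longrightarrow> n < k \<Longrightarrow> c n \<le> of_bool (n \<in> P)"
  using P_conv[of n] sum_nonneg[of "{s\<in>P. s < n}" "\<lambda>s. c (n - s)"] c_nonneg by simp

lemma c_le_one: assumes "1 \<le> n" "n \<le> k" shows "c n \<le> 1"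
proof (cases "n = k")
  case True
  have "0 \<le> (\<Sum>s\<in>P. c (k - s))" by (intro sum_nonneg c_nonneg)
  then show ?thesis using True h_conv[of k] h_k by simp
next
  case False
  then have "c n \<le> of_bool (n \<in> P)" using assms by (intro c_le_bool) auto
  also have "\<dots> \<le> 1" by simp
  finally show ?thesis .
qed

lemma c_le_h: "k \<le> n \<Longrightarrow> c n \<le> h n"
  using h_conv[of n] sum_nonneg[of P "\<lambda>s. c (n - s)"] c_nonneg by simp

text \<open>The claims are proved together because the step needs
  \<open>c (Suc n - k) \<le> h n\<close>, which for \<open>Suc n - k \<ge> k\<close> comes from
  \<open>c_le_h\<close> and monotonicity up to \<open>n\<close>. As \<open>q \<ge> 2\<close>, the
  recursion then cannot decrease \<open>h\<close>.\<close>

lemma h_growth_aux: "k \<le> n \<Longrightarrow> 1 \<le> h n \<and> h n \<le> h (Suc n) \<and> (\<forall>m\<le>n. h m \<le> h n)"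
proof (induction n rule: less_induct)
  case (less n)
  have mono: "h m \<le> h n" if "m \<le> n" for m
  proof (cases "m = n \<or> m < k")
    case True
    then show ?thesis
    proof
      assume "m < k"
      have "0 \<le> h n"
      proof (cases "n = k")
        case True then show ?thesis using h_k by simp
      next
        case False
        then have "1 \<le> h (n - 1)" "h (n - 1) \<le> h (Suc (n - 1))"
          using less.IH[of "n - 1"] less.prems k1 by auto
        then show ?thesis using False less.prems by (cases n) auto
      qed
      then show ?thesis using h_zero \<open>m < k\<close> by simp
    qed simp
  next
    case False
    then have "k \<le> n - 1" "m \<le> n - 1" "n - 1 < n" using that by auto
    then have "h m \<le> h (n - 1)" "h (n - 1) \<le> h (Suc (n - 1))" using less.IH[of "n - 1"] by auto
    then show ?thesis using \<open>n - 1 < n\<close> by simp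
  qed
  have one: "1 \<le> h n" using mono[of k] less.prems h_k by simp
  have "c (Suc n - k) \<le> h n"
  proof (cases "Suc n - k < k")
    case True
    then have "c (Suc n - k) \<le> 1" using less.prems by (intro c_le_one) auto
    then show ?thesis using one by simp
  next
    case False
    then have "c (Suc n - k) \<le> h (Suc n - k)" by (intro c_le_h) simp
    also have "\<dots> \<le> h n" using k1 by (intro mono) simp
    finally show ?thesis .
  qed
  moreover have "2 * h n \<le> q * h n" using q2 one by (intro mult_right_mono) auto
  ultimately have "h n \<le> h (Suc n)" using h_step[OF less.prems] by linarith
  then show ?case using one mono by blast
qed

lemma h_pos: "k \<le> n \<Longrightarrow> 1 \<le> h n"
  using h_growth_aux by blast

lemma h_nonneg [simp]: "0 \<le> h n"
  using h_pos[of n] h_zero[of n] by (cases "k \<le> n") auto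

lemma h_mono: assumes "m \<le> n" shows "h m \<le> h n"
proof (cases "k \<le> n")
  case True then show ?thesis using h_growth_aux assms by blast
next
  case False then show ?thesis using assms h_zero by simp
qed

lemma h_le_pow: "h (k + i) \<le> q ^ i"
proof (induction i)
  case 0 then show ?case using h_k by simp
next
  case (Suc i)
  have "h (Suc (k + i)) \<le> q * h (k + i)" using h_step[of "k + i"] c_nonneg[of "Suc (k + i) - k"] by simp
  also have "\<dots> \<le> q * q ^ i" using Suc q2 by (intro mult_left_mono) auto
  finally show ?case by simp
qed

lemma c_le_pow: assumes "k \<le> i" shows "c i \<le> q ^ (i - k)"
  using c_le_h[OF assms] h_le_pow[of "i - k"] assms by simp

lemma c_below_Min: assumes "1 \<le> i" "i < k" "\<And>s. s \<in> P \<Longrightarrow> i < s" shows "c i = 0"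
proof -
  have "i \<notin> P" using assms(3) by blast
  then show ?thesis using c_le_bool[OF assms(1,2)] c_nonneg[of i] by simp
qed

lemma c_Min: assumes "P \<noteq> {}" shows "c (Min P) = 1"
proof -
  have m: "Min P \<in> P" using assms by simp
  have e: "{s\<in>P. s < Min P} = {}" by (auto simp: not_less)
  show ?thesis using P_conv[of "Min P", unfolded e] P_bounds[OF m] m by simp
qed

text \<open>Otherwise \<open>fw\<close> makes \<open>s - Min P\<close> a period, so in
  \<open>P_conv\<close> at \<open>s\<close> the summand \<open>c (Min P) = 1\<close> already
  accounts for the indicator and \<open>c s\<close> vanishes.\<close>

lemma prime_gap:
  assumes s: "1 \<le> s" "s < k" "c s \<noteq> 0" and ne: "s \<noteq> Min P"
  shows "k + 2 \<le> Min P + s"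
proof (rule ccontr)
  assume "\<not> ?thesis"
  then have le: "Min P + s \<le> k + 1" by simp
  have "c s \<ge> 1" using s c_nonneg[of s] by simp
  then have sP: "s \<in> P" using c_le_bool[of s] s by (cases "s \<in> P") auto
  then have ne': "P \<noteq> {}" by auto
  then have m: "Min P \<in> P" by simp
  have lt: "Min P < s" using sP ne by (metis Min_le fin_P le_neq_implies_less)
  have d: "s - Min P \<in> {t\<in>P. t < s}" using fw[OF m sP lt le] P_bounds[OF m] lt by auto
  have "c (Min P) \<le> (\<Sum>t\<in>{t\<in>P. t < s}. c (s - t))"
    using member_le_sum[OF d, of "\<lambda>t. c (s - t)"] c_nonneg lt by simp
  then show False using P_conv[of s] s sP \<open>c s \<ge> 1\<close> c_Min[OF ne'] by simp
qed

text \<open>By \<open>P_conv\<close> every period is in exactly one way a prime \<open>l\<close> or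
  a prime \<open>l\<close> plus a period \<open>t\<close>; \<open>G\<close> is summed along this
  decomposition.\<close>

lemma P_sum:
  fixes G :: "nat \<Rightarrow> int"
  shows "(\<Sum>s\<in>P. G s) = (\<Sum>l=1..<k. c l * (G l + (\<Sum>t\<in>{t\<in>P. l + t < k}. G (l + t))))"
proof -
  have "(\<Sum>s\<in>P. G s) = (\<Sum>i=1..<k. of_bool (i \<in> P) * G i)"
    using P_sub by (simp add: sum.If_cases of_bool_def Int_absorb1 if_distrib[of "\<lambda>x. x * _"] cong: if_cong)
  also have "\<dots> = (\<Sum>i=1..<k. c i * G i + (\<Sum>t\<in>{t\<in>P. t < i}. c (i - t) * G i))"
    by (intro sum.cong refl) (simp add: P_conv distrib_right sum_distrib_right)
  also have "\<dots> = (\<Sum>i=1..<k. c i * G i) + (\<Sum>i=1..<k. \<Sum>t\<in>{t\<in>P. t < i}. c (i - t) * G i)"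
    by (simp add: sum.distrib)
  also have "(\<Sum>i=1..<k. \<Sum>t\<in>{t\<in>P. t < i}. c (i - t) * G i)
      = (\<Sum>l=1..<k. \<Sum>t\<in>{t\<in>P. l + t < k}. c l * G (l + t))"
  proof -
    have "(\<Sum>i=1..<k. \<Sum>t\<in>{t\<in>P. t < i}. c (i - t) * G i)
        = (\<Sum>(i,t)\<in>(SIGMA i:{1..<k}. {t\<in>P. t < i}). c (i - t) * G i)"
      by (rule sum.Sigma) auto
    also have "\<dots> = (\<Sum>(l,t)\<in>(SIGMA l:{1..<k}. {t\<in>P. l + t < k}). c l * G (l + t))"
      by (rule sum.reindex_bij_witness[of _ "\<lambda>(l,t). (l + t, t)" "\<lambda>(i,t). (i - t, t)"]) (auto dest: P_bounds)
    also have "\<dots> = (\<Sum>l=1..<k. \<Sum>t\<in>{t\<in>P. l + t < k}. c l * G (l + t))"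
      by (rule sum.Sigma[symmetric]) auto
    finally show ?thesis .
  qed
  finally show ?thesis by (simp add: sum.distrib distrib_left sum_distrib_left)
qed

section \<open>Domination of the preceding window\<close>

lemma e_formula:
  "h (k + X) - (q - 1) * (\<Sum>i=1..<k. h (k + X - i)) = 1 + (\<Sum>i=1..X. (q - 1) * h i - c i)"
proof (induction X)
  case 0
  have "(\<Sum>i=1..<k. h (k - i)) = 0" by (intro sum.neutral) (auto simp: h_zero)
  then show ?case using h_k by simp
next
  case (Suc X)
  have w: "(\<Sum>i=1..<k. h (Suc (k + X) - i)) = (\<Sum>i=1..<k. h (k + X - i)) + h (k + X) - h (Suc X)"
    using window_shift[of "k - 1" "k + X" h] k1 by simp
  have "h (Suc (k + X)) = q * h (k + X) - c (Suc X)" using h_step[of "k + X"] by simp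
  then have "h (k + Suc X) - (q - 1) * (\<Sum>i=1..<k. h (k + Suc X - i))
      = (h (k + X) - (q - 1) * (\<Sum>i=1..<k. h (k + X - i))) + ((q - 1) * h (Suc X) - c (Suc X))"
  proof -
    assume st: "h (Suc (k + X)) = q * h (k + X) - c (Suc X)"
    show ?thesis unfolding add_Suc_right w st by (simp add: algebra_simps)
  qed
  also have "\<dots> = 1 + (\<Sum>i=1..Suc X. (q - 1) * h i - c i)" unfolding Suc by simp
  finally show ?case .
qed

text \<open>An account: the credit 1 comes from \<open>h k = 1\<close>, every prime below
  \<open>k\<close> costs one unit because \<open>h\<close> vanishes there, and from \<open>k\<close>
  on index \<open>i\<close> repays at least \<open>h i - c i\<close>, the sum over the periods in
  \<open>h_conv\<close>.\<close>

lemma e_lower: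
  assumes "k \<le> X"
  shows "1 - (\<Sum>i=1..<k. c i) + (\<Sum>i=k..X. \<Sum>s\<in>P. c (i - s)) \<le> 1 + (\<Sum>i=1..X. (q - 1) * h i - c i)"
proof -
  have "{1..X} = {1..<k} \<union> {k..X}" using assms k1 by auto
  then have "(\<Sum>i=1..X. (q - 1) * h i - c i)
      = (\<Sum>i=1..<k. (q - 1) * h i - c i) + (\<Sum>i=k..X. (q - 1) * h i - c i)"
    using sum.union_disjoint[of "{1..<k}" "{k..X}" "\<lambda>i. (q - 1) * h i - c i"]
    by (simp add: ivl_disj_int)
  moreover have "(\<Sum>i=1..<k. (q - 1) * h i - c i) = - (\<Sum>i=1..<k. c i)"
    unfolding sum_negf[symmetric] by (intro sum.cong) (auto simp: h_zero)
  moreover have "(\<Sum>i=k..X. \<Sum>s\<in>P. c (i - s)) \<le> (\<Sum>i=k..X. (q - 1) * h i - c i)"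
  proof (intro sum_mono)
    fix i assume "i \<in> {k..X}"
    then have "h i = c i + (\<Sum>s\<in>P. c (i - s))" using h_conv by simp
    moreover have "1 * h i \<le> (q - 1) * h i" using q2 by (intro mult_right_mono) auto
    ultimately show "(\<Sum>s\<in>P. c (i - s)) \<le> (q - 1) * h i - c i" by linarith
  qed
  ultimately show ?thesis by simp
qed

lemma sum_prev_le_aux:
  assumes "k \<le> y" and "0 \<le> 1 + (\<Sum>i=1..y - k. (q - 1) * h i - c i) - e"
  shows "(\<Sum>i=1..<k. h (y - i)) + e \<le> h y"
proof -
  have "h y - (q - 1) * (\<Sum>i=1..<k. h (y - i)) \<ge> e"
    using e_formula[of "y - k"] assms by simp
  moreover have "1 * (\<Sum>i=1..<k. h (y - i)) \<le> (q - 1) * (\<Sum>i=1..<k. h (y - i))"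
    using q2 by (intro mult_right_mono sum_nonneg) auto
  ultimately show ?thesis by simp
qed

text \<open>The credit 1 pays for the least period \<open>p\<close>. By \<open>prime_gap\<close>
  every other prime \<open>i\<close> lies in \<open>k - p..<k\<close>, and its cost is repaid at
  index \<open>i + p\<close>, where the period \<open>p\<close> contributes \<open>c i\<close>. All
  these indices are below \<open>k + p\<close>, hence reached once
  \<open>y - k \<ge> 2 * k\<close>.\<close>

lemma sum_prev_le:
  assumes "3 * k \<le> y"
  shows "(\<Sum>i=1..<k. h (y - i)) \<le> h y"
proof -
  have X: "k \<le> y - k" using assms by simp
  have "(\<Sum>i=1..<k. c i) \<le> 1 + (\<Sum>i=k..y - k. \<Sum>s\<in>P. c (i - s))"
  proof (cases "P = {}")
    case True
    then have "(\<Sum>i=1..<k. c i) = 0" by (intro sum.neutral) (auto intro: c_below_Min)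
    then show ?thesis using True by simp
  next
    case False
    define p where "p = Min P"
    have p: "p \<in> P" "1 \<le> p" "p < k" using False P_bounds[of p] by (auto simp: p_def)
    have "(\<Sum>i=1..<k. c i) = c p + (\<Sum>i\<in>{1..<k} - {p}. c i)"
      using p by (intro sum.remove) auto
    also have "(\<Sum>i\<in>{1..<k} - {p}. c i) \<le> (\<Sum>i=k-p..<k. c i)"
    proof -
      have "(\<Sum>i\<in>{1..<k} - {p}. c i) = (\<Sum>i\<in>({1..<k} - {p}) \<inter> {k-p..<k}. c i)"
        using prime_gap by (intro sum.mono_neutral_right) (auto simp: p_def, force)
      also have "\<dots> \<le> (\<Sum>i=k-p..<k. c i)" by (intro sum_mono2) (auto simp: c_nonneg)
      finally show ?thesis .
    qed
    also have "(\<Sum>i=k-p..<k. c i) = (\<Sum>i=k..<k+p. c (i - p))"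
      using p by (intro sum.reindex_bij_witness[of _ "\<lambda>i. i - p" "\<lambda>i. i + p"]) auto
    also have "\<dots> \<le> (\<Sum>i=k..<k+p. \<Sum>s\<in>P. c (i - s))"
      using p by (intro sum_mono member_le_sum[of p P "\<lambda>s. c (_ - s)"]) (auto simp: c_nonneg)
    also have "\<dots> \<le> (\<Sum>i=k..y - k. \<Sum>s\<in>P. c (i - s))"
      using p assms by (intro sum_mono2) (auto intro!: sum_nonneg c_nonneg)
    finally show ?thesis using c_Min[OF False] by (simp add: p_def)
  qed
  then have "0 \<le> 1 + (\<Sum>i=1..y - k. (q - 1) * h i - c i) - 0" using e_lower[OF X] by simp
  then show ?thesis using sum_prev_le_aux[of y 0] assms by simp
qed

text \<open>A single prime is paid by the credit alone, so domination needs no repayment and holds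
  from \<open>k\<close> on.\<close>

lemma sum_prev_le_one_prime:
  assumes "k \<le> y" "(\<Sum>i=1..<k. c i) \<le> 1"
  shows "(\<Sum>i=1..<k. h (y - i)) \<le> h y"
proof -
  have "0 \<le> 1 + (\<Sum>i=1..y - k. (q - 1) * h i - c i) - 0"
  proof (cases "k \<le> y - k")
    case True
    have "0 \<le> (\<Sum>i=k..y-k. \<Sum>s\<in>P. c (i - s))" by (intro sum_nonneg c_nonneg)
    then show ?thesis using e_lower[OF True] assms(2) by simp
  next
    case False
    then have "(\<Sum>i=1..y - k. (q - 1) * h i - c i) = (\<Sum>i=1..y - k. - c i)"
      by (intro sum.cong) (auto simp: h_zero)
    moreover have "(\<Sum>i=1..y - k. c i) \<le> (\<Sum>i=1..<k. c i)"
      using False by (intro sum_mono2) (auto simp: c_nonneg)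
    ultimately show ?thesis using assms(2) by (simp add: sum_negf)
  qed
  then show ?thesis using sum_prev_le_aux[of y 0] assms by simp
qed

text \<open>As long as no prime has been charged, the credit is available as a slack of one.\<close>

lemma sum_prev_less:
  assumes "k \<le> y" "y < 2 * k" "\<And>i. 1 \<le> i \<Longrightarrow> i \<le> y - k \<Longrightarrow> c i = 0"
  shows "(\<Sum>i=1..<k. h (y - i)) + 1 \<le> h y"
proof -
  have "(\<Sum>i=1..y - k. (q - 1) * h i - c i) = 0"
    using assms by (intro sum.neutral) (auto simp: h_zero)
  then show ?thesis using sum_prev_le_aux[of y 1] assms by simp
qed

lemma h_double:
  assumes "1 \<le> i" "i < k" "3 * k + i \<le> t"
  shows "2 ^ (i - 1) * h (t - i) \<le> h t"
  using assms by (intro superadditive_double[where k = k] sum_prev_le) auto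

text \<open>The overshoot in the expansion over primes: \<open>h (y - l)\<close> sums
  \<open>c (y - l - t)\<close> over all periods \<open>t\<close>, whereas \<open>P_sum\<close> only
  meets those with \<open>l + t < k\<close>.\<close>

definition B :: "nat \<Rightarrow> nat \<Rightarrow> int" where
  "B y l = (\<Sum>t\<in>{t\<in>P. k \<le> l + t}. c (y - l - t))"

lemma B_nonneg [simp]: "0 \<le> B y l"
  unfolding B_def by (intro sum_nonneg c_nonneg)

lemma h_minus_B:
  assumes "2 * k \<le> y" "l < k"
  shows "h (y - l) - B y l = c (y - l) + (\<Sum>t\<in>{t\<in>P. l + t < k}. c (y - l - t))"
proof -
  have "(\<Sum>t\<in>P. c (y - l - t)) = (\<Sum>t\<in>{t\<in>P. l + t < k} \<union> {t\<in>P. k \<le> l + t}. c (y - l - t))"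
    by (intro sum.cong) auto
  also have "\<dots> = (\<Sum>t\<in>{t\<in>P. l + t < k}. c (y - l - t)) + B y l"
    unfolding B_def by (intro sum.union_disjoint) auto
  finally show ?thesis using h_conv[of "y - l"] assms by simp
qed

lemma B_le: "2 * k \<le> y \<Longrightarrow> l < k \<Longrightarrow> c (y - l) \<le> h (y - l) - B y l"
  using h_minus_B[of y l] sum_nonneg[of "{t\<in>P. l + t < k}" "\<lambda>t. c (y - l - t)"] c_nonneg by simp

lemma c_expand:
  assumes "2 * k \<le> y"
  shows "c y = h y - (\<Sum>l=1..<k. c l * (h (y - l) - B y l))"
proof -
  have "(\<Sum>s\<in>P. c (y - s)) = (\<Sum>l=1..<k. c l * (h (y - l) - B y l))"
    unfolding P_sum[of "\<lambda>s. c (y - s)"]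
    using assms by (intro sum.cong refl arg_cong2[of _ _ _ _ "(*)"]) (simp add: h_minus_B)
  then show ?thesis using h_conv[of y] assms by simp
qed

text \<open>All primes are at least 2, so \<open>c_expand\<close> subtracts at most the window
  without its first term, and domination leaves \<open>h (y - 1)\<close> over.\<close>

lemma h_prev_le_c:
  assumes "3 * k \<le> y" "2 \<le> k" "1 \<notin> P"
  shows "h (y - 1) \<le> c y"
proof -
  have c1: "c 1 = 0" using c_le_bool[of 1] c_nonneg[of 1] assms by simp
  have split: "{1..<k} = insert 1 {2..<k}" using assms by auto
  have "(\<Sum>l=1..<k. c l * (h (y - l) - B y l)) = (\<Sum>l=2..<k. c l * (h (y - l) - B y l))"
    unfolding split by (simp add: c1[simplified])
  also have "\<dots> \<le> (\<Sum>l=2..<k. h (y - l))"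
  proof (intro sum_mono)
    fix l assume l: "l \<in> {2..<k}"
    have "c l * (h (y - l) - B y l) \<le> 1 * (h (y - l) - B y l)"
      using l B_le[of y l] c_nonneg[of "y - l"] assms c_le_one[of l] by (intro mult_right_mono) auto
    then show "c l * (h (y - l) - B y l) \<le> h (y - l)" using B_nonneg[of y l] by (simp del: B_nonneg)
  qed
  finally have a: "(\<Sum>l=1..<k. c l * (h (y - l) - B y l)) \<le> (\<Sum>l=2..<k. h (y - l))" .
  have "h (y - 1) + (\<Sum>l=2..<k. h (y - l)) \<le> h y"
    using sum_prev_le[OF assms(1)] unfolding split by simp
  then show ?thesis using a c_expand[of y] assms by simp
qed

end

section \<open>Positivity persists\<close>

definition pos :: "int \<Rightarrow> int" where "pos x = max 0 x"

lemma pos_nonneg [simp]: "0 \<le> pos x" and le_pos [simp]: "x \<le> pos x"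
  by (auto simp: pos_def)

lemma pos_eq: "0 \<le> x \<Longrightarrow> pos x = x" by (simp add: pos_def)
lemma pos_zero: "x \<le> 0 \<Longrightarrow> pos x = 0" by (simp add: pos_def)

text \<open>The invariant is \<open>0 \<le> e n\<close>. Moving the window from \<open>n\<close> to
  \<open>Suc n\<close> drops the index \<open>y = Suc n - k\<close>, the same one at which
  \<open>\<delta>\<close> enters the recursion, so \<open>key\<close> is what keeps \<open>e\<close>
  nonnegative. \<open>M\<close> marks where the estimate of \<open>\<delta>\<close> sets in; before
  it \<open>D\<close> has to be known nonpositive.\<close>

lemma positivity_persists:
  fixes D \<delta> :: "nat \<Rightarrow> int" and q :: int and k M :: nat
  assumes q: "2 \<le> q" and k: "1 \<le> k" "k \<le> M"
    and step: "\<And>n. k \<le> n \<Longrightarrow> D (Suc n) = q * D n - \<delta> (Suc n - k)"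
    and early: "\<And>n. n < M \<Longrightarrow> D n \<le> 0"
    and key: "\<And>y. M < y + k \<Longrightarrow> (\<And>m. m < y + k \<Longrightarrow> (q - 1) * (\<Sum>i=1..<k. pos (D (m - i))) \<le> pos (D m))
        \<Longrightarrow> \<delta> y \<le> (q - 1) * pos (D y)"
    and N: "0 < D N" "\<And>n. n < N \<Longrightarrow> D n \<le> 0"
  shows "N \<le> n \<Longrightarrow> 0 < D n"
proof -
  define e where "e n = pos (D n) - (q - 1) * (\<Sum>i=1..<k. pos (D (n - i)))" for n
  have MN: "M \<le> N" using early[of N] N(1) by (meson not_le_imp_less not_less)
  have low: "0 \<le> e n" if "n \<le> N" for n
  proof -
    have "(\<Sum>i=1..<k. pos (D (n - i))) = 0"
    proof (intro sum.neutral ballI)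
      fix i assume i: "i \<in> {1..<k}"
      have "n - i < N" using i that MN k by (cases "n = 0") auto
      then show "pos (D (n - i)) = 0" using N(2) by (simp add: pos_zero)
    qed
    then show ?thesis by (simp add: e_def)
  qed
  have "0 < D n \<and> (\<forall>m\<le>n. 0 \<le> e m)" if "N \<le> n" for n
    using that
  proof (induction n rule: dec_induct)
    case base then show ?case using N low by blast
  next
    case (step n)
    have super: "(q - 1) * (\<Sum>i=1..<k. pos (D (m - i))) \<le> pos (D m)" if "m \<le> n" for m
      using step.IH that unfolding e_def by auto
    define y where "y = Suc n - k"
    have y: "y + k = Suc n" "y \<le> n" using step.hyps MN k by (auto simp: y_def)
    have "\<delta> y \<le> (q - 1) * pos (D y)"
      using y MN step.hyps super by (intro key) auto
    have st: "D (Suc n) = q * D n - \<delta> y"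
      using assms(4)[of n] step.hyps MN k by (simp add: y_def)
    have w: "(\<Sum>i=1..<k. pos (D (Suc n - i))) = (\<Sum>i=1..<k. pos (D (n - i))) + pos (D n) - pos (D y)"
      using window_shift[of "k - 1" n "\<lambda>i. pos (D i)"] k step.hyps MN y by (simp add: y_def)
    have Dn: "pos (D n) = D n" using step.IH by (simp add: pos_eq)
    have e: "0 \<le> e n" using step.IH by blast
    have *: "(q - 1) * (\<Sum>i=1..<k. pos (D (Suc n - i))) \<le> D (Suc n)"
    proof -
      have "(q - 1) * (\<Sum>i=1..<k. pos (D (Suc n - i)))
          = (q - 1) * (\<Sum>i=1..<k. pos (D (n - i))) + (q - 1) * D n - (q - 1) * pos (D y)"
        unfolding w Dn by (simp add: algebra_simps)
      moreover have "q * D n = D n + (q - 1) * D n" by (simp add: algebra_simps)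
      ultimately show ?thesis using \<open>\<delta> y \<le> _\<close> st e Dn unfolding e_def by linarith
    qed
    have "0 < D (Suc n)"
    \<comment> \<open>For \<open>k = 1\<close> the window is empty and domination does not give
      positivity, which then follows from \<open>key\<close> at \<open>y = n\<close>.\<close>
    proof (cases "k = 1")
      case True
      then have "y = n" using y by simp
      then have "\<delta> y \<le> (q - 1) * D n" using \<open>\<delta> y \<le> _\<close> Dn by simp
      then show ?thesis using st step.IH by (simp add: algebra_simps)
    next
      case False
      have "pos (D (Suc n - 1)) \<le> (\<Sum>i=1..<k. pos (D (Suc n - i)))"
        using False k by (intro member_le_sum) auto
      then have "D n \<le> (\<Sum>i=1..<k. pos (D (Suc n - i)))" using Dn by simp
      moreover have "1 * (\<Sum>i=1..<k. pos (D (Suc n - i))) \<le> (q - 1) * (\<Sum>i=1..<k. pos (D (Suc n - i)))"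
        using q by (intro mult_right_mono sum_nonneg) auto
      ultimately show ?thesis using * step.IH by linarith
    qed
    moreover have "0 \<le> e (Suc n)" using * le_pos[of "D (Suc n)"] unfolding e_def by linarith
    ultimately show ?case using step.IH by (auto simp: le_Suc_eq)
  qed
  then show "N \<le> n \<Longrightarrow> 0 < D n" by blast
qed

lemma square_le_two_power: "(2 + int j)\<^sup>2 \<le> 2 ^ (2 + 2 * j)"
proof -
  have "2 + int j \<le> 2 ^ (1 + j)"
  proof (induction j)
    case (Suc j)
    have "(1::int) \<le> 2 ^ (1 + j)" by (rule one_le_power) simp
    then have "2 + int (Suc j) \<le> 2 * 2 ^ (1 + j)" using Suc by linarith
    then show ?case by simp
  qed simp
  then have "(2 + int j)\<^sup>2 \<le> (2 ^ (1 + j))\<^sup>2" by (intro power_mono) auto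
  also have "\<dots> = 2 ^ (2 + 2 * j)" by (simp add: power_mult[symmetric] mult.commute)
  finally show ?thesis .
qed

lemma sum_subset_reindex:
  fixes f g :: "nat \<Rightarrow> int"
  assumes "inj_on \<phi> T" "\<phi> ` T \<subseteq> I" "finite I" "\<And>t. t \<in> T \<Longrightarrow> g t = f (\<phi> t)" "\<And>i. i \<in> I \<Longrightarrow> 0 \<le> f i"
  shows "(\<Sum>t\<in>T. g t) \<le> (\<Sum>i\<in>I. f i)"
proof -
  have "(\<Sum>t\<in>T. g t) = (\<Sum>i\<in>\<phi> ` T. f i)"
    using assms by (simp add: sum.reindex cong: sum.cong)
  also have "\<dots> \<le> (\<Sum>i\<in>I. f i)" using assms by (intro sum_mono2) auto
  finally show ?thesis .
qed

section \<open>Two words of equal length\<close>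

text \<open>The first shift at which the period sets differ is \<open>s0\<close>. For the word with
  the larger autocorrelation it is a period, because shift \<open>s\<close> has binary weight
  \<open>2 ^ (k - 1 - s)\<close> and the smallest differing shift decides the comparison.\<close>

locale corr_pair = W: corr q k P h c + V: corr q k P' h' c'
  for q :: int and k :: nat and P :: "nat set" and h c :: "nat \<Rightarrow> int"
    and P' :: "nat set" and h' c' :: "nat \<Rightarrow> int" +
  fixes s0 :: nat
  assumes s0_P: "s0 \<in> P" and s0_P': "s0 \<notin> P'"
    and agree: "s < s0 \<Longrightarrow> s \<in> P \<longleftrightarrow> s \<in> P'"
begin

definition D :: "nat \<Rightarrow> int" where "D n = h n - h' n"
definition \<delta> :: "nat \<Rightarrow> int" where "\<delta> n = c n - c' n"

lemma s0_bounds: "1 \<le> s0" "s0 < k"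
  using W.P_bounds[OF s0_P] by auto

lemma agree_set: "n \<le> s0 \<Longrightarrow> {s\<in>P'. s < n} = {s\<in>P. s < n}"
  using agree by auto

lemma c_agree: "1 \<le> n \<Longrightarrow> n < s0 \<Longrightarrow> c' n = c n"
proof (induction n rule: less_induct)
  case (less n)
  have "(\<Sum>s\<in>{s\<in>P. s < n}. c' (n - s)) = (\<Sum>s\<in>{s\<in>P. s < n}. c (n - s))"
    using less.prems by (intro sum.cong refl less.IH) (auto dest: W.P_bounds)
  then show ?case
    using W.P_conv[of n] V.P_conv[of n] less.prems s0_bounds agree[of n] agree_set[of n] by simp
qed

lemma c_s0: "c s0 = 1" "c' s0 = 0"
proof -
  have e: "(\<Sum>s\<in>{s\<in>P. s < s0}. c' (s0 - s)) = (\<Sum>s\<in>{s\<in>P. s < s0}. c (s0 - s))"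
    by (intro sum.cong refl c_agree) (auto dest: W.P_bounds)
  have "0 \<le> (\<Sum>s\<in>{s\<in>P. s < s0}. c (s0 - s))" by (intro sum_nonneg W.c_nonneg)
  moreover have "1 = c s0 + (\<Sum>s\<in>{s\<in>P. s < s0}. c (s0 - s))"
    using W.P_conv[of s0] s0_bounds s0_P by simp
  moreover have "0 = c' s0 + (\<Sum>s\<in>{s\<in>P. s < s0}. c (s0 - s))"
    using V.P_conv[of s0] s0_bounds s0_P' agree_set[of s0] e by simp
  ultimately show "c s0 = 1" "c' s0 = 0" using V.c_nonneg[of s0] by linarith+
qed

lemma D_step: "k \<le> n \<Longrightarrow> D (Suc n) = q * D n - \<delta> (Suc n - k)"
  unfolding D_def \<delta>_def by (simp add: W.h_step V.h_step algebra_simps)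

lemma D_zero: "n < k + s0 \<Longrightarrow> D n = 0"
proof (induction n)
  case 0 then show ?case using W.h_zero V.h_zero W.k1 by (simp add: D_def)
next
  case (Suc n)
  consider "Suc n < k" | "Suc n = k" | "k \<le> n" by linarith
  then show ?case
  proof cases
    case 3
    then have "\<delta> (Suc n - k) = 0" using c_agree[of "Suc n - k"] Suc.prems by (simp add: \<delta>_def)
    then show ?thesis using D_step[OF 3] Suc by simp
  qed (auto simp: D_def W.h_zero V.h_zero W.h_k V.h_k)
qed

lemma D_first: "D (k + s0) = - 1"
proof -
  have "D (Suc (k + s0 - 1)) = q * D (k + s0 - 1) - \<delta> (Suc (k + s0 - 1) - k)"
    using s0_bounds by (intro D_step) simp
  then show ?thesis using s0_bounds D_zero[of "k + s0 - 1"] c_s0 by (simp add: \<delta>_def)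
qed

lemma D_neg: "k + s0 \<le> n \<Longrightarrow> n \<le> 2 * k \<Longrightarrow> D n \<le> - 1"
proof (induction n rule: dec_induct)
  case base then show ?case using D_first by simp
next
  case (step n)
  have "c' (Suc n - k) \<le> 1" using step by (intro V.c_le_one) auto
  then have "- 1 \<le> \<delta> (Suc n - k)" using W.c_nonneg[of "Suc n - k"] unfolding \<delta>_def by linarith
  moreover have "q * D n \<le> q * (- 1)" using step W.q2 by (intro mult_left_mono) auto
  ultimately show ?case using D_step[of n] step W.q2 by simp
qed

section \<open>Comparing the return counts of the two words\<close>

lemma telescope:
  "k + s \<le> y \<Longrightarrow> D y = (q - 1) * (\<Sum>i=1..s. D (y - i)) + D (y - s) - (\<Sum>i=1..s. \<delta> (y - k + 1 - i))"
proof (induction s)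
  case 0 then show ?case by simp
next
  case (Suc s)
  have "D (Suc (y - Suc s)) = q * D (y - Suc s) - \<delta> (Suc (y - Suc s) - k)"
    using Suc.prems by (intro D_step) simp
  moreover have "Suc (y - Suc s) = y - s" "Suc (y - Suc s) - k = y - k + 1 - Suc s" using Suc.prems by auto
  ultimately have "D (y - s) = q * D (y - Suc s) - \<delta> (y - k + 1 - Suc s)" by metis
  then show ?case using Suc by (simp add: algebra_simps)
qed

definition Lin :: "nat \<Rightarrow> int" where
  "Lin y = (\<Sum>i=1..<s0. (q - 1 - c i) * D (y - i)) + (q - 1) * D (y - s0)"

text \<open>What \<open>Lin\<close> leaves of the bound for \<open>\<delta> y\<close>: the
  overshoots of both words, the \<open>c\<close> terms freed by telescoping \<open>D\<close> over
  \<open>s0\<close> steps, and the primes of \<open>w\<close> beyond \<open>s0\<close>.\<close>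

definition Q :: "nat \<Rightarrow> int" where
  "Q y = (\<Sum>l=1..s0. c l * W.B y l) - (\<Sum>l=1..<k. c' l * V.B y l)
      - (\<Sum>i=1..s0. c (y - k + 1 - i)) - (\<Sum>l=s0+1..<k. c l * c (y - l))"

lemma split_at_s0:
  fixes f :: "nat \<Rightarrow> int"
  shows "(\<Sum>l=1..<k. f l) = (\<Sum>l=1..<s0. f l) + f s0 + (\<Sum>l=s0+1..<k. f l)"
proof -
  have "{1..<k} = {1..<s0} \<union> insert s0 {s0+1..<k}" using s0_bounds by auto
  then show ?thesis by (simp add: sum.union_disjoint)
qed

lemma sum_to_s0:
  fixes f :: "nat \<Rightarrow> int"
  shows "(\<Sum>l=1..s0. f l) = (\<Sum>l=1..<s0. f l) + f s0"
  using s0_bounds by (simp add: sum.last_plus)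

text \<open>The window below \<open>y - s0\<close> is split so that one piece can absorb the primes
  of \<open>w'\<close> beyond \<open>s0\<close> and the other the \<open>c'\<close> terms of
  \<open>telescope\<close>.\<close>

lemma slack_sum:
  assumes "k \<le> y - s0" "s0 \<le> y"
  shows "(\<Sum>i=1..<k. f (y - s0 - i)) = (\<Sum>l=s0+1..<k. f (y - l)) + (\<Sum>i=1..s0. (f (y - k + 1 - i) :: int))"
proof -
  have "(\<Sum>i=1..<k. f (y - s0 - i)) = (\<Sum>l=s0+1..<s0+k. f (y - l))"
    by (rule sum.reindex_bij_witness[of _ "\<lambda>l. l - s0" "\<lambda>i. i + s0"]) (auto simp: add.commute)
  also have "{s0+1..<s0+k} = {s0+1..<k} \<union> {k..<s0+k}" using s0_bounds by auto
  also have "(\<Sum>l\<in>\<dots>. f (y - l)) = (\<Sum>l=s0+1..<k. f (y - l)) + (\<Sum>l=k..<s0+k. f (y - l))"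
    by (intro sum.union_disjoint) auto
  also have "(\<Sum>l=k..<s0+k. f (y - l)) = (\<Sum>i=1..s0. f (y - k + 1 - i))"
    using assms by (intro sum.reindex_bij_witness[of _ "\<lambda>i. i + k - 1" "\<lambda>l. l + 1 - k"]) auto
  finally show ?thesis .
qed

text \<open>Expand \<open>c y\<close> and \<open>c' y\<close> over primes. Primes below
  \<open>s0\<close> are common and yield multiples of \<open>D\<close>. The prime \<open>s0\<close>
  occurs only in \<open>w\<close> and gives \<open>- h (y - s0)\<close>, which with the extra
  \<open>D (y - s0)\<close> of \<open>telescope\<close> leaves \<open>- h' (y - s0)\<close>; by
  domination this pays for the later primes of \<open>w'\<close> and the telescoped
  \<open>c'\<close> terms. Domination of \<open>h'\<close> at \<open>y - s0\<close> dictates the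
  range.\<close>

lemma \<delta>_le_Lin_Q:
  assumes y: "3 * k + s0 \<le> y"
  shows "\<delta> y \<le> Lin y + Q y"
proof -
  have y2: "2 * k \<le> y" using y by simp
  have 1: "c y = h y - (\<Sum>l=1..<s0. c l * h (y - l)) - h (y - s0) + (\<Sum>l=1..s0. c l * W.B y l)
      - (\<Sum>l=s0+1..<k. c l * (h (y - l) - W.B y l))"
    unfolding W.c_expand[OF y2] split_at_s0 sum_to_s0
    by (simp add: c_s0 right_diff_distrib sum_subtractf)
  have "(\<Sum>l=s0+1..<k. c l * c (y - l)) \<le> (\<Sum>l=s0+1..<k. c l * (h (y - l) - W.B y l))"
    using y2 by (intro sum_mono mult_left_mono W.B_le W.c_nonneg) auto
  moreover have 2: "c' y = h' y - (\<Sum>l=1..<s0. c l * h' (y - l)) - (\<Sum>l=s0+1..<k. c' l * h' (y - l))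
      + (\<Sum>l=1..<k. c' l * V.B y l)"
  proof -
    have "(\<Sum>l=1..<s0. c' l * h' (y - l)) = (\<Sum>l=1..<s0. c l * h' (y - l))"
      by (intro sum.cong refl) (simp add: c_agree)
    then show ?thesis
      unfolding V.c_expand[OF y2] right_diff_distrib sum_subtractf
      unfolding split_at_s0[of "\<lambda>l. c' l * h' (y - l)"] by (simp add: c_s0)
  qed
  moreover have "(\<Sum>l=s0+1..<k. c' l * h' (y - l)) + (\<Sum>i=1..s0. c' (y - k + 1 - i)) \<le> h' (y - s0)"
  proof -
    have "(\<Sum>l=s0+1..<k. c' l * h' (y - l)) \<le> (\<Sum>l=s0+1..<k. h' (y - l))"
    proof (intro sum_mono)
      fix l assume "l \<in> {s0+1..<k}"
      then have "c' l * h' (y - l) \<le> 1 * h' (y - l)" by (intro mult_right_mono V.c_le_one) auto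
      then show "c' l * h' (y - l) \<le> h' (y - l)" by simp
    qed
    moreover have "(\<Sum>i=1..s0. c' (y - k + 1 - i)) \<le> (\<Sum>i=1..s0. h' (y - k + 1 - i))"
      using y by (intro sum_mono V.c_le_h) auto
    moreover have "(\<Sum>i=1..<k. h' (y - s0 - i)) \<le> h' (y - s0)"
      using y by (intro V.sum_prev_le) auto
    ultimately show ?thesis using slack_sum[of y h'] y by simp
  qed
  moreover have "D y = (q - 1) * (\<Sum>i=1..<s0. D (y - i)) + (q - 1) * D (y - s0) + D (y - s0)
      - (\<Sum>i=1..s0. c (y - k + 1 - i)) + (\<Sum>i=1..s0. c' (y - k + 1 - i))"
  proof -
    have "(\<Sum>i=1..s0. \<delta> (y - k + 1 - i)) = (\<Sum>i=1..s0. c (y - k + 1 - i)) - (\<Sum>i=1..s0. c' (y - k + 1 - i))"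
      by (simp add: \<delta>_def sum_subtractf)
    then show ?thesis using telescope[of s0 y] y unfolding sum_to_s0[of "\<lambda>i. D (y - i)"]
      by (simp add: distrib_left)
  qed
  moreover have "Lin y = (q - 1) * (\<Sum>i=1..<s0. D (y - i)) - (\<Sum>i=1..<s0. c i * h (y - i))
      + (\<Sum>i=1..<s0. c i * h' (y - i)) + (q - 1) * D (y - s0)"
    unfolding Lin_def D_def
    by (simp add: sum_distrib_left sum_subtractf[symmetric] sum.distrib[symmetric] algebra_simps)
  ultimately show ?thesis using 1 unfolding Q_def \<delta>_def D_def by linarith
qed

text \<open>The coefficients \<open>q - 1 - c i\<close> are nonnegative, so \<open>D\<close> may be
  replaced by its positive part. The subtracted sum is a reserve, spent in
  \<open>\<delta>_le_common\<close>.\<close>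

lemma Lin_le:
  "Lin y \<le> (q - 1) * (\<Sum>i=1..s0. pos (D (y - i))) - (\<Sum>i=1..<s0. c i * pos (D (y - i)))"
proof -
  have "(\<Sum>i=1..<s0. (q - 1 - c i) * D (y - i)) \<le> (\<Sum>i=1..<s0. (q - 1 - c i) * pos (D (y - i)))"
  proof (intro sum_mono mult_left_mono le_pos)
    fix i assume "i \<in> {1..<s0}"
    then have "c i \<le> 1" using s0_bounds by (intro W.c_le_one) auto
    then show "0 \<le> q - 1 - c i" using W.q2 by simp
  qed
  also have "\<dots> = (q - 1) * (\<Sum>i=1..<s0. pos (D (y - i))) - (\<Sum>i=1..<s0. c i * pos (D (y - i)))"
    by (simp add: sum_distrib_left sum_subtractf[symmetric] left_diff_distrib)
  finally have "(\<Sum>i=1..<s0. (q - 1 - c i) * D (y - i)) \<le> \<dots>" .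
  moreover have "(q - 1) * D (y - s0) \<le> (q - 1) * pos (D (y - s0))"
    using W.q2 by (intro mult_left_mono) auto
  ultimately show ?thesis unfolding Lin_def sum_to_s0 by (simp add: distrib_left)
qed

lemma window_s0:
  assumes "(\<Sum>i=1..<k. pos (D (y - i))) \<le> pos (D y)"
  shows "(q - 1) * (\<Sum>i=1..s0. pos (D (y - i))) \<le> (q - 1) * pos (D y)"
proof -
  have "(\<Sum>i=1..s0. pos (D (y - i))) \<le> (\<Sum>i=1..<k. pos (D (y - i)))"
    using s0_bounds by (intro sum_mono2) auto
  then show ?thesis using assms W.q2 by (intro mult_left_mono) auto
qed

lemma sum_c_D_nonneg: "0 \<le> (\<Sum>i=1..<s0. c i * pos (D (y - i)))"
  by (intro sum_nonneg mult_nonneg_nonneg W.c_nonneg pos_nonneg)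

lemma B_s0_le:
  assumes "k + s0 \<le> y"
  shows "W.B y s0 \<le> (\<Sum>i=1..s0. c (y - k + 1 - i))"
  unfolding W.B_def
  using assms by (intro sum_subset_reindex[of "\<lambda>t. s0 + t + 1 - k"])
    (auto simp: inj_on_def W.c_nonneg dest!: W.P_bounds intro!: arg_cong[of _ _ c])

text \<open>The only prime of \<open>w\<close> up to \<open>s0\<close> is \<open>s0\<close> itself,
  and its overshoot is covered by \<open>B_s0_le\<close>; hence \<open>Q y \<le> 0\<close>.\<close>

lemma \<delta>_le_no_common:
  assumes y: "3 * k + s0 \<le> y" and nc: "\<And>s. s \<in> P \<Longrightarrow> s0 \<le> s"
    and super: "(\<Sum>i=1..<k. pos (D (y - i))) \<le> pos (D y)"
  shows "\<delta> y \<le> (q - 1) * pos (D y)"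
proof -
  have c0: "c l = 0" if "l \<in> {1..<s0}" for l
    using that s0_bounds nc by (intro W.c_below_Min) (auto intro: less_le_trans)
  have "(\<Sum>l=1..s0. c l * W.B y l) = W.B y s0"
    unfolding sum_to_s0 by (simp add: c_s0 c0)
  moreover have "0 \<le> (\<Sum>l=1..<k. c' l * V.B y l)"
    by (intro sum_nonneg mult_nonneg_nonneg V.c_nonneg V.B_nonneg)
  moreover have "0 \<le> (\<Sum>l=s0+1..<k. c l * c (y - l))"
    by (intro sum_nonneg mult_nonneg_nonneg W.c_nonneg)
  moreover have "W.B y s0 \<le> (\<Sum>i=1..s0. c (y - k + 1 - i))" using y by (intro B_s0_le) simp
  ultimately have "Q y \<le> 0" unfolding Q_def by linarith
  then show ?thesis using \<delta>_le_Lin_Q[OF y] Lin_le[of y] window_s0[OF super] sum_c_D_nonneg[of y] by linarith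
qed

text \<open>With at most one prime, \<open>h'\<close> dominates its window already from
  \<open>k\<close>, so the estimate starts at \<open>k + s0\<close>. Since \<open>c_expand\<close>
  requires \<open>2 * k \<le> y\<close>, the sum over \<open>P\<close> is bounded below by the part
  \<open>l = s0\<close> of \<open>P_sum\<close> instead.\<close>

lemma \<delta>_le_one_prime:
  assumes y: "k + s0 \<le> y" and nc: "\<And>s. s \<in> P \<Longrightarrow> s0 \<le> s"
    and one: "(\<Sum>i=1..<k. c' i) \<le> 1"
    and super: "(\<Sum>i=1..<k. pos (D (y - i))) \<le> pos (D y)"
  shows "\<delta> y \<le> (q - 1) * pos (D y)"
proof -
  have c0: "c l = 0" if "l \<in> {1..<s0}" for l
    using that s0_bounds nc by (intro W.c_below_Min) (auto intro: less_le_trans)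
  define n' where "n' = y - s0"
  have n': "k \<le> n'" using y by (simp add: n'_def)
  have hn': "h n' = c n' + (\<Sum>t\<in>{t\<in>P. s0 + t < k}. c (n' - t)) + W.B y s0"
  proof -
    have "(\<Sum>t\<in>P. c (n' - t)) = (\<Sum>t\<in>{t\<in>P. s0 + t < k} \<union> {t\<in>P. k \<le> s0 + t}. c (n' - t))"
      by (intro sum.cong) auto
    also have "\<dots> = (\<Sum>t\<in>{t\<in>P. s0 + t < k}. c (n' - t)) + W.B y s0"
      unfolding W.B_def n'_def by (intro sum.union_disjoint) auto
    finally show ?thesis using W.h_conv[OF n'] by simp
  qed
  have "c y = h y - (\<Sum>s\<in>P. c (y - s))" using W.h_conv[of y] y by simp
  moreover have "h n' - W.B y s0 \<le> (\<Sum>s\<in>P. c (y - s))"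
  proof -
    have "h n' - W.B y s0 = c s0 * (c (y - s0) + (\<Sum>t\<in>{t\<in>P. s0 + t < k}. c (y - (s0 + t))))"
      unfolding hn' by (simp add: c_s0 n'_def)
    also have "\<dots> \<le> (\<Sum>l=1..<k. c l * (c (y - l) + (\<Sum>t\<in>{t\<in>P. l + t < k}. c (y - (l + t)))))"
      using s0_bounds
      by (intro member_le_sum[of s0 "{1..<k}" "\<lambda>l. c l * (c (y - l) + (\<Sum>t\<in>{t\<in>P. l + t < k}. c (y - (l + t))))"])
        (auto intro!: mult_nonneg_nonneg add_nonneg_nonneg sum_nonneg W.c_nonneg)
    also have "\<dots> = (\<Sum>s\<in>P. c (y - s))" by (rule W.P_sum[symmetric])
    finally show ?thesis .
  qed
  moreover have "W.B y s0 \<le> (\<Sum>i=1..s0. c (y - k + 1 - i))" using y by (rule B_s0_le)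
  moreover have "c' y = h' y - (\<Sum>s\<in>P'. c' (y - s))" using V.h_conv[of y] y by simp
  moreover have "D y = (q - 1) * (\<Sum>i=1..s0. D (y - i)) + D n'
      - (\<Sum>i=1..s0. c (y - k + 1 - i)) + (\<Sum>i=1..s0. c' (y - k + 1 - i))"
    using telescope[of s0 y] y unfolding \<delta>_def sum_subtractf n'_def by simp
  moreover have "(\<Sum>s\<in>P'. c' (y - s)) + (\<Sum>i=1..s0. c' (y - k + 1 - i)) \<le> h' n'"
  proof -
    have P'_gt: "s0 < s" if "s \<in> P'" for s
      using that s0_P' agree[of s] nc[of s] by (metis linorder_neqE_nat not_le)
    have "(\<Sum>s\<in>P'. c' (y - s)) \<le> (\<Sum>l=s0+1..<k. c' (y - l))"
    proof (rule sum_mono2)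
      show "P' \<subseteq> {s0+1..<k}" using P'_gt V.P_bounds by fastforce
    qed (auto simp: V.c_nonneg)
    then have "(\<Sum>s\<in>P'. c' (y - s)) + (\<Sum>i=1..s0. c' (y - k + 1 - i)) \<le> (\<Sum>j=1..<k. c' (n' - j))"
      using slack_sum[of y c'] y unfolding n'_def by simp
    \<comment> \<open>The comparison \<open>c' \<le> h'\<close> can fail only at an index below
      \<open>k\<close> that is a prime of \<open>w'\<close>. There is at most one, and as it lies
      above \<open>n' - k\<close>, the unit it costs is supplied by
      \<open>sum_prev_less\<close>.\<close>
    also have "\<dots> \<le> h' n'"
    proof (cases "\<exists>j\<in>{1..<k}. n' - j < k \<and> c' (n' - j) \<noteq> 0")
      case False
      have "(\<Sum>j=1..<k. c' (n' - j)) \<le> (\<Sum>j=1..<k. h' (n' - j))"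
      proof (intro sum_mono)
        fix j assume "j \<in> {1..<k}"
        then show "c' (n' - j) \<le> h' (n' - j)"
          using False V.c_le_h[of "n' - j"] V.h_nonneg[of "n' - j"] by (cases "n' - j < k") auto
      qed
      also have "\<dots> \<le> h' n'" using n' one by (rule V.sum_prev_le_one_prime)
      finally show ?thesis .
    next
      case True
      then obtain j0 where j0: "j0 \<in> {1..<k}" "n' - j0 < k" "c' (n' - j0) \<noteq> 0" by blast
      define \<pi> where "\<pi> = n' - j0"
      have \<pi>: "1 \<le> \<pi>" "\<pi> < k" "1 \<le> c' \<pi>" using j0 n' V.c_nonneg[of \<pi>] by (auto simp: \<pi>_def)
      have uniq: "c' i = 0" if "1 \<le> i" "i < k" "i \<noteq> \<pi>" for i
      proof -
        have "(\<Sum>i=1..<k. c' i) = c' \<pi> + (\<Sum>i\<in>{1..<k}-{\<pi>}. c' i)" using \<pi> by (intro sum.remove) auto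
        moreover have "c' i \<le> (\<Sum>i\<in>{1..<k}-{\<pi>}. c' i)"
          using that by (intro member_le_sum) (auto simp: V.c_nonneg)
        ultimately show ?thesis using one \<pi> V.c_nonneg[of i] by linarith
      qed
      have "(\<Sum>j=1..<k. c' (n' - j)) \<le> (\<Sum>j=1..<k. h' (n' - j) + of_bool (j = j0))"
      proof (intro sum_mono)
        fix j assume j: "j \<in> {1..<k}"
        show "c' (n' - j) \<le> h' (n' - j) + of_bool (j = j0)"
        proof (cases "n' - j < k")
          case True
          have "1 \<le> n' - j" using j n' by auto
          have "c' (n' - j) \<le> of_bool (j = j0)"
          proof (cases "j = j0")
            case True
            then show ?thesis using V.c_le_one[of "n' - j"] \<open>1 \<le> n' - j\<close> \<open>n' - j < k\<close> by simp
          next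
            case False
            then have "n' - j \<noteq> \<pi>" using j j0 n' by (auto simp: \<pi>_def)
            then show ?thesis using uniq[of "n' - j"] True \<open>1 \<le> n' - j\<close> by simp
          qed
          then show ?thesis using V.h_nonneg[of "n' - j"] by linarith
        next
          case False
          then have "c' (n' - j) \<le> h' (n' - j)" by (intro V.c_le_h) simp
          moreover have "0 \<le> (of_bool (j = j0) :: int)" by simp
          ultimately show ?thesis by linarith
        qed
      qed
      also have "\<dots> = (\<Sum>j=1..<k. h' (n' - j)) + 1"
        using j0(1) by (simp add: sum.distrib)
      also have "\<dots> \<le> h' n'"
      proof (rule V.sum_prev_less[OF n'])
        show "n' < 2 * k" using j0 by auto
        fix i assume i: "1 \<le> i" "i \<le> n' - k"
        then show "c' i = 0" using j0 by (intro uniq) (auto simp: \<pi>_def)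
      qed
      finally show ?thesis .
    qed
    finally show ?thesis .
  qed
  moreover have "D n' = h n' - h' n'" by (simp add: D_def)
  ultimately have "\<delta> y \<le> (q - 1) * (\<Sum>i=1..s0. D (y - i))"
    unfolding \<delta>_def D_def[of y] by linarith
  also have "\<dots> \<le> (q - 1) * (\<Sum>i=1..s0. pos (D (y - i)))"
    using W.q2 by (intro mult_left_mono sum_mono) auto
  also have "\<dots> \<le> (q - 1) * pos (D y)" by (rule window_s0[OF super])
  finally show ?thesis .
qed

text \<open>Period 1 makes every shift a period. Differencing \<open>h_conv\<close> over one step
  then gives \<open>c y = (q - 1) * h (y - 1)\<close>, the smallest value that
  \<open>c_lower\<close> permits.\<close>

lemma \<delta>_le_period_one:
  assumes y: "k + 1 \<le> y" and s0: "s0 = 1"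
    and super: "(\<Sum>i=1..<k. pos (D (y - i))) \<le> pos (D y)"
  shows "\<delta> y \<le> (q - 1) * pos (D y)"
proof -
  have "n \<in> P" if "1 \<le> n" "n < k" for n
    using that
  proof (induction n rule: dec_induct)
    case base then show ?case using s0_P s0 by simp
  next
    case (step n)
    have "c 1 \<le> (\<Sum>s\<in>{s\<in>P. s < Suc n}. c (Suc n - s))"
      using member_le_sum[of n "{s\<in>P. s < Suc n}" "\<lambda>s. c (Suc n - s)"] step W.c_nonneg by simp
    then have "1 \<le> (of_bool (Suc n \<in> P) :: int)"
      using W.P_conv[of "Suc n"] step c_s0 s0 W.c_nonneg[of "Suc n"] by simp
    then show ?case by (cases "Suc n \<in> P") auto
  qed
  then have P: "P = {1..<k}" using W.P_sub by auto
  have k2: "2 \<le> k" using s0_bounds by simp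
  have "h (y - 1) = c (y - 1) + (\<Sum>s=1..<k. c (y - 1 - s))" using W.h_conv[of "y - 1"] y P by simp
  moreover have "h y = c y + (\<Sum>s=1..<k. c (y - s))" using W.h_conv[of y] y P by simp
  moreover have "h y = q * h (y - 1) - c (y - k)" using W.h_step[of "y - 1"] y by simp
  moreover have "(\<Sum>s=1..<k. c (y - s)) = (\<Sum>s=1..<k. c (y - 1 - s)) + c (y - 1) - c (y - k)"
    using window_shift[of "k - 1" "y - 1" c] y k2 by simp
  ultimately have "c y = (q - 1) * h (y - 1)" by (simp add: left_diff_distrib)
  moreover have "(q - 1) * h' (y - 1) \<le> c' y" using V.c_lower[of "y - 1"] y by simp
  ultimately have "\<delta> y \<le> (q - 1) * D (y - 1)" unfolding \<delta>_def D_def by (simp add: right_diff_distrib)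
  also have "\<dots> \<le> (q - 1) * (\<Sum>i=1..s0. pos (D (y - i)))"
    using W.q2 s0 by (intro mult_left_mono) auto
  also have "\<dots> \<le> (q - 1) * pos (D y)" by (rule window_s0[OF super])
  finally show ?thesis .
qed

end

subsection \<open>A common period below the first difference\<close>

context corr_pair
begin

context
  fixes p :: nat
  assumes p_def: "p = Min P" and p_less: "p < s0"
begin

lemma p_P: "p \<in> P" "p \<in> P'"
proof -
  have "Min P \<in> P" using s0_P by (intro Min_in) auto
  then show "p \<in> P" "p \<in> P'" using agree[of p] p_less unfolding p_def by auto
qed

lemma p_le: "s \<in> P \<Longrightarrow> p \<le> s"
  unfolding p_def by simp

lemma c_p: "c p = 1" "c' p = 1"
  using W.c_Min c_agree[of p] p_P p_less W.P_bounds[of p] unfolding p_def by auto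

lemma gap: "1 \<le> l \<Longrightarrow> l < k \<Longrightarrow> c l \<noteq> 0 \<Longrightarrow> l \<noteq> p \<Longrightarrow> k + 2 \<le> p + l"
  using W.prime_gap unfolding p_def by blast

lemma p_s0: "k + 2 \<le> p + s0"
  using gap[of s0] c_s0 s0_bounds p_less by simp

lemma p_ge3: "3 \<le> p"
  using p_s0 s0_bounds by simp

lemma one_notin_P: "1 \<notin> P"
  using p_le[of 1] p_ge3 by auto

lemma prime_ge_p: "1 \<le> l \<Longrightarrow> l < k \<Longrightarrow> c l \<noteq> 0 \<Longrightarrow> p \<le> l"
  using W.c_le_bool[of l] W.c_nonneg[of l] p_le[of l] by (cases "l \<in> P") auto

lemma prime_add_s0: "1 \<le> l \<Longrightarrow> l < k \<Longrightarrow> c l \<noteq> 0 \<Longrightarrow> k + 2 \<le> l + s0"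
  using gap[of l] p_s0 p_less by (cases "l = p") auto

text \<open>A period that is not prime is a period \<open>s\<close> plus a prime. The prime must be
  \<open>p\<close>, since by \<open>gap\<close> any other one plus a period exceeds
  \<open>k\<close>. Then \<open>s < s0\<close> is a common period, and \<open>s + p\<close> would be
  a period of \<open>w'\<close> too.\<close>

lemma diff_prime:
  assumes "\<pi> \<in> P" "\<pi> \<notin> P'"
  shows "c \<pi> = 1"
proof (rule ccontr)
  have b: "1 \<le> \<pi>" "\<pi> < k" using W.P_bounds assms by auto
  assume "c \<pi> \<noteq> 1"
  then have "c \<pi> = 0" using W.c_le_one[of \<pi>] W.c_nonneg[of \<pi>] b by simp
  then have "(\<Sum>s\<in>{s\<in>P. s < \<pi>}. c (\<pi> - s)) \<noteq> 0" using W.P_conv[of \<pi>] b assms by simp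
  then obtain s where s: "s \<in> P" "s < \<pi>" "c (\<pi> - s) \<noteq> 0" by (auto elim: sum.not_neutral_contains_not_neutral)
  have "\<pi> - s = p"
  proof (rule ccontr)
    assume "\<pi> - s \<noteq> p"
    then have "k + 2 \<le> p + (\<pi> - s)" using s b by (intro gap) auto
    then show False using s p_le[of s] b by simp
  qed
  then have \<pi>: "\<pi> = s + p" using s by simp
  then have "s < s0" using p_s0 b by simp
  then have "s \<in> P'" using s agree by blast
  then have "c' p \<le> (\<Sum>t\<in>{t\<in>P'. t < \<pi>}. c' (\<pi> - t))"
    using member_le_sum[of s "{t\<in>P'. t < \<pi>}" "\<lambda>t. c' (\<pi> - t)"] s V.c_nonneg \<pi> by simp
  then show False using V.P_conv[of \<pi>] b assms c_p V.c_nonneg[of \<pi>] by simp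
qed

text \<open>The overshooting sums of a common prime and a common period are the arguments at which
  the overshoots of both words can be subtracted, leaving values of \<open>\<delta>\<close>.\<close>

definition pairs :: "(nat \<Rightarrow> int) \<Rightarrow> int" where
  "pairs F = (\<Sum>\<sigma>=1..<s0. c \<sigma> * (\<Sum>t\<in>{t\<in>P \<inter> P'. k \<le> \<sigma> + t}. F (\<sigma> + t)))"

definition S :: "nat set" where "S = {\<sigma>\<in>{1..<s0}. c \<sigma> \<noteq> 0 \<and> \<sigma> \<noteq> p}"

lemma finite_S [simp]: "finite S" unfolding S_def by simp

lemma pairs_mono:
  assumes "\<And>u. k \<le> u \<Longrightarrow> u + 3 \<le> 2 * k \<Longrightarrow> F u \<le> G u"
  shows "pairs F \<le> pairs G"
  unfolding pairs_def using s0_bounds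
  by (intro sum_mono mult_left_mono W.c_nonneg assms) (auto dest!: W.P_bounds)

lemma pairs_add: "pairs (\<lambda>u. F u + G u) = pairs F + pairs G"
  unfolding pairs_def by (simp add: sum.distrib distrib_left)

lemma pairs_scale: "pairs (\<lambda>u. a * F u) = a * pairs F"
  unfolding pairs_def by (simp add: sum_distrib_left mult.left_commute)

text \<open>The sums \<open>p + t\<close> may hit \<open>k\<close> itself, so \<open>p\<close> costs
  \<open>f x\<close> plus a window, at most \<open>2 * f x\<close>. Every other common prime gives
  sums strictly above \<open>k\<close> by \<open>gap\<close> and costs one window.\<close>

lemma pairs_le:
  fixes f :: "nat \<Rightarrow> int"
  assumes nn: "\<And>n. 0 \<le> f n" and super: "(\<Sum>i=1..<k. f (x - i)) \<le> f x"
  shows "pairs (\<lambda>u. f (x + k - u)) \<le> (2 + int (card S)) * f x"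
proof -
  define g where "g \<sigma> = (\<Sum>t\<in>{t\<in>P \<inter> P'. k \<le> \<sigma> + t}. f (x + k - (\<sigma> + t)))" for \<sigma>
  have g_nn: "0 \<le> g \<sigma>" for \<sigma> unfolding g_def by (intro sum_nonneg nn)
  have "pairs (\<lambda>u. f (x + k - u)) = (\<Sum>\<sigma>\<in>insert p S. c \<sigma> * g \<sigma>)"
    unfolding pairs_def g_def[symmetric] using p_less W.P_bounds[OF p_P(1)]
    by (intro sum.mono_neutral_right) (auto simp: S_def)
  also have "\<dots> \<le> (\<Sum>\<sigma>\<in>insert p S. g \<sigma>)"
  proof (intro sum_mono)
    fix \<sigma> assume "\<sigma> \<in> insert p S"
    then have "c \<sigma> * g \<sigma> \<le> 1 * g \<sigma>"
      using W.P_bounds[OF p_P(1)] s0_bounds by (intro mult_right_mono W.c_le_one g_nn) (auto simp: S_def)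
    then show "c \<sigma> * g \<sigma> \<le> g \<sigma>" by simp
  qed
  also have "\<dots> = g p + (\<Sum>\<sigma>\<in>S. g \<sigma>)" by (intro sum.insert) (auto simp: S_def)
  also have "g p \<le> 2 * f x"
  proof -
    have "g p \<le> (\<Sum>i=0..<k. f (x - i))"
      unfolding g_def using p_less s0_bounds nn
      by (intro sum_subset_reindex[of "\<lambda>t. p + t - k"]) (auto simp: inj_on_def dest!: W.P_bounds intro!: arg_cong[of _ _ f])
    also have "\<dots> = f x + (\<Sum>i=1..<k. f (x - i))"
      using W.k1 by (simp add: sum.atLeast_Suc_lessThan)
    finally show ?thesis using super by simp
  qed
  also have "(\<Sum>\<sigma>\<in>S. g \<sigma>) \<le> (\<Sum>\<sigma>\<in>S. f x)"
  proof (intro sum_mono)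
    fix \<sigma> assume \<sigma>: "\<sigma> \<in> S"
    then have g2: "k + 2 \<le> p + \<sigma>" using gap[of \<sigma>] s0_bounds by (auto simp: S_def)
    have "k < \<sigma> + t \<and> \<sigma> + t < 2 * k" if "t \<in> P" for t
      using g2 p_le[OF that] W.P_bounds[OF that] \<sigma> s0_bounds by (auto simp: S_def)
    then have "g \<sigma> \<le> (\<Sum>i=1..<k. f (x - i))"
      unfolding g_def using nn
      by (intro sum_subset_reindex[of "\<lambda>t. \<sigma> + t - k"])
        (fastforce simp: inj_on_def intro!: arg_cong[of _ _ f])+
    then show "g \<sigma> \<le> f x" using super by simp
  qed
  finally show ?thesis by (simp add: algebra_simps)
qed

text \<open>\<open>S\<close> lies above \<open>k + 1 - p\<close> by \<open>gap\<close>, above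
  \<open>p\<close>, and below \<open>s0\<close>. Adding the two resulting bounds eliminates
  \<open>p\<close> and gives the first claim.\<close>

lemma card_S: "2 * card S + 5 \<le> k" "card S + p + 2 \<le> k"
proof -
  have "S \<subseteq> {k + 2 - p..<s0}" using gap s0_bounds by (force simp: S_def)
  then have "card S \<le> s0 - (k + 2 - p)" by (metis card_atLeastLessThan card_mono finite_atLeastLessThan)
  moreover have "S \<subseteq> {p+1..<s0}"
  proof
    fix \<sigma> assume "\<sigma> \<in> S"
    then show "\<sigma> \<in> {p+1..<s0}" using prime_ge_p[of \<sigma>] s0_bounds by (auto simp: S_def)
  qed
  then have "card S \<le> s0 - (p + 1)" by (metis card_atLeastLessThan card_mono finite_atLeastLessThan)
  ultimately show "2 * card S + 5 \<le> k" "card S + p + 2 \<le> k" using s0_bounds p_less p_s0 by auto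
qed

text \<open>The arguments lie in the window below \<open>z - 1\<close>, so domination bounds the sum
  by \<open>h (z - 1)\<close>, which \<open>h_prev_le_c\<close> puts below \<open>c z\<close>. The
  offsets \<open>a\<close>, \<open>b\<close> let one statement serve both the period
  \<open>s0\<close> and the later periods that \<open>w'\<close> lacks.\<close>

lemma conv_le:
  assumes z: "3 * k + 1 \<le> z" and gap: "\<And>\<sigma>. 1 \<le> \<sigma> \<Longrightarrow> \<sigma> < s0 \<Longrightarrow> c \<sigma> \<noteq> 0 \<Longrightarrow> a + 2 \<le> \<sigma> + b \<and> \<sigma> + b \<le> a + k"
  shows "(\<Sum>\<sigma>=1..<s0. c \<sigma> * c (z + a - (\<sigma> + b))) \<le> c z"
proof -
  have "(\<Sum>\<sigma>=1..<s0. c \<sigma> * c (z + a - (\<sigma> + b))) = (\<Sum>\<sigma>\<in>{\<sigma>\<in>{1..<s0}. c \<sigma> \<noteq> 0}. c \<sigma> * c (z + a - (\<sigma> + b)))"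
    by (intro sum.mono_neutral_right) auto
  also have "\<dots> \<le> (\<Sum>\<sigma>\<in>{\<sigma>\<in>{1..<s0}. c \<sigma> \<noteq> 0}. h (z + a - (\<sigma> + b)))"
  proof (intro sum_mono)
    fix \<sigma> assume \<sigma>: "\<sigma> \<in> {\<sigma>\<in>{1..<s0}. c \<sigma> \<noteq> 0}"
    then have "a + 2 \<le> \<sigma> + b \<and> \<sigma> + b \<le> a + k" using gap by simp
    then have "c (z + a - (\<sigma> + b)) \<le> h (z + a - (\<sigma> + b))" using z by (intro W.c_le_h) auto
    moreover have "c \<sigma> * c (z + a - (\<sigma> + b)) \<le> 1 * c (z + a - (\<sigma> + b))"
      using \<sigma> s0_bounds by (intro mult_right_mono W.c_le_one W.c_nonneg) auto
    ultimately show "c \<sigma> * c (z + a - (\<sigma> + b)) \<le> h (z + a - (\<sigma> + b))" by simp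
  qed
  also have "\<dots> \<le> (\<Sum>i=1..<k. h (z - 1 - i))"
    using gap z by (intro sum_subset_reindex[of "\<lambda>\<sigma>. \<sigma> + b - a - 1"])
      (fastforce simp: inj_on_def intro!: arg_cong[of _ _ h])+
  also have "\<dots> \<le> h (z - 1)" using z by (intro W.sum_prev_le) simp
  also have "\<dots> \<le> c z" using z s0_bounds one_notin_P by (intro W.h_prev_le_c) auto
  finally show ?thesis .
qed

text \<open>The periods of \<open>w\<close> that \<open>w'\<close> lacks are all prime, so their contributions are paid for by the
  terms \<open>c l * c (y - l)\<close> of \<open>Q\<close>.\<close>

lemma Q_common:
  assumes y: "4 * k + 1 \<le> y"
  shows "Q y \<le> pairs (\<lambda>u. \<delta> (y - u)) - h (y - k - 2)"
proof -
  define E where "E = P - P'"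
  define G where "G t = (\<Sum>\<sigma>=1..<s0. c \<sigma> * c (y - (\<sigma> + t)))" for t
  have finE [simp]: "finite E" by (simp add: E_def)
  have s0E: "s0 \<in> E" using s0_P s0_P' by (simp add: E_def)
  have E_ge: "s0 < \<pi>" if "\<pi> \<in> E" "\<pi> \<noteq> s0" for \<pi>
    using that agree[of \<pi>] by (cases "\<pi> < s0") (auto simp: E_def)
  have B: "c \<sigma> * W.B y \<sigma> - c \<sigma> * V.B y \<sigma>
      \<le> c \<sigma> * (\<Sum>t\<in>{t\<in>P \<inter> P'. k \<le> \<sigma> + t}. \<delta> (y - (\<sigma> + t))) + c \<sigma> * (\<Sum>t\<in>E. c (y - (\<sigma> + t)))" for \<sigma>
  proof -
    have "W.B y \<sigma> = (\<Sum>t\<in>{t\<in>P \<inter> P'. k \<le> \<sigma> + t} \<union> {t\<in>E. k \<le> \<sigma> + t}. c (y - (\<sigma> + t)))"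
      unfolding W.B_def by (intro sum.cong) (auto simp: E_def)
    also have "\<dots> = (\<Sum>t\<in>{t\<in>P \<inter> P'. k \<le> \<sigma> + t}. c (y - (\<sigma> + t))) + (\<Sum>t\<in>{t\<in>E. k \<le> \<sigma> + t}. c (y - (\<sigma> + t)))"
      by (intro sum.union_disjoint) (auto simp: E_def)
    also have "(\<Sum>t\<in>{t\<in>E. k \<le> \<sigma> + t}. c (y - (\<sigma> + t))) \<le> (\<Sum>t\<in>E. c (y - (\<sigma> + t)))"
      by (intro sum_mono2) (auto simp: W.c_nonneg)
    finally have 1: "W.B y \<sigma> \<le> (\<Sum>t\<in>{t\<in>P \<inter> P'. k \<le> \<sigma> + t}. c (y - (\<sigma> + t))) + (\<Sum>t\<in>E. c (y - (\<sigma> + t)))" by simp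
    have 2: "(\<Sum>t\<in>{t\<in>P \<inter> P'. k \<le> \<sigma> + t}. c' (y - (\<sigma> + t))) \<le> V.B y \<sigma>"
      unfolding V.B_def diff_diff_left by (intro sum_mono2) (auto simp: V.c_nonneg)
    have "W.B y \<sigma> - V.B y \<sigma> \<le> (\<Sum>t\<in>{t\<in>P \<inter> P'. k \<le> \<sigma> + t}. \<delta> (y - (\<sigma> + t))) + (\<Sum>t\<in>E. c (y - (\<sigma> + t)))"
      using 1 2 unfolding \<delta>_def sum_subtractf by linarith
    then have "c \<sigma> * (W.B y \<sigma> - V.B y \<sigma>) \<le> c \<sigma> * ((\<Sum>t\<in>{t\<in>P \<inter> P'. k \<le> \<sigma> + t}. \<delta> (y - (\<sigma> + t))) + (\<Sum>t\<in>E. c (y - (\<sigma> + t))))"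
      by (intro mult_left_mono W.c_nonneg)
    then show ?thesis by (simp add: algebra_simps)
  qed
  have "(\<Sum>\<sigma>=1..<s0. c \<sigma> * W.B y \<sigma>) - (\<Sum>\<sigma>=1..<s0. c \<sigma> * V.B y \<sigma>)
      \<le> pairs (\<lambda>u. \<delta> (y - u)) + (\<Sum>\<sigma>=1..<s0. c \<sigma> * (\<Sum>t\<in>E. c (y - (\<sigma> + t))))"
    unfolding pairs_def sum_subtractf[symmetric] sum.distrib[symmetric] by (intro sum_mono B)
  moreover have "(\<Sum>\<sigma>=1..<s0. c \<sigma> * (\<Sum>t\<in>E. c (y - (\<sigma> + t)))) = (\<Sum>t\<in>E. G t)"
    unfolding G_def sum_distrib_left by (rule sum.swap)
  moreover have "(\<Sum>t\<in>E. G t) = G s0 + (\<Sum>t\<in>E - {s0}. G t)" using s0E by (intro sum.remove) auto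
  moreover have "G s0 \<le> c (y - k)"
  proof -
    have "(\<Sum>\<sigma>=1..<s0. c \<sigma> * c (y - k + k - (\<sigma> + s0))) \<le> c (y - k)"
    proof (rule conv_le[of _ k])
    qed (use y s0_bounds prime_add_s0 in auto)
    then show ?thesis using y by (simp add: G_def)
  qed
  moreover have "(\<Sum>t\<in>E - {s0}. G t) \<le> (\<Sum>l=s0+1..<k. c l * c (y - l))"
  proof -
    have "(\<Sum>t\<in>E - {s0}. G t) \<le> (\<Sum>t\<in>E - {s0}. c t * c (y - t))"
    proof (intro sum_mono)
      fix \<pi> assume \<pi>: "\<pi> \<in> E - {s0}"
      then have b: "\<pi> < k" "c \<pi> = 1" using diff_prime W.P_bounds by (auto simp: E_def)
      have "(\<Sum>\<sigma>=1..<s0. c \<sigma> * c (y - \<pi> + 0 - (\<sigma> + 0))) \<le> c (y - \<pi>)"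
      proof (rule conv_le)
        fix \<sigma> assume "1 \<le> \<sigma>" "\<sigma> < s0" "c \<sigma> \<noteq> 0"
        then show "0 + 2 \<le> \<sigma> + 0 \<and> \<sigma> + 0 \<le> 0 + k" using prime_ge_p[of \<sigma>] p_ge3 s0_bounds by auto
      qed (use y b W.k1 in auto)
      then show "G \<pi> \<le> c \<pi> * c (y - \<pi>)" using b unfolding G_def by (simp add: add.commute)
    qed
    also have "\<dots> \<le> (\<Sum>l=s0+1..<k. c l * c (y - l))"
    proof (rule sum_mono2)
      show "E - {s0} \<subseteq> {s0+1..<k}" using E_ge W.P_bounds by (fastforce simp: E_def)
    qed (auto simp: W.c_nonneg)
    finally show ?thesis .
  qed
  moreover have "(\<Sum>l=1..s0. c l * W.B y l) = (\<Sum>l=1..<s0. c l * W.B y l) + W.B y s0"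
    unfolding sum_to_s0 by (simp add: c_s0)
  moreover have "(\<Sum>l=1..<s0. c l * V.B y l) \<le> (\<Sum>l=1..<k. c' l * V.B y l)"
  proof -
    have "(\<Sum>l=1..<s0. c l * V.B y l) = (\<Sum>l=1..<s0. c' l * V.B y l)"
      by (intro sum.cong refl) (simp add: c_agree)
    also have "\<dots> \<le> (\<Sum>l=1..<k. c' l * V.B y l)"
      using s0_bounds by (intro sum_mono2) (auto simp: V.c_nonneg)
    finally show ?thesis .
  qed
  \<comment> \<open>Since \<open>s0 + t \<ge> k + 2\<close>, the overshoot of \<open>s0\<close>
    starts at \<open>i = 3\<close>. Two telescoped terms stay free: \<open>c (y - k)\<close> pays
    for \<open>G s0\<close>, and \<open>c (y - k - 1)\<close> yields the gain
    \<open>h (y - k - 2)\<close>.\<close>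
  moreover have "W.B y s0 \<le> (\<Sum>i=3..s0. c (y - k + 1 - i))"
  proof -
    have b: "k + 2 \<le> s0 + t \<and> t < k" if "t \<in> P" for t using p_s0 p_le[OF that] W.P_bounds[OF that] by simp
    show ?thesis
      unfolding W.B_def
    proof (rule sum_subset_reindex[of "\<lambda>t. s0 + t + 1 - k"])
      show "inj_on (\<lambda>t. s0 + t + 1 - k) {t \<in> P. k \<le> s0 + t}" by (auto simp: inj_on_def)
      show "(\<lambda>t. s0 + t + 1 - k) ` {t \<in> P. k \<le> s0 + t} \<subseteq> {3..s0}" using b by fastforce
      show "c (y - s0 - t) = c (y - k + 1 - (s0 + t + 1 - k))" if "t \<in> {t \<in> P. k \<le> s0 + t}" for t
        using that y by (intro arg_cong[of _ _ c]) auto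
    qed (auto simp: W.c_nonneg)
  qed
  moreover have "(\<Sum>i=1..s0. c (y - k + 1 - i)) = c (y - k) + c (y - k - 1) + (\<Sum>i=3..s0. c (y - k + 1 - i))"
  proof -
    have "{1..s0} = insert 1 (insert 2 {3..s0})" using p_ge3 p_less by auto
    then show ?thesis using y by (simp add: Suc_diff_le)
  qed
  moreover have "h (y - k - 2) \<le> c (y - k - 1)"
    using W.h_prev_le_c[of "y - k - 1"] y s0_bounds one_notin_P by (simp add: numeral_2_eq_2)
  ultimately show ?thesis unfolding Q_def by linarith
qed

text \<open>The estimate for \<open>\<delta>\<close> is applied twice: the second application bounds the terms
  \<open>\<delta> (y - u)\<close> produced by the first, and the gain \<open>h (y - k - 2)\<close> absorbs what is left.\<close>

lemma \<delta>_le_common: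
  assumes y: "6 * k \<le> y"
    and super: "\<And>m. m \<le> y \<Longrightarrow> (q - 1) * (\<Sum>i=1..<k. pos (D (m - i))) \<le> pos (D m)"
  shows "\<delta> y \<le> (q - 1) * pos (D y)"
proof -
  have super1: "(\<Sum>i=1..<k. pos (D (m - i))) \<le> pos (D m)" if "m \<le> y" for m
  proof -
    have "1 * (\<Sum>i=1..<k. pos (D (m - i))) \<le> (q - 1) * (\<Sum>i=1..<k. pos (D (m - i)))"
      using W.q2 by (intro mult_right_mono sum_nonneg) auto
    then show ?thesis using super[OF that] by linarith
  qed
  define C where "C = 2 + int (card S)"
  have C0: "0 \<le> C" by (simp add: C_def)
  have inner: "\<delta> (y - u) \<le> pos (D (y - u)) + C * h (y - k - u)" if u: "k \<le> u" "u + 3 \<le> 2 * k" for u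
  proof -
    define t where "t = y - u"
    have t: "4 * k + 1 \<le> t" "t \<le> y" using u y by (auto simp: t_def)
    have "\<delta> t \<le> Lin t + pairs (\<lambda>u. \<delta> (t - u)) - h (t - k - 2)"
      using \<delta>_le_Lin_Q[of t] Q_common[of t] t s0_bounds by auto
    moreover have "0 \<le> h (t - k - 2)" by simp
    moreover have "Lin t \<le> pos (D t)"
    proof -
      have "(q - 1) * (\<Sum>i=1..s0. pos (D (t - i))) \<le> (q - 1) * (\<Sum>i=1..<k. pos (D (t - i)))"
        using W.q2 s0_bounds by (intro mult_left_mono sum_mono2) auto
      then show ?thesis using Lin_le[of t] super[of t] t sum_c_D_nonneg[of t] by linarith
    qed
    moreover have "pairs (\<lambda>u. \<delta> (t - u)) \<le> pairs (\<lambda>u. h (t - k + k - u))"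
    proof (rule pairs_mono)
      fix v assume v: "k \<le> v" "v + 3 \<le> 2 * k"
      have "c (t - v) \<le> h (t - v)" using v t by (intro W.c_le_h) auto
      then show "\<delta> (t - v) \<le> h (t - k + k - v)" using V.c_nonneg[of "t - v"] t unfolding \<delta>_def by simp
    qed
    moreover have "pairs (\<lambda>u. h (t - k + k - u)) \<le> C * h (t - k)"
      unfolding C_def using t by (intro pairs_le W.sum_prev_le) auto
    ultimately have "\<delta> t \<le> pos (D t) + C * h (t - k)" by linarith
    then show ?thesis unfolding t_def by (simp add: add.commute)
  qed
  have "\<delta> y \<le> Lin y + pairs (\<lambda>u. \<delta> (y - u)) - h (y - k - 2)"
    using \<delta>_le_Lin_Q[of y] Q_common[of y] y s0_bounds by auto
  moreover have "pairs (\<lambda>u. \<delta> (y - u)) \<le> pairs (\<lambda>u. pos (D (y - k + k - u)) + C * h (y - 2 * k + k - u))"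
  proof (rule pairs_mono)
    fix u assume u: "k \<le> u" "u + 3 \<le> 2 * k"
    have "y - k + k = y" "y - 2 * k + k = y - k" using y by auto
    then show "\<delta> (y - u) \<le> pos (D (y - k + k - u)) + C * h (y - 2 * k + k - u)" using inner[OF u] by simp
  qed
  moreover have "\<dots> = pairs (\<lambda>u. pos (D (y - k + k - u))) + C * pairs (\<lambda>u. h (y - 2 * k + k - u))"
    by (simp add: pairs_add pairs_scale)
  moreover have "pairs (\<lambda>u. pos (D (y - k + k - u))) \<le> C * pos (D (y - k))"
    unfolding C_def using pairs_le[of "\<lambda>n. pos (D n)" "y - k"] super1[of "y - k"] by simp
  moreover have "C * pairs (\<lambda>u. h (y - 2 * k + k - u)) \<le> C * (C * h (y - 2 * k))"
    using C0 y unfolding C_def by (intro mult_left_mono pairs_le W.sum_prev_le) auto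
  \<comment> \<open>Two rounds of pairs cost \<open>C * C\<close>, at most
    \<open>2 ^ (2 + 2 * card S)\<close>. Because \<open>2 * card S + 5 \<le> k\<close>, the doubling
    of \<open>h\<close> over the \<open>k - 2\<close> steps from \<open>y - 2 * k\<close> to
    \<open>y - k - 2\<close> outweighs it.\<close>
  moreover have "C * (C * h (y - 2 * k)) \<le> h (y - k - 2)"
  proof -
    have "C * C \<le> 2 ^ (2 + 2 * card S)" using square_le_two_power[of "card S"] by (simp add: C_def power2_eq_square)
    also have "\<dots> \<le> 2 ^ (k - 2 - 1)" using card_S(1) by (intro power_increasing) auto
    finally have "C * C * h (y - 2 * k) \<le> 2 ^ (k - 2 - 1) * h (y - 2 * k)" by (intro mult_right_mono) auto
    moreover have "2 ^ (k - 2 - 1) * h (y - k - 2 - (k - 2)) \<le> h (y - k - 2)"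
      using y card_S(1) by (intro W.h_double) auto
    moreover have "y - k - 2 - (k - 2) = y - 2 * k" using card_S(1) by simp
    ultimately show ?thesis by (simp add: mult.assoc)
  qed
  \<comment> \<open>Here \<open>C \<le> k - p\<close>, and the positive part of \<open>D\<close>
    doubles over the \<open>k - p\<close> steps up to \<open>y - p\<close>. The value reached is
    paid by the reserve of \<open>Lin_le\<close>, where \<open>c p = 1\<close>.\<close>
  moreover have "C * pos (D (y - k)) \<le> pos (D (y - p))"
  proof -
    have j: "card S + 2 \<le> k - p" using card_S(2) by simp
    have "int (n + 1) \<le> 2 ^ n" for n by (induction n) auto
    from this[of "k - p - 1"] have "C \<le> 2 ^ (k - p - 1)" using j by (simp add: C_def)
    then have "C * pos (D (y - k)) \<le> 2 ^ (k - p - 1) * pos (D (y - k))" by (intro mult_right_mono) auto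
    also have "\<dots> \<le> pos (D (y - p))"
    proof -
      have "2 ^ (k - p - 1) * pos (D (y - p - (k - p))) \<le> pos (D (y - p))"
        using super1 j p_ge3 y
        by (intro superadditive_double[of "\<lambda>n. pos (D n)" _ k]) auto
      moreover have "y - p - (k - p) = y - k" using j by simp
      ultimately show ?thesis by simp
    qed
    finally show ?thesis .
  qed
  moreover have "pos (D (y - p)) \<le> (\<Sum>i=1..<s0. c i * pos (D (y - i)))"
    using member_le_sum[of p "{1..<s0}" "\<lambda>i. c i * pos (D (y - i))"] p_less p_ge3 c_p W.c_nonneg by simp
  ultimately show ?thesis using Lin_le[of y] window_s0[OF super1[of y]] by linarith
qed

end

end

section \<open>The initial segment\<close>

lemma half_power_sum: "(\<Sum>i=3..<3 + n. (1 / 2 :: real) ^ i) = 1 / 4 - (1 / 4) * (1 / 2) ^ n"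
proof (induction n)
  case (Suc n)
  have "(\<Sum>i=3..<3 + Suc n. (1 / 2 :: real) ^ i) = (\<Sum>i=3..<3 + n. (1 / 2) ^ i) + (1 / 2) ^ (3 + n)"
    unfolding add_Suc_right by (subst sum.atLeastLessThan_Suc) auto
  then show ?case unfolding Suc by (simp add: power_add power3_eq_cube)
qed simp

context corr
begin

text \<open>If 2 is a period, \<open>prime_gap\<close> leaves it as the only prime; otherwise all
  primes are at least 3 and the geometric series from \<open>(1 / 2) ^ 3\<close> on sums to
  \<open>1 / 4\<close>. Two words together thus weigh at most one half.\<close>

lemma prime_weight:
  assumes "1 \<notin> P"
  shows "(\<Sum>i=1..<k. real_of_int (c i) / real_of_int q ^ i) \<le> 1 / 4"
proof (cases "2 \<in> P")
  case True
  have "Min P = 2"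
  proof (rule Min_eqI)
    fix s assume "s \<in> P"
    then show "2 \<le> s" using assms P_bounds[of s] by (cases "s = 1") auto
  qed (use True in auto)
  then have "c i = 0" if "1 \<le> i" "i < k" "i \<noteq> 2" for i
    using prime_gap[of i] that by auto
  then have "(\<Sum>i=1..<k. real_of_int (c i) / real_of_int q ^ i) = (\<Sum>i\<in>{2}. real_of_int (c i) / real_of_int q ^ i)"
    using P_bounds[OF True] by (intro sum.mono_neutral_right) auto
  also have "\<dots> \<le> 1 / 4"
  proof -
    have "real_of_int (c 2) \<le> 1" using c_le_one[of 2] P_bounds[OF True] by simp
    moreover have "4 \<le> real_of_int q ^ 2" using power_mono[of 2 "real_of_int q" 2] q2 by simp
    ultimately have "real_of_int (c 2) / real_of_int q ^ 2 \<le> 1 / 4" by (intro frac_le) auto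
    then show ?thesis by simp
  qed
  finally show ?thesis .
next
  case False
  have "(\<Sum>i=1..<k. real_of_int (c i) / real_of_int q ^ i) \<le> (\<Sum>i=1..<k. if 3 \<le> i then (1 / 2) ^ i else 0)"
  proof (intro sum_mono)
    fix i assume i: "i \<in> {1..<k}"
    show "real_of_int (c i) / real_of_int q ^ i \<le> (if 3 \<le> i then (1 / 2) ^ i else 0)"
    proof (cases "3 \<le> i")
      case True
      have "real_of_int (c i) \<le> 1" using c_le_one[of i] i by simp
      moreover have "2 ^ i \<le> real_of_int q ^ i" using q2 by (intro power_mono) auto
      ultimately have "real_of_int (c i) / real_of_int q ^ i \<le> 1 / 2 ^ i" by (intro frac_le) auto
      then show ?thesis using True by (simp add: power_one_over)
    next
      case f: False
      then have "i \<notin> P" using i False assms by (cases "i = 1"; cases "i = 2") auto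
      then have "c i = 0" using c_le_bool[of i] c_nonneg[of i] i by simp
      then show ?thesis using f by simp
    qed
  qed
  also have "\<dots> \<le> (\<Sum>i=3..<3 + k. (1 / 2 :: real) ^ i)"
    by (subst sum.inter_filter[symmetric]) (auto intro!: sum_mono2)
  also have "\<dots> \<le> 1 / 4" unfolding half_power_sum by simp
  finally show ?thesis .
qed

section \<open>Generating functions of a single word\<close>

definition gf_h :: "int fps" where "gf_h = Abs_fps (\<lambda>n. h (n + k))"
definition gf_c :: "int fps" where "gf_c = Abs_fps (\<lambda>n. if n = 0 then 0 else c n)"
text \<open>The autocorrelation polynomial, \<open>C\<close> in the identities; \<open>gf_h\<close>,
  shifted by \<open>k\<close> to start with 1, is \<open>H\<close>, and \<open>gf_c\<close> is
  \<open>F\<close>, with constant term 0 in place of the undetermined \<open>c 0\<close>.\<close>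

definition gf_P :: "int fps" where "gf_P = Abs_fps (\<lambda>n. of_bool (n = 0 \<or> n \<in> P))"

lemma gf_step: "(1 - fps_const q * fps_X) * gf_h = 1 - gf_c"
proof (rule fps_ext)
  fix n
  show "fps_nth ((1 - fps_const q * fps_X) * gf_h) n = fps_nth (1 - gf_c) n"
    using h_step[of "n - 1 + k"]
    by (cases n) (auto simp: left_diff_distrib mult.assoc gf_h_def gf_c_def h_k add.commute)
qed

lemma gf_conv: "gf_P * (1 - gf_c) = 1 - fps_X ^ k * gf_h"
proof (rule fps_ext)
  fix n
  have "fps_nth (gf_P * gf_c) n = (\<Sum>i=0..n. of_bool (i = 0 \<or> i \<in> P) * (if n - i = 0 then 0 else c (n - i)))"
    by (simp add: fps_mult_nth gf_P_def gf_c_def)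
  also have "\<dots> = (\<Sum>i\<in>{i\<in>insert 0 P. i < n}. c (n - i))"
    by (intro sum.mono_neutral_cong_right) auto
  also have "\<dots> = (if n = 0 then 0 else c n + (\<Sum>s\<in>{s\<in>P. s < n}. c (n - s)))"
  proof (cases "n = 0")
    case False
    then have "{i\<in>insert 0 P. i < n} = insert 0 {s\<in>P. s < n}" by auto
    moreover have "0 \<notin> P" using P_bounds by fastforce
    ultimately show ?thesis using False by simp
  qed simp
  finally have *: "fps_nth (gf_P * gf_c) n = (if n = 0 then 0 else c n + (\<Sum>s\<in>{s\<in>P. s < n}. c (n - s)))" .
  have "{s\<in>P. s < n} = P" if "k \<le> n" using that P_bounds by fastforce
  moreover have "n \<notin> P" if "k \<le> n" using that P_bounds by fastforce
  ultimately have "fps_nth (gf_P * gf_c) n = of_bool (n \<in> P) + (if n < k then 0 else h n)"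
    using * h_conv[of n] P_conv[of n] k1 P_bounds[of 0] by (cases "n = 0"; cases "n < k") auto
  then show "fps_nth (gf_P * (1 - gf_c)) n = fps_nth (1 - fps_X ^ k * gf_h) n"
    using k1 P_bounds[of 0]
    by (cases "n = 0") (auto simp: right_diff_distrib fps_X_power_mult_nth gf_P_def gf_h_def)
qed

end

text \<open>\<open>E N\<close> is the excess of \<open>\<kappa> N\<close> over its \<open>r\<close>
  predecessors. A step costs \<open>a (Suc N)\<close> and gains the value leaving the window. Up to
  \<open>r\<close> nothing leaves and the starting value 1 pays; at \<open>r + 1\<close> the
  departing \<open>\<kappa> 0 = 1\<close> raises the budget to 2; later \<open>tail\<close> lets the
  departing value cover the cost.\<close>

lemma window_recursion_nonneg:
  fixes \<kappa> a :: "nat \<Rightarrow> int" and q :: int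
  assumes q: "2 \<le> q" and \<kappa>0: "\<kappa> 0 = 1" and step: "\<And>z. q * \<kappa> z - a (Suc z) \<le> \<kappa> (Suc z)"
    and init: "(\<Sum>i=1..r. a i) \<le> 1" "(\<Sum>i=1..Suc r. a i) \<le> 2"
    and a_nn: "\<And>i. 0 \<le> a i"
    and tail: "\<And>z. 1 \<le> z \<Longrightarrow> z + r + 1 \<le> X \<Longrightarrow> a (z + r + 1) \<le> \<kappa> z"
    and N: "N \<le> X"
  shows "0 \<le> \<kappa> N" "(\<Sum>i=1..min r N. \<kappa> (N - i)) \<le> \<kappa> N"
proof -
  define E where "E N = \<kappa> N - (\<Sum>i=1..min r N. \<kappa> (N - i))" for N
  have shift: "(\<Sum>i=1..Suc m. \<kappa> (Suc N - i)) = \<kappa> N + (\<Sum>i=1..m. \<kappa> (N - i))" for m N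
    by (induction m) auto
  have dbl: "2 * \<kappa> N - a (Suc N) \<le> \<kappa> (Suc N)" if "0 \<le> \<kappa> N" for N
  proof -
    have "2 * \<kappa> N \<le> q * \<kappa> N" using q that by (intro mult_right_mono) auto
    then show ?thesis using step[of N] by linarith
  qed
  have E1: "E N - a (Suc N) \<le> E (Suc N)" if "N < r" "0 \<le> \<kappa> N" for N
  proof -
    have "min r (Suc N) = Suc N" "min r N = N" using that by auto
    then have "E (Suc N) = \<kappa> (Suc N) - \<kappa> N - (\<Sum>i=1..N. \<kappa> (N - i))" "E N = \<kappa> N - (\<Sum>i=1..N. \<kappa> (N - i))"
      unfolding E_def using shift[of N N] by auto
    then show ?thesis using dbl[of N] that by auto
  qed
  have E2: "E N + \<kappa> (N - r) - a (Suc N) \<le> E (Suc N)" if "r \<le> N" "0 \<le> \<kappa> N" for N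
  proof (cases r)
    case 0
    then show ?thesis using dbl[OF that(2)] by (simp add: E_def)
  next
    case (Suc m)
    have "min r (Suc N) = Suc m" "min r N = Suc m" using that Suc by auto
    then have "E (Suc N) = \<kappa> (Suc N) - \<kappa> N - (\<Sum>i=1..m. \<kappa> (N - i))"
      "E N = \<kappa> N - (\<Sum>i=1..m. \<kappa> (N - i)) - \<kappa> (N - r)"
      unfolding E_def using shift[where m = m and N = N] Suc by auto
    then show ?thesis using dbl[OF that(2)] by linarith
  qed
  have "(\<forall>m\<le>N. 0 \<le> \<kappa> m) \<and> 0 \<le> E N \<and> (N \<le> r \<longrightarrow> 1 - (\<Sum>i=1..N. a i) \<le> E N)"
    using N
  proof (induction N)
    case 0 then show ?case using \<kappa>0 by (simp add: E_def)
  next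
    case (Suc N)
    have IH: "\<forall>m\<le>N. 0 \<le> \<kappa> m" "0 \<le> E N" "N \<le> r \<longrightarrow> 1 - (\<Sum>i=1..N. a i) \<le> E N"
      using Suc by auto
    have low: "1 - (\<Sum>i=1..Suc N. a i) \<le> E (Suc N)" if "Suc N \<le> r"
      using E1[of N] IH that by auto
    have E: "0 \<le> E (Suc N)"
    proof -
      consider "Suc N \<le> r" | "N = r" | "r < N" by linarith
      then show ?thesis
      proof cases
        case 1
        have "(\<Sum>i=1..Suc N. a i) \<le> (\<Sum>i=1..r. a i)" using 1 a_nn by (intro sum_mono2) auto
        then show ?thesis using low[OF 1] init by linarith
      next
        case 2
        then show ?thesis using E2[of N] IH init \<kappa>0 by auto
      next
        case 3
        then have "a (Suc N) \<le> \<kappa> (N - r)" using tail[of "N - r"] Suc.prems by simp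
        then show ?thesis using E2[of N] IH 3 by auto
      qed
    qed
    have "0 \<le> (\<Sum>i=1..min r (Suc N). \<kappa> (Suc N - i))"
      using IH(1) by (intro sum_nonneg) auto
    then have "0 \<le> \<kappa> (Suc N)" using E unfolding E_def by linarith
    then show ?case using E low IH(1) by (auto simp: le_Suc_eq)
  qed
  then show "0 \<le> \<kappa> N" "(\<Sum>i=1..min r N. \<kappa> (N - i)) \<le> \<kappa> N"
    unfolding E_def by auto
qed

context corr_pair
begin

text \<open>Both words satisfy \<open>(1 - q X) * H = 1 - F\<close> and \<open>C * (1 - F) = 1 - X ^ k * H\<close>; eliminating
  the \<open>X ^ k\<close> terms uses \<open>H * (1 - F') = (1 - q X) * H * H' = H' * (1 - F)\<close>.\<close>

lemma gf_diff: "W.gf_h - V.gf_h = - ((W.gf_P - V.gf_P) * ((1 - W.gf_c) * V.gf_h))"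
proof -
  define A :: "int fps" where "A = 1 - fps_const q * fps_X"
  have "fps_nth A 0 = 1" by (simp add: A_def)
  then have A: "A \<noteq> 0" by auto
  have s: "A * W.gf_h = 1 - W.gf_c" "A * V.gf_h = 1 - V.gf_c"
    using W.gf_step V.gf_step by (simp_all add: A_def)
  have cross: "W.gf_h * (1 - V.gf_c) = V.gf_h * (1 - W.gf_c)"
    unfolding s[symmetric] by (simp add: mult_ac)
  have "A * ((W.gf_P - V.gf_P) * ((1 - W.gf_c) * V.gf_h)) = (W.gf_P - V.gf_P) * (1 - W.gf_c) * (1 - V.gf_c)"
    unfolding s(2)[symmetric] by (simp add: mult_ac)
  also have "\<dots> = (W.gf_P * (1 - W.gf_c)) * (1 - V.gf_c) - (V.gf_P * (1 - V.gf_c)) * (1 - W.gf_c)"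
    by (simp add: algebra_simps)
  also have "\<dots> = (1 - V.gf_c) - (1 - W.gf_c) - fps_X ^ k * (W.gf_h * (1 - V.gf_c) - V.gf_h * (1 - W.gf_c))"
    unfolding W.gf_conv V.gf_conv by (simp add: algebra_simps)
  also have "\<dots> = A * - (W.gf_h - V.gf_h)" unfolding cross s[symmetric] by (simp add: algebra_simps)
  finally have "A * ((W.gf_P - V.gf_P) * ((1 - W.gf_c) * V.gf_h)) = A * - (W.gf_h - V.gf_h)" .
  then show ?thesis using A by simp
qed

section \<open>Growth of the coefficients of \<open>(1 - F) * H'\<close>\<close>

definition \<kappa> :: "nat \<Rightarrow> int" where "\<kappa> z = fps_nth ((1 - W.gf_c) * V.gf_h) z"

lemma \<kappa>_0: "\<kappa> 0 = 1"
  by (simp add: \<kappa>_def W.gf_c_def V.gf_h_def V.h_k)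

text \<open>Multiplication by \<open>1 - q X\<close> turns \<open>(1 - F) * H'\<close> into
  \<open>(1 - F) * (1 - F')\<close>, and \<open>F * F'\<close> has nonnegative coefficients.\<close>

lemma \<kappa>_step: "q * \<kappa> z - (c (Suc z) + c' (Suc z)) \<le> \<kappa> (Suc z)"
proof -
  have "(1 - fps_const q * fps_X) * ((1 - W.gf_c) * V.gf_h) = (1 - W.gf_c) * (1 - V.gf_c)"
    unfolding V.gf_step[symmetric] by (simp add: mult_ac)
  then have "fps_nth ((1 - fps_const q * fps_X) * ((1 - W.gf_c) * V.gf_h)) (Suc z) = fps_nth ((1 - W.gf_c) * (1 - V.gf_c)) (Suc z)"
    by (rule arg_cong)
  moreover have "fps_nth ((1 - fps_const q * fps_X) * ((1 - W.gf_c) * V.gf_h)) (Suc z) = \<kappa> (Suc z) - q * \<kappa> z"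
    by (simp add: left_diff_distrib[of 1] mult.assoc \<kappa>_def)
  moreover have "fps_nth ((1 - W.gf_c) * (1 - V.gf_c)) (Suc z) = fps_nth (W.gf_c * V.gf_c) (Suc z) - c (Suc z) - c' (Suc z)"
    by (simp add: left_diff_distrib right_diff_distrib W.gf_c_def V.gf_c_def)
  moreover have "0 \<le> fps_nth (W.gf_c * V.gf_c) (Suc z)"
    unfolding fps_mult_nth by (intro sum_nonneg mult_nonneg_nonneg) (auto simp: W.gf_c_def V.gf_c_def W.c_nonneg V.c_nonneg)
  ultimately show ?thesis by linarith
qed

lemma minus_D_eq:
  "- D (k + s0 + x) = (\<Sum>r=0..x. (of_bool (s0 + r \<in> P) - of_bool (s0 + r \<in> P')) * \<kappa> (x - r))"
proof -
  have "fps_nth (W.gf_h - V.gf_h) (s0 + x) = D (k + s0 + x)"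
    by (simp add: W.gf_h_def V.gf_h_def D_def add_ac)
  then have "- D (k + s0 + x) = fps_nth ((W.gf_P - V.gf_P) * ((1 - W.gf_c) * V.gf_h)) (s0 + x)"
    using gf_diff by simp
  also have "\<dots> = (\<Sum>i=0..s0 + x. (of_bool (i \<in> P) - of_bool (i \<in> P')) * \<kappa> (s0 + x - i))"
    unfolding fps_mult_nth \<kappa>_def
    by (intro sum.cong refl arg_cong2[of _ _ _ _ "(*)"])
      (auto simp: W.gf_P_def V.gf_P_def dest: W.P_bounds V.P_bounds)
  also have "\<dots> = (\<Sum>i=s0..s0 + x. (of_bool (i \<in> P) - of_bool (i \<in> P')) * \<kappa> (s0 + x - i))"
    using agree by (intro sum.mono_neutral_right) auto
  also have "\<dots> = (\<Sum>r=0..x. (of_bool (s0 + r \<in> P) - of_bool (s0 + r \<in> P')) * \<kappa> (x - r))"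
    by (rule sum.reindex_bij_witness[of _ "\<lambda>r. s0 + r" "\<lambda>i. i - s0"]) (auto simp: add.commute)
  finally show ?thesis .
qed

text \<open>In units of \<open>q ^ z\<close> the steps of \<open>\<kappa>_step\<close> lose in total
  the weights of the primes of both words, at most one half by \<open>prime_weight\<close>.\<close>

lemma \<kappa>_half:
  assumes n1: "1 \<notin> P" "1 \<notin> P'" and z: "z < k"
  shows "q ^ z \<le> 2 * \<kappa> z"
proof -
  define w where "w i = real_of_int (c i) / real_of_int q ^ i + real_of_int (c' i) / real_of_int q ^ i" for i
  have q0: "0 < real_of_int q" using W.q2 by simp
  have *: "real_of_int q ^ z * (1 - (\<Sum>i=1..z. w i)) \<le> real_of_int (\<kappa> z)" for z
  proof (induction z)
    case (Suc z)
    have "real_of_int q ^ Suc z * (1 - (\<Sum>i=1..Suc z. w i))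
        = real_of_int q * (real_of_int q ^ z * (1 - (\<Sum>i=1..z. w i))) - real_of_int q ^ Suc z * w (Suc z)"
      by (simp add: algebra_simps)
    also have "real_of_int q ^ Suc z * w (Suc z) = real_of_int (c (Suc z) + c' (Suc z))"
      using q0 by (simp add: w_def field_simps)
    also have "real_of_int q * (real_of_int q ^ z * (1 - (\<Sum>i=1..z. w i))) \<le> real_of_int q * real_of_int (\<kappa> z)"
      using Suc q0 by (intro mult_left_mono) auto
    also have "real_of_int q * real_of_int (\<kappa> z) - real_of_int (c (Suc z) + c' (Suc z))
        = real_of_int (q * \<kappa> z - (c (Suc z) + c' (Suc z)))" by simp
    also have "\<dots> \<le> real_of_int (\<kappa> (Suc z))" using \<kappa>_step[of z] by (simp only: of_int_le_iff)
    finally show ?case by simp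
  qed (simp add: \<kappa>_0)
  have "(\<Sum>i=1..z. w i) \<le> (\<Sum>i=1..<k. w i)"
    using z q0 by (intro sum_mono2) (auto simp: w_def W.c_nonneg V.c_nonneg)
  also have "\<dots> \<le> 1 / 2"
    using W.prime_weight[OF n1(1)] V.prime_weight[OF n1(2)] by (simp add: w_def sum.distrib)
  finally have "real_of_int q ^ z * (1 / 2) \<le> real_of_int q ^ z * (1 - (\<Sum>i=1..z. w i))"
    using q0 by (intro mult_left_mono) auto
  then have "real_of_int q ^ z \<le> 2 * real_of_int (\<kappa> z)" using *[of z] by simp
  then have "real_of_int (q ^ z) \<le> real_of_int (2 * \<kappa> z)" by simp
  then show ?thesis by (simp only: of_int_le_iff)
qed

text \<open>From \<open>k\<close> on \<open>c_le_pow\<close> bounds the loss of one step by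
  \<open>2 / q ^ k\<close> in units of \<open>q ^ z\<close>; multiplied by \<open>2 * q ^ k\<close>
  this is the 4 of the statement, counted from \<open>z = k - 1\<close>, where
  \<open>\<kappa>_half\<close> supplies the start.\<close>

lemma \<kappa>_lower:
  assumes n1: "1 \<notin> P" "1 \<notin> P'"
  shows "q ^ z * (q ^ k - 4 * int (z + 1 - k)) \<le> 2 * q ^ k * \<kappa> z"
proof (cases "z < k")
  case True
  have "q ^ k * q ^ z \<le> q ^ k * (2 * \<kappa> z)"
    using \<kappa>_half[OF n1 True] W.q2 by (intro mult_left_mono) auto
  then show ?thesis using True by (simp add: mult_ac)
next
  case False
  then have "k - 1 \<le> z" by simp
  then show ?thesis
  proof (induction z rule: dec_induct)
    case base
    have "k - 1 < k" using W.k1 by simp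
    then have "q ^ k * q ^ (k - 1) \<le> q ^ k * (2 * \<kappa> (k - 1))"
      using \<kappa>_half[OF n1, of "k - 1"] W.q2 by (intro mult_left_mono) auto
    then show ?case using W.k1 by (simp add: mult_ac)
  next
    case (step z)
    have "c (Suc z) \<le> q ^ (Suc z - k)" "c' (Suc z) \<le> q ^ (Suc z - k)"
      using step by (auto intro!: W.c_le_pow V.c_le_pow)
    then have "q * \<kappa> z - 2 * q ^ (Suc z - k) \<le> \<kappa> (Suc z)" using \<kappa>_step[of z] by linarith
    then have "2 * q ^ k * (q * \<kappa> z - 2 * q ^ (Suc z - k)) \<le> 2 * q ^ k * \<kappa> (Suc z)"
      using W.q2 by (intro mult_left_mono) auto
    moreover have "2 * q ^ k * (q * \<kappa> z - 2 * q ^ (Suc z - k)) = q * (2 * q ^ k * \<kappa> z) - 4 * (q ^ k * q ^ (Suc z - k))"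
      by (simp add: algebra_simps)
    moreover have "q ^ k * q ^ (Suc z - k) = q ^ Suc z" using step unfolding power_add[symmetric] by simp
    moreover have "q * (q ^ z * (q ^ k - 4 * int (z + 1 - k))) \<le> q * (2 * q ^ k * \<kappa> z)"
      using step W.q2 by (intro mult_left_mono) auto
    moreover have "q * (q ^ z * (q ^ k - 4 * int (z + 1 - k))) - 4 * q ^ Suc z = q ^ Suc z * (q ^ k - 4 * int (Suc z + 1 - k))"
    proof -
      have "int (Suc z + 1 - k) = int (z + 1 - k) + 1" using step by simp
      then show ?thesis by (simp add: algebra_simps)
    qed
    ultimately show ?case by linarith
  qed
qed

text \<open>Once \<open>z + r + 1 \<ge> k\<close>, \<open>cond\<close> and
  \<open>\<kappa>_lower\<close> give \<open>\<kappa> z \<ge> 2 * q ^ (z + r + 1 - k)\<close>, which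
  bounds \<open>c + c'\<close> at \<open>z + r + 1\<close> and so provides
  \<open>tail\<close>.\<close>

lemma window_nonneg:
  assumes n1: "1 \<notin> P" "1 \<notin> P'"
    and cond: "4 * int (X - r - k) + 4 * q ^ (r + 1) \<le> q ^ k"
    and init: "(\<Sum>i=1..r. c i + c' i) \<le> 1" "(\<Sum>i=1..Suc r. c i + c' i) \<le> 2"
    and N: "N \<le> X"
  shows "0 \<le> \<kappa> N" "(\<Sum>i=1..min r N. \<kappa> (N - i)) \<le> \<kappa> N"
proof -
  have tail: "c (z + r + 1) + c' (z + r + 1) \<le> \<kappa> z" if z: "1 \<le> z" "z + r + 1 \<le> X" for z
  proof (cases "z + r + 1 < k")
    case True
    then have "c (z + r + 1) \<le> 1" "c' (z + r + 1) \<le> 1" by (auto intro!: W.c_le_one V.c_le_one)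
    moreover have "2 \<le> \<kappa> z"
    proof (cases "z = 1")
      case True
      have "1 < k" using s0_bounds by simp
      then have "c 1 = 0" "c' 1 = 0"
        using n1 W.c_le_bool[of 1] V.c_le_bool[of 1] W.c_nonneg[of 1] V.c_nonneg[of 1] by auto
      then show ?thesis using \<kappa>_step[of 0] True \<kappa>_0 W.q2 by simp
    next
      case False
      then have "q ^ 2 \<le> q ^ z" using z W.q2 by (intro power_increasing) auto
      moreover have "2 ^ 2 \<le> q ^ 2" using W.q2 by (intro power_mono) auto
      moreover have "q ^ z \<le> 2 * \<kappa> z" using True n1 by (intro \<kappa>_half) auto
      ultimately show ?thesis by simp
    qed
    ultimately show ?thesis by linarith
  next
    case False
    define j where "j = z + r + 1 - k"
    have "c (z + r + 1) \<le> q ^ j" "c' (z + r + 1) \<le> q ^ j"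
      using False unfolding j_def by (auto intro!: W.c_le_pow V.c_le_pow)
    moreover have "2 * q ^ j \<le> \<kappa> z"
    proof -
      have "int (z + 1 - k) \<le> int (X - r - k)" using z by simp
      then have "4 * q ^ (r + 1) \<le> q ^ k - 4 * int (z + 1 - k)" using cond by linarith
      then have "q ^ z * (4 * q ^ (r + 1)) \<le> q ^ z * (q ^ k - 4 * int (z + 1 - k))"
        using W.q2 by (intro mult_left_mono) auto
      also have "\<dots> \<le> 2 * q ^ k * \<kappa> z" by (rule \<kappa>_lower[OF n1])
      finally have "2 * q ^ (z + r + 1) \<le> q ^ k * \<kappa> z" by (simp add: power_add mult_ac)
      moreover have "q ^ (z + r + 1) = q ^ k * q ^ j"
        using False unfolding j_def power_add[symmetric] by simp
      ultimately have "q ^ k * (2 * q ^ j) \<le> q ^ k * \<kappa> z" by (simp add: mult_ac)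
      then show ?thesis using W.q2 by simp
    qed
    ultimately show ?thesis by linarith
  qed
  show "0 \<le> \<kappa> N" "(\<Sum>i=1..min r N. \<kappa> (N - i)) \<le> \<kappa> N"
    using window_recursion_nonneg[of q \<kappa> "\<lambda>i. c i + c' i" r X N] W.q2 \<kappa>_0 \<kappa>_step init tail N
      W.c_nonneg V.c_nonneg by auto
qed

text \<open>All periods being below \<open>k\<close>, the coefficients of \<open>C - C'\<close>
  after the leading one sit at most \<open>r = k - s0 - 1\<close> places behind it. Even if all were
  -1, the window estimate of width \<open>r\<close> outweighs them; its initial conditions hold
  because every period exceeds \<open>r\<close>.\<close>

lemma D_nonpos_overlap:
  assumes n1: "1 \<notin> P" "1 \<notin> P'"
    and P_ge: "\<And>s. s \<in> P \<Longrightarrow> k - s0 \<le> s"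
    and cond: "4 * int (X + 1 - (k - s0) - k) + 4 * q ^ (k - s0) \<le> q ^ k"
    and n: "n \<le> k + s0 + X"
  shows "D n \<le> 0"
proof (cases "n < k + s0")
  case True then show ?thesis using D_zero by simp
next
  case False
  define x r where "x = n - k - s0" and "r = k - s0 - 1"
  have nx: "n = k + s0 + x" "x \<le> X" using False n by (auto simp: x_def)
  have r: "r + 1 = k - s0" "X - r - k = X + 1 - (k - s0) - k" using s0_bounds by (auto simp: r_def)
  have P'_ge: "k - s0 \<le> s" if "s \<in> P'" for s
    using P_ge[of s] P_ge[OF s0_P] agree[of s] that by (cases "s < s0") auto
  have zero: "c i + c' i = 0" if "i \<in> {1..r}" for i
  proof -
    have "1 \<le> i" "i < k" "i < k - s0" using that r s0_bounds by auto
    then show ?thesis using W.c_below_Min[of i] V.c_below_Min[of i] P_ge P'_ge by (metis add.right_neutral less_le_trans)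
  qed
  have i1: "(\<Sum>i=1..r. c i + c' i) = 0" by (intro sum.neutral ballI zero)
  have "c (Suc r) \<le> 1" "c' (Suc r) \<le> 1" using r by (auto intro!: W.c_le_one V.c_le_one)
  then have i2: "(\<Sum>i=1..Suc r. c i + c' i) \<le> 2" using i1 by simp
  have win: "0 \<le> \<kappa> N" "(\<Sum>i=1..min r N. \<kappa> (N - i)) \<le> \<kappa> N" if "N \<le> X" for N
    using window_nonneg[OF n1, of X r N, unfolded r] cond i1 i2 that by auto
  have "- (\<Sum>i=1..min r x. \<kappa> (x - i)) \<le> (\<Sum>i=1..x. (of_bool (s0 + i \<in> P) - of_bool (s0 + i \<in> P')) * \<kappa> (x - i))"
  proof -
    have "(\<Sum>i=1..x. (of_bool (s0 + i \<in> P) - of_bool (s0 + i \<in> P')) * \<kappa> (x - i))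
        = (\<Sum>i=1..min r x. (of_bool (s0 + i \<in> P) - of_bool (s0 + i \<in> P')) * \<kappa> (x - i))"
      using W.P_bounds V.P_bounds by (intro sum.mono_neutral_right) (fastforce simp: r_def)+
    moreover have "(\<Sum>i=1..min r x. - \<kappa> (x - i)) \<le> \<dots>"
    proof (intro sum_mono)
      fix i
      have "(- 1) * \<kappa> (x - i) \<le> (of_bool (s0 + i \<in> P) - of_bool (s0 + i \<in> P')) * \<kappa> (x - i)"
        using nx by (intro mult_right_mono win(1)) auto
      then show "- \<kappa> (x - i) \<le> (of_bool (s0 + i \<in> P) - of_bool (s0 + i \<in> P')) * \<kappa> (x - i)" by simp
    qed
    ultimately show ?thesis by (simp add: sum_negf)
  qed
  moreover have "- D n = \<kappa> x + (\<Sum>i=1..x. (of_bool (s0 + i \<in> P) - of_bool (s0 + i \<in> P')) * \<kappa> (x - i))"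
    unfolding nx(1) minus_D_eq using s0_P s0_P' by (simp add: sum.atLeast_Suc_atMost)
  ultimately show ?thesis using win(2)[OF nx(2)] by linarith
qed

text \<open>All multiples of \<open>s0\<close> below \<open>k\<close> are periods of \<open>w\<close>, so negative coefficients of \<open>C - C'\<close> sit
  strictly between multiples of \<open>s0\<close> and the window estimate applies block by block.\<close>

lemma D_nonpos_periodic:
  assumes n1: "1 \<notin> P" "1 \<notin> P'"
    and nc: "\<And>s. s \<in> P \<Longrightarrow> s0 \<le> s" and long: "2 * s0 < k"
    and cond: "4 * int (X - s0 - k) + 4 * q ^ (s0 + 1) \<le> q ^ k"
    and n: "n \<le> k + s0 + X"
  shows "D n \<le> 0"
proof (cases "n < k + s0")
  case True then show ?thesis using D_zero by simp
next
  case False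
  define x where "x = n - k - s0"
  have nx: "n = k + s0 + x" "x \<le> X" using False n by (auto simp: x_def)
  have P'_gt: "s0 < s" if "s \<in> P'" for s
    using that s0_P' agree[of s] nc[of s] by (metis linorder_neqE_nat not_le)
  have MinP: "Min P = s0" using nc s0_P by (intro Min_eqI) auto
  have zero: "c i + c' i = 0" if "i \<in> {1..<s0}" for i
    using that W.c_below_Min[of i] V.c_below_Min[of i] nc P'_gt s0_bounds
    by (metis add.right_neutral atLeastLessThan_iff less_le_trans less_trans)
  have "(\<Sum>i=1..<s0. c i + c' i) = 0" by (intro sum.neutral ballI zero)
  then have i1: "(\<Sum>i=1..s0. c i + c' i) = 1" unfolding sum_to_s0 by (simp add: c_s0)
  have "c (Suc s0) = 0"
  proof (rule ccontr)
    assume "c (Suc s0) \<noteq> 0"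
    then have "k + 2 \<le> Min P + Suc s0" using long MinP s0_bounds by (intro W.prime_gap) auto
    then show False using MinP long by simp
  qed
  moreover have "c' (Suc s0) \<le> 1" using s0_bounds by (intro V.c_le_one) auto
  ultimately have i2: "(\<Sum>i=1..Suc s0. c i + c' i) \<le> 2" using i1 by simp
  have win: "0 \<le> \<kappa> N" "(\<Sum>i=1..min s0 N. \<kappa> (N - i)) \<le> \<kappa> N" if "N \<le> X" for N
    using window_nonneg[OF n1, of X s0 N] cond i1 i2 that by auto
  have mult: "s0 + t * s0 \<in> P" if "s0 + t * s0 < k" for t
    using that
  proof (induction t)
    case 0 then show ?case using s0_P by simp
  next
    case (Suc t)
    define s where "s = s0 + t * s0"
    have s: "s \<in> P" "s0 + Suc t * s0 = s + s0" "s + s0 < k" using Suc by (auto simp: s_def)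
    have "c s0 \<le> (\<Sum>t\<in>{t\<in>P. t < s + s0}. c (s + s0 - t))"
      using member_le_sum[of s "{t\<in>P. t < s + s0}" "\<lambda>t. c (s + s0 - t)"] s s0_bounds W.c_nonneg by simp
    then have "1 \<le> (of_bool (s + s0 \<in> P) :: int)"
      using W.P_conv[of "s + s0"] s s0_bounds c_s0 W.c_nonneg[of "s + s0"] by simp
    then show ?case unfolding s(2) by (cases "s + s0 \<in> P") auto
  qed
  \<comment> \<open>Beyond \<open>s0\<close> the non-multiples are those for \<open>x - s0\<close>,
    shifted. By induction they sum to at most \<open>\<kappa> (x - s0)\<close>, which fills the slot
    \<open>i = s0\<close> of the window at \<open>x\<close>.\<close>
  have block: "(\<Sum>i\<in>{i\<in>{1..x}. \<not> s0 dvd i}. \<kappa> (x - i)) \<le> \<kappa> x" if "x \<le> X" for x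
    using that
  proof (induction x rule: less_induct)
    case (less x)
    show ?case
    proof (cases "x < s0")
      case True
      then have "{i\<in>{1..x}. \<not> s0 dvd i} = {1..min s0 x}" by (auto dest: dvd_imp_le)
      then show ?thesis using win(2)[of x] less.prems by simp
    next
      case False
      have set: "{i\<in>{1..x}. \<not> s0 dvd i} = {1..<s0} \<union> (\<lambda>i. i + s0) ` {i\<in>{1..x - s0}. \<not> s0 dvd i}"
      proof (intro set_eqI iffI)
        fix i assume i: "i \<in> {i\<in>{1..x}. \<not> s0 dvd i}"
        show "i \<in> {1..<s0} \<union> (\<lambda>i. i + s0) ` {i\<in>{1..x - s0}. \<not> s0 dvd i}"
        proof (cases "i < s0")
          case False
          have "i \<noteq> s0" using i by auto
          moreover have "\<not> s0 dvd (i - s0)" using i False by (simp add: dvd_minus_self)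
          ultimately have "i - s0 \<in> {i\<in>{1..x - s0}. \<not> s0 dvd i}" using i False by auto
          then have "(i - s0) + s0 \<in> (\<lambda>i. i + s0) ` {i\<in>{1..x - s0}. \<not> s0 dvd i}" by blast
          then show ?thesis using False by simp
        qed (use i in auto)
      qed (use False s0_bounds in \<open>auto dest: dvd_imp_le\<close>)
      have "(\<Sum>i\<in>{i\<in>{1..x}. \<not> s0 dvd i}. \<kappa> (x - i))
          = (\<Sum>i=1..<s0. \<kappa> (x - i)) + (\<Sum>i\<in>(\<lambda>i. i + s0) ` {i\<in>{1..x - s0}. \<not> s0 dvd i}. \<kappa> (x - i))"
        unfolding set by (intro sum.union_disjoint) auto
      also have "(\<Sum>i\<in>(\<lambda>i. i + s0) ` {i\<in>{1..x - s0}. \<not> s0 dvd i}. \<kappa> (x - i))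
          = (\<Sum>i\<in>{i\<in>{1..x - s0}. \<not> s0 dvd i}. \<kappa> (x - s0 - i))"
        by (subst sum.reindex) (auto simp: inj_on_def add.commute)
      also have "\<dots> \<le> \<kappa> (x - s0)" using less.prems False s0_bounds by (intro less.IH) auto
      also have "(\<Sum>i=1..<s0. \<kappa> (x - i)) + \<kappa> (x - s0) = (\<Sum>i=1..min s0 x. \<kappa> (x - i))"
        using False sum_to_s0[of "\<lambda>i. \<kappa> (x - i)"] by simp
      also have "\<dots> \<le> \<kappa> x" using win(2)[of x] less.prems by simp
      finally show ?thesis by simp
    qed
  qed
  have "- (\<Sum>i\<in>{i\<in>{1..x}. \<not> s0 dvd i}. \<kappa> (x - i)) \<le> (\<Sum>i=1..x. (of_bool (s0 + i \<in> P) - of_bool (s0 + i \<in> P')) * \<kappa> (x - i))"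
  proof -
    have "- (\<Sum>i\<in>{i\<in>{1..x}. \<not> s0 dvd i}. \<kappa> (x - i)) = (\<Sum>i=1..x. - of_bool (\<not> s0 dvd i) * \<kappa> (x - i))"
      unfolding sum_negf[symmetric] by (intro sum.mono_neutral_cong_left) auto
    also have "\<dots> \<le> (\<Sum>i=1..x. (of_bool (s0 + i \<in> P) - of_bool (s0 + i \<in> P')) * \<kappa> (x - i))"
    proof (intro sum_mono mult_right_mono win(1))
      fix i
      show "- (of_bool (\<not> s0 dvd i) :: int) \<le> of_bool (s0 + i \<in> P) - of_bool (s0 + i \<in> P')"
      proof (cases "s0 dvd i \<and> s0 + i \<in> P'")
        case True
        then obtain t where "i = s0 * t" by (auto elim: dvdE)
        then have "s0 + i \<in> P" using mult[of t] True V.P_bounds[of "s0 + i"] by (simp add: mult.commute)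
        then show ?thesis by simp
      qed auto
      show "x - i \<le> X" using nx by simp
    qed
    finally show ?thesis .
  qed
  moreover have "- D n = \<kappa> x + (\<Sum>i=1..x. (of_bool (s0 + i \<in> P) - of_bool (s0 + i \<in> P')) * \<kappa> (x - i))"
    unfolding nx(1) minus_D_eq using s0_P s0_P' by (simp add: sum.atLeast_Suc_atMost)
  ultimately show ?thesis using block[OF nx(2)] by linarith
qed

end

subsection \<open>Tables for the small exceptional cases\<close>

text \<open>The pairs \<open>(h, c)\<close> are stored newest first: when entry \<open>n\<close> is
  computed, \<open>t ! (j - 1)\<close> is the pair at \<open>n - j\<close>.\<close>

definition corr_next :: "int \<Rightarrow> nat \<Rightarrow> nat list \<Rightarrow> nat \<Rightarrow> (int \<times> int) list \<Rightarrow> (int \<times> int) list" where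
  "corr_next q k ps n t = (
      let hn = (if n < k then 0 else if n = k then 1 else q * fst (t ! 0) - snd (t ! (k - 1)))
      in (hn, (if n < k then of_bool (n \<in> set ps) else hn)
            - (\<Sum>s\<leftarrow>filter (\<lambda>s. s < n) ps. snd (t ! (s - 1)))) # t)"

definition corr_table :: "int \<Rightarrow> nat \<Rightarrow> nat list \<Rightarrow> nat \<Rightarrow> (int \<times> int) list" where
  "corr_table q k ps X = fold (corr_next q k ps) [1..<Suc X] [(0, 0)]"

text \<open>What \<open>D_nonpos_common\<close> needs of
  \<open>16 * k - 4 + 4 * q ^ m \<le> q ^ k\<close> once \<open>32 * q ^ m \<le> q ^ k\<close> is
  known, with denominators cleared.\<close>

lemma exp_bound_16: "7 \<le> k \<Longrightarrow> 128 * int k \<le> 7 * 2 ^ k + 32"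
  by (induction k rule: dec_induct) auto

lemma exp_bound_8: "6 \<le> k \<Longrightarrow> 8 * (2 * int k - 4) \<le> 2 ^ k"
  by (induction k rule: dec_induct) auto

context corr
begin

lemma corr_table_correct:
  assumes ps: "set ps = P" "distinct ps"
  shows "length (corr_table q k ps n) = Suc n \<and> (\<forall>j<n. corr_table q k ps n ! j = (h (n - j), c (n - j)))
     \<and> fst (corr_table q k ps n ! n) = h 0"
proof (induction n)
  case 0 then show ?case using h_zero k1 by (simp add: corr_table_def)
next
  case (Suc n)
  define t where "t = corr_table q k ps n"
  have t: "length t = Suc n" "\<And>j. j < n \<Longrightarrow> t ! j = (h (n - j), c (n - j))" "fst (t ! n) = h 0"
    using Suc by (auto simp: t_def)
  define hn where "hn = (if Suc n < k then 0 else if Suc n = k then 1 else q * fst (t ! 0) - snd (t ! (k - 1)))"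
  define cn where "cn = (if Suc n < k then of_bool (Suc n \<in> set ps) else hn)
        - (\<Sum>s\<leftarrow>filter (\<lambda>s. s < Suc n) ps. snd (t ! (s - 1)))"
  have tab: "corr_table q k ps (Suc n) = (hn, cn) # t"
    by (simp add: corr_table_def corr_next_def Let_def t_def hn_def cn_def)
  have hn: "hn = h (Suc n)"
  proof -
    consider "Suc n < k" | "Suc n = k" | "k \<le> n" by linarith
    then show ?thesis
    proof cases
      case 3
      then have "h (Suc n) = q * h n - c (n - (k - 1))" using h_step[of n] k1 by simp
      moreover have "t ! 0 = (h n, c n)" "t ! (k - 1) = (h (n - (k - 1)), c (n - (k - 1)))"
        using 3 k1 t(2)[of 0] t(2)[of "k - 1"] by auto
      ultimately show ?thesis using 3 by (simp add: hn_def)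
    qed (auto simp: hn_def h_zero h_k)
  qed
  have "(\<Sum>s\<leftarrow>filter (\<lambda>s. s < Suc n) ps. snd (t ! (s - 1))) = (\<Sum>s\<in>{s\<in>P. s < Suc n}. snd (t ! (s - 1)))"
    using ps by (simp add: sum_list_distinct_conv_sum_set)
  also have "\<dots> = (\<Sum>s\<in>{s\<in>P. s < Suc n}. c (Suc n - s))"
  proof (intro sum.cong refl)
    fix s assume "s \<in> {s\<in>P. s < Suc n}"
    then have "s - 1 < n" "n - (s - 1) = Suc n - s" using P_bounds[of s] by auto
    then show "snd (t ! (s - 1)) = c (Suc n - s)" using t(2)[of "s - 1"] by simp
  qed
  finally have sm: "(\<Sum>s\<leftarrow>filter (\<lambda>s. s < Suc n) ps. snd (t ! (s - 1))) = (\<Sum>s\<in>{s\<in>P. s < Suc n}. c (Suc n - s))" .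
  have cn: "cn = c (Suc n)"
  proof (cases "Suc n < k")
    case True
    then show ?thesis using P_conv[of "Suc n"] ps unfolding cn_def sm by simp
  next
    case False
    then have "{s\<in>P. s < Suc n} = P" using P_bounds by fastforce
    then show ?thesis using h_conv[of "Suc n"] False hn unfolding cn_def sm by simp
  qed
  show ?case unfolding tab using t hn cn by (auto simp: nth_Cons split: nat.splits)
qed

lemma corr_table_h:
  assumes ps: "set ps = P" "distinct ps" and n: "n \<le> X"
  shows "fst (corr_table q k ps X ! (X - n)) = h n"
  using corr_table_correct[OF ps, of X] n by (cases "n = 0") auto

subsection \<open>The first hitting time is almost surely finite\<close>

text \<open>For a word, the probability that it is first completed at time \<open>n\<close> by
  independent uniform letters.\<close>

definition \<eta> :: "nat \<Rightarrow> real" where "\<eta> n = real_of_int (h n) / real_of_int q ^ n"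

lemma q_real: "2 \<le> real_of_int q"
  using q2 by simp

lemma \<eta>_nonneg [simp]: "0 \<le> \<eta> n"
  using q_real by (simp add: \<eta>_def)

lemma \<eta>_antimono: assumes "k \<le> m" "m \<le> n" shows "\<eta> n \<le> \<eta> m"
  using assms(2)
proof (induction n rule: dec_induct)
  case (step n)
  have "h (Suc n) \<le> q * h n" using h_step[of n] step assms c_nonneg[of "Suc n - k"] by simp
  then have "real_of_int (h (Suc n)) \<le> real_of_int q * real_of_int (h n)" by (metis of_int_le_iff of_int_mult)
  then have "\<eta> (Suc n) \<le> \<eta> n" using q_real by (simp add: \<eta>_def field_simps)
  then show ?case using step by simp
qed simp

text \<open>Append \<open>w\<close> to a string of length \<open>n\<close> without occurrence: the
  first hit comes at \<open>n + k - s\<close> with \<open>s\<close> zero or a period, and the last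
  \<open>s\<close> letters are forced. So the sum on the right is the probability of no hit up to
  \<open>n\<close>.\<close>

lemma \<eta>_sum:
  "(\<Sum>i\<le>n. \<eta> i) = 1 - (\<Sum>s\<in>insert 0 P. real_of_int q ^ (k - s) * \<eta> (n + k - s))"
proof (induction n)
  case 0
  have "0 \<notin> P" using P_bounds by fastforce
  moreover have "(\<Sum>s\<in>P. real_of_int q ^ (k - s) * \<eta> (k - s)) = 0"
  proof (intro sum.neutral ballI)
    fix s assume "s \<in> P"
    then have "k - s < k" using P_bounds[of s] by simp
    then show "real_of_int q ^ (k - s) * \<eta> (k - s) = 0" by (simp add: \<eta>_def h_zero)
  qed
  moreover have "real_of_int q ^ k * \<eta> k = 1" using q_real by (simp add: \<eta>_def h_k)
  moreover have "\<eta> 0 = 0" using k1 h_zero by (simp add: \<eta>_def)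
  ultimately show ?case by simp
next
  case (Suc n)
  \<comment> \<open>The -1 at \<open>s = Suc n\<close> is the jump of \<open>h\<close> from 0 to
    \<open>h k = 1\<close>; it cancels the indicator of \<open>P_conv\<close>.\<close>
  define g where "g s = (if s \<le> n then c (Suc n - s) else if s = Suc n then - 1 else 0)" for s
  have summand: "real_of_int q ^ (k - s) * \<eta> (n + k - s) - real_of_int q ^ (k - s) * \<eta> (Suc n + k - s)
      = real_of_int (g s) / real_of_int q ^ Suc n" if s: "s \<in> insert 0 P" for s
  proof -
    have sk: "s < k" using s P_bounds k1 by auto
    have e: "real_of_int q ^ (n + k - s) = real_of_int q ^ n * real_of_int q ^ (k - s)"
      "real_of_int q ^ (Suc n + k - s) = real_of_int q ^ Suc n * real_of_int q ^ (k - s)"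
    proof -
      have "n + k - s = n + (k - s)" "Suc n + k - s = Suc n + (k - s)" using sk by auto
      then show "real_of_int q ^ (n + k - s) = real_of_int q ^ n * real_of_int q ^ (k - s)"
        "real_of_int q ^ (Suc n + k - s) = real_of_int q ^ Suc n * real_of_int q ^ (k - s)"
        by (simp_all only: power_add)
    qed
    have q0: "real_of_int q \<noteq> 0" using q_real by simp
    have "q * h (n + k - s) - h (Suc n + k - s) = g s"
    proof -
      consider "s \<le> n" | "s = Suc n" | "Suc n < s" by linarith
      then show ?thesis
      proof cases
        case 1
        then have "h (Suc (n + k - s)) = q * h (n + k - s) - c (Suc (n + k - s) - k)" by (intro h_step) simp
        moreover have "Suc (n + k - s) = Suc n + k - s" "Suc (n + k - s) - k = Suc n - s" using 1 sk by auto
        ultimately show ?thesis using 1 by (simp add: g_def)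
      next
        case 2 then show ?thesis using h_zero[of "k - 1"] k1 h_k by (simp add: g_def)
      next
        case 3 then show ?thesis using h_zero[of "n + k - s"] h_zero[of "Suc n + k - s"] sk by (simp add: g_def)
      qed
    qed
    then have "real_of_int (g s) = real_of_int q * real_of_int (h (n + k - s)) - real_of_int (h (Suc n + k - s))"
      by (metis of_int_diff of_int_mult)
    then show ?thesis unfolding \<eta>_def e using q0 by (simp add: field_simps)
  qed
  have "(\<Sum>s\<in>insert 0 P. g s) = h (Suc n)"
  proof -
    have z: "0 \<notin> P" using P_bounds by fastforce
    have "(\<Sum>s\<in>P. g s) = (\<Sum>s\<in>P. (if s \<le> n then c (Suc n - s) else 0) - of_bool (s = Suc n))"
      by (intro sum.cong) (auto simp: g_def)
    also have "\<dots> = (\<Sum>s\<in>{s\<in>P. s < Suc n}. c (Suc n - s)) - of_bool (Suc n \<in> P)"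
      by (simp add: sum_subtractf sum.inter_filter[symmetric] less_Suc_eq_le of_bool_def sum.delta)
    finally have *: "(\<Sum>s\<in>insert 0 P. g s) = c (Suc n) + (\<Sum>s\<in>{s\<in>P. s < Suc n}. c (Suc n - s)) - of_bool (Suc n \<in> P)"
      using z by (simp add: g_def)
    show ?thesis
    proof (cases "Suc n < k")
      case True then show ?thesis using * P_conv[of "Suc n"] h_zero by simp
    next
      case False
      then have "{s\<in>P. s < Suc n} = P" "Suc n \<notin> P" using P_bounds by fastforce+
      then show ?thesis using * h_conv[of "Suc n"] False by simp
    qed
  qed
  then have "\<eta> (Suc n) = (\<Sum>s\<in>insert 0 P. real_of_int (g s) / real_of_int q ^ Suc n)"
    unfolding \<eta>_def sum_divide_distrib[symmetric] by (simp del: sum.insert flip: of_int_sum)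
  also have "\<dots> = (\<Sum>s\<in>insert 0 P. real_of_int q ^ (k - s) * \<eta> (n + k - s)) - (\<Sum>s\<in>insert 0 P. real_of_int q ^ (k - s) * \<eta> (Suc n + k - s))"
    unfolding sum_subtractf[symmetric] by (intro sum.cong refl summand[symmetric])
  finally show ?case using Suc by simp
qed

lemma \<eta>_sum_le: "(\<Sum>i\<le>n. \<eta> i) \<le> 1"
proof -
  have "0 \<le> (\<Sum>s\<in>insert 0 P. real_of_int q ^ (k - s) * \<eta> (n + k - s))"
    using q_real by (intro sum_nonneg mult_nonneg_nonneg) auto
  then show ?thesis unfolding \<eta>_sum by linarith
qed

text \<open>Partial sums at most 1 and antitonicity from \<open>k\<close> on give
  \<open>(j + 1) * \<eta> n \<le> 1\<close> for \<open>n = m + k + j\<close>, so the remainder in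
  \<open>\<eta>_sum\<close>, at most \<open>K * \<eta> n\<close>, becomes arbitrarily small.\<close>

lemma \<eta>_sum_limit:
  assumes "0 < \<epsilon>"
  shows "\<exists>n\<ge>m. 1 - \<epsilon> < (\<Sum>i\<le>n. \<eta> i)"
proof -
  define K where "K = (\<Sum>s\<in>insert 0 P. real_of_int q ^ (k - s))"
  have K: "0 \<le> K" unfolding K_def using q_real by (intro sum_nonneg) auto
  obtain j :: nat where j: "K / \<epsilon> < real j" using reals_Archimedean2 by blast
  define n where "n = m + k + j"
  have jn: "real (j + 1) * \<eta> n \<le> 1"
  proof -
    have "real (j + 1) * \<eta> n = (\<Sum>i\<in>{n - j..n}. \<eta> n)" by (simp add: n_def)
    also have "\<dots> \<le> (\<Sum>i\<in>{n - j..n}. \<eta> i)" by (intro sum_mono \<eta>_antimono) (auto simp: n_def)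
    also have "\<dots> \<le> (\<Sum>i\<le>n. \<eta> i)" by (intro sum_mono2) auto
    also have "\<dots> \<le> 1" by (rule \<eta>_sum_le)
    finally show ?thesis .
  qed
  have "(\<Sum>s\<in>insert 0 P. real_of_int q ^ (k - s) * \<eta> (n + k - s)) \<le> (\<Sum>s\<in>insert 0 P. real_of_int q ^ (k - s) * \<eta> n)"
    using q_real P_bounds by (intro sum_mono mult_left_mono \<eta>_antimono) (auto simp: n_def, force)
  also have "\<dots> = K * \<eta> n" unfolding K_def by (simp only: sum_distrib_right)
  also have "K * \<eta> n < \<epsilon>"
  proof -
    have "K \<le> real j * \<epsilon>" using j assms by (simp add: field_simps)
    then have "K * \<eta> n \<le> real j * \<epsilon> * \<eta> n" by (intro mult_right_mono) auto
    also have "\<dots> = \<epsilon> * (real (j + 1) * \<eta> n - \<eta> n)" by (simp add: algebra_simps)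
    also have "\<dots> < \<epsilon> * 1"
    proof (intro mult_strict_left_mono assms)
      have "0 < \<eta> n" using h_pos[of n] q_real by (simp add: \<eta>_def n_def)
      then show "real (j + 1) * \<eta> n - \<eta> n < 1" using jn by linarith
    qed
    finally show ?thesis by simp
  qed
  finally have "1 - \<epsilon> < (\<Sum>i\<le>n. \<eta> i)" unfolding \<eta>_sum by linarith
  then show ?thesis by (intro exI[of _ n]) (simp add: n_def)
qed

end

text \<open>Both \<open>\<eta>\<close> have total mass 1. If \<open>h \<le> h'\<close> held
  everywhere, the strict inequality at \<open>m\<close> would cap the mass of the first at
  \<open>1 - \<epsilon>\<close>.\<close>

lemma corr_exceeds:
  fixes h h' :: "nat \<Rightarrow> int"
  assumes W: "corr q k P h c" and V: "corr q k' P' h' c'" and m: "h m < h' m"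
  shows "\<exists>n. h' n < h n"
proof (rule ccontr)
  assume "\<nexists>n. h' n < h n"
  then have le: "h n \<le> h' n" for n by (simp add: not_less)
  interpret W: corr q k P h c by (rule W)
  interpret V: corr q k' P' h' c' by (rule V)
  have q0: "0 < real_of_int q" using W.q2 by simp
  have e_le: "W.\<eta> n \<le> V.\<eta> n" for n
    unfolding W.\<eta>_def V.\<eta>_def using le q0 by (intro divide_right_mono) auto
  define \<epsilon> where "\<epsilon> = V.\<eta> m - W.\<eta> m"
  have "0 < \<epsilon>" unfolding \<epsilon>_def W.\<eta>_def V.\<eta>_def using m q0 by (simp add: divide_strict_right_mono)
  then obtain n where n: "n \<ge> m" "1 - \<epsilon> < (\<Sum>i\<le>n. W.\<eta> i)" using W.\<eta>_sum_limit by blast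
  have "\<epsilon> \<le> (\<Sum>i\<le>n. V.\<eta> i - W.\<eta> i)"
    using member_le_sum[of m "{..n}" "\<lambda>i. V.\<eta> i - W.\<eta> i"] n(1) e_le by (simp add: \<epsilon>_def)
  then show False using n(2) V.\<eta>_sum_le[of n] by (simp add: sum_subtractf)
qed

section \<open>Existence of the sign change\<close>

text \<open>Here \<open>c_lower\<close> suffices: away from the start,
  \<open>c (Suc n - k) \<le> h (Suc n - k)\<close> and
  \<open>c' (Suc n - k') \<ge> h' (n - k') \<ge> h' (Suc n - k)\<close>, so the recursion subtracts
  at most an earlier value of \<open>D\<close>. With the invariant that \<open>D n\<close> is a
  running maximum, \<open>D (Suc n) \<ge> 2 * D n - D n\<close>.\<close>

lemma sign_change_longer:
  fixes h h' :: "nat \<Rightarrow> int"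
  assumes W: "corr q k P h c" and V: "corr q k' P' h' c'" and kk: "k' < k"
  shows "\<exists>N>k. (\<forall>n<N. h n - h' n \<le> 0) \<and> (\<forall>n\<ge>N. 0 < h n - h' n)"
proof -
  interpret W: corr q k P h c by (rule W)
  interpret V: corr q k' P' h' c' by (rule V)
  define D where "D n = h n - h' n" for n
  have "\<exists>n. h' n < h n"
    using corr_exceeds[OF W V, of k'] W.h_zero[OF kk] V.h_k by simp
  then have ex: "\<exists>n. 0 < D n" by (simp add: D_def)
  define N where "N = (LEAST n. 0 < D n)"
  have N: "0 < D N" "\<And>n. n < N \<Longrightarrow> D n \<le> 0"
    using LeastI_ex[OF ex] not_less_Least[of _ "\<lambda>n. 0 < D n"] unfolding N_def not_less by blast+
  have Nk: "k < N"
  proof (rule ccontr)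
    assume "\<not> k < N"
    then have "h N \<le> of_bool (N = k)" using W.h_k W.h_zero[of N] by simp
    moreover have "1 \<le> h' N" if "N = k" using V.h_pos[of N] that kk by simp
    moreover have "0 \<le> h' N" by simp
    ultimately have "D N \<le> 0" unfolding D_def by (cases "N = k") (auto simp del: V.h_nonneg W.h_nonneg)
    then show False using N by simp
  qed
  have "0 < D n \<and> (\<forall>m\<le>n. D m \<le> D n)" if "N \<le> n" for n
    using that
  proof (induction n rule: dec_induct)
    case base
    have "D m \<le> D N" if "m \<le> N" for m using N(1) N(2)[of m] that by (cases "m = N") auto
    then show ?case using N by blast
  next
    case (step n)
    have st: "D (Suc n) = q * D n - (c (Suc n - k) - c' (Suc n - k'))"
      using W.h_step[of n] V.h_step[of n] step Nk kk by (simp add: D_def algebra_simps)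
    have dbl: "2 * D n \<le> q * D n" using W.q2 step by (intro mult_right_mono) auto
    have "c (Suc n - k) - c' (Suc n - k') \<le> D n"
    proof (cases "Suc n - k \<le> k")
      case True
      have "c (Suc n - k) \<le> 1" using True step Nk by (intro W.c_le_one) auto
      then show ?thesis using step V.c_nonneg[of "Suc n - k'"] by linarith
    next
      case False
      then have "c (Suc n - k) \<le> h (Suc n - k)" by (intro W.c_le_h) simp
      moreover have "(q - 1) * h' (n - k') \<le> c' (Suc n - k')"
        using V.c_lower[of "n - k'"] False kk by (simp add: Suc_diff_le)
      moreover have "1 * h' (n - k') \<le> (q - 1) * h' (n - k')" using W.q2 by (intro mult_right_mono) auto
      moreover have "h' (Suc n - k) \<le> h' (n - k')" using kk by (intro V.h_mono) simp
      moreover have "D (Suc n - k) \<le> D n" using step W.k1 by simp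
      ultimately show ?thesis unfolding D_def by linarith
    qed
    then have "D n \<le> D (Suc n)" using st dbl by linarith
    then show ?case using step by (auto simp: le_Suc_eq intro: order_trans)
  qed
  then show ?thesis using N Nk unfolding D_def by blast
qed

context corr_pair
begin

section \<open>Nonpositivity up to the thresholds of the estimates\<close>

lemma D_nonpos_by_table:
  assumes "set ps = P" "distinct ps" "set ps' = P'" "distinct ps'" "q = q0" "k = k0"
    and le: "list_all2 (\<lambda>x y. fst x \<le> fst y) (corr_table q0 k0 ps X) (corr_table q0 k0 ps' X)"
    and n: "n \<le> X"
  shows "D n \<le> 0"
proof -
  have "X - n < length (corr_table q k ps X)" using W.corr_table_correct[of ps X] assms by simp
  then have "fst (corr_table q k ps X ! (X - n)) \<le> fst (corr_table q k ps' X ! (X - n))"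
    using list_all2_nthD[OF le] assms(5,6) by simp
  then show ?thesis
    unfolding D_def using W.corr_table_h[OF assms(1,2) n] V.corr_table_h[OF assms(3,4) n] by simp
qed

text \<open>The choice \<open>X = k\<close> makes the linear term of \<open>cond\<close> vanish and
  still reaches the threshold \<open>2 * k + s0 - 1\<close> at which
  \<open>\<delta>_le_one_prime\<close> takes over.\<close>

lemma D_nonpos_one_prime:
  assumes n1: "1 \<notin> P" "1 \<notin> P'" and s2: "2 \<le> s0" and nc: "\<And>s. s \<in> P \<Longrightarrow> s0 \<le> s"
    and n: "n \<le> k + s0 + k"
  shows "D n \<le> 0"
proof -
  have pow: "4 * q ^ j \<le> q ^ k" if "j + 2 \<le> k" for j
  proof -
    have "2 ^ 2 * q ^ j \<le> q ^ 2 * q ^ j" using W.q2 by (intro mult_right_mono power_mono) auto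
    also have "\<dots> \<le> q ^ k" unfolding power_add[symmetric] using that W.q2 by (intro power_increasing) auto
    finally show ?thesis by simp
  qed
  show ?thesis
  proof (cases "2 * s0 < k")
    case True
    then show ?thesis using D_nonpos_periodic[OF n1 nc True, of k n] pow[of "s0 + 1"] s2 n by simp
  next
    case False
    have "k - s0 \<le> s" if "s \<in> P" for s using nc[OF that] False by simp
    then show ?thesis using D_nonpos_overlap[OF n1, of k n] pow[of "k - s0"] s2 n s0_bounds by auto
  qed
qed

text \<open>Two primes \<open>p' < l\<close> of \<open>w'\<close> lie strictly between
  \<open>s0\<close> and \<open>k\<close>, so \<open>s0 + 3 \<le> k\<close>. This room gives
  \<open>8 * q ^ j \<le> q ^ k\<close> for the exponents in question, enough for the range except
  when \<open>k = 5\<close>; there \<open>s0 = 2\<close>, and for \<open>q = 2\<close> a table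
  decides.\<close>

lemma D_nonpos_no_common:
  assumes n1: "1 \<notin> P" "1 \<notin> P'" and s2: "2 \<le> s0" and nc: "\<And>s. s \<in> P \<Longrightarrow> s0 \<le> s"
    and two: "1 < (\<Sum>i=1..<k. c' i)" and n: "n < 4 * k + s0 - 1"
  shows "D n \<le> 0"
proof -
  have P'_gt: "s0 < s" if "s \<in> P'" for s
    using that s0_P' agree[of s] nc[of s] by (metis linorder_neqE_nat not_le)
  have "P' \<noteq> {}"
  proof
    assume "P' = {}"
    then have "(\<Sum>i=1..<k. c' i) = 0" by (intro sum.neutral) (auto intro: V.c_below_Min)
    then show False using two by simp
  qed
  define p' where "p' = Min P'"
  have p': "p' \<in> P'" "\<And>s. s \<in> P' \<Longrightarrow> p' \<le> s" "c' p' = 1"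
    using \<open>P' \<noteq> {}\<close> V.c_Min by (auto simp: p'_def)
  have "\<exists>l\<in>{1..<k}-{p'}. c' l \<noteq> 0"
  proof (rule ccontr)
    assume "\<not> ?thesis"
    then have "(\<Sum>i\<in>{1..<k}-{p'}. c' i) = 0" by simp
    moreover have "(\<Sum>i=1..<k. c' i) = c' p' + (\<Sum>i\<in>{1..<k}-{p'}. c' i)"
      using V.P_bounds[OF p'(1)] by (intro sum.remove) auto
    ultimately show False using two p' by simp
  qed
  then obtain l where l: "1 \<le> l" "l < k" "l \<noteq> p'" "c' l \<noteq> 0" by fastforce
  then have lP: "l \<in> P'" using V.c_le_bool[of l] V.c_nonneg[of l] by (cases "l \<in> P'") auto
  have gap: "k + 2 \<le> p' + l" using V.prime_gap[of l] l by (simp add: p'_def)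
  have lp: "p' < l" using p'(2)[OF lP] l by simp
  have s0k: "s0 + 3 \<le> k" using P'_gt[OF p'(1)] lp l by simp
  have big: "4 * (2 * int k - 4) + 4 * q ^ j \<le> q ^ k" if "6 \<le> k" "j + 3 \<le> k" for j
  proof -
    have "2 ^ 3 * q ^ j \<le> q ^ 3 * q ^ j" using W.q2 by (intro mult_right_mono power_mono) auto
    also have "\<dots> \<le> q ^ k" unfolding power_add[symmetric] using that W.q2 by (intro power_increasing) auto
    finally have "8 * q ^ j \<le> q ^ k" by simp
    moreover have "2 ^ k \<le> q ^ k" using W.q2 by (intro power_mono) auto
    ultimately show ?thesis using exp_bound_8[OF that(1)] by linarith
  qed
  show ?thesis
  proof (cases "2 * s0 < k")
    case long: True
    show ?thesis
    proof (cases "k = 5")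
      case k5: True
      then have s02: "s0 = 2" using long s2 by simp
      have p3: "p' = 3" using gap l k5 P'_gt[OF p'(1)] lp s02 by simp
      have l4: "l = 4" using lp l k5 p3 by simp
      show ?thesis
      proof (cases "q = 2")
        case q2: True
        have "P' = {3, 4}"
        proof
          show "P' \<subseteq> {3, 4}" using p'(2) p3 V.P_bounds k5 by fastforce
        qed (use p' lP p3 l4 in auto)
        moreover have "P = {2, 4}"
        proof
          have "3 \<notin> P"
          proof
            assume "3 \<in> P"
            then have "3 - 2 \<in> P" using s0_P s02 k5 by (intro W.fw) auto
            then show False using n1 by simp
          qed
          show "P \<subseteq> {2, 4}"
          proof
            fix s assume "s \<in> P"
            then have "2 \<le> s" "s < 5" "s \<noteq> 3" using nc[of s] s02 W.P_bounds[of s] k5 \<open>3 \<notin> P\<close> by auto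
            then show "s \<in> {2, 4}" by auto
          qed
          have "c 2 \<le> (\<Sum>s\<in>{s\<in>P. s < 4}. c (4 - s))"
            using member_le_sum[of 2 "{s\<in>P. s < 4}" "\<lambda>s. c (4 - s)"] s0_P s02 W.c_nonneg by simp
          then have "1 \<le> (of_bool (4 \<in> P) :: int)"
            using W.P_conv[of 4] k5 c_s0 s02 W.c_nonneg[of 4] by simp
          then show "{2, 4} \<subseteq> P" using s0_P s02 by (cases "4 \<in> P") auto
        qed
        moreover have "list_all2 (\<lambda>x y. fst x \<le> fst y) (corr_table 2 5 [2, 4] 20) (corr_table 2 5 [3, 4] 20)"
          by code_simp
        ultimately show ?thesis using q2 k5 n s02 by (intro D_nonpos_by_table[of "[2, 4]" "[3, 4]" 2 5 20 n]) auto
      next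
        case False
        then have q3: "3 \<le> q" using W.q2 by simp
        have "4 * int (13 - 2 - 5) + 4 * q ^ 3 \<le> q ^ 5"
        proof -
          have "3 ^ 2 * q ^ 3 \<le> q ^ 2 * q ^ 3" using q3 by (intro mult_right_mono power_mono) auto
          moreover have "3 ^ 3 \<le> q ^ 3" using q3 by (intro power_mono) auto
          ultimately show ?thesis unfolding power_add[symmetric] by simp
        qed
        then show ?thesis using D_nonpos_periodic[OF n1 nc long, of 13 n] n s02 k5 by simp
      qed
    next
      case False
      then have k6: "6 \<le> k" using long s2 by simp
      have "4 * int (3 * k - 2 - s0 - k) + 4 * q ^ (s0 + 1) \<le> q ^ k"
        using big[OF k6, of "s0 + 1"] long k6 s2 by (simp add: of_nat_diff)
      then show ?thesis using n k6 by (intro D_nonpos_periodic[OF n1 nc long, of "3 * k - 2"]) auto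
    qed
  next
    case short: False
    have k6: "6 \<le> k" using short s0k by simp
    have m: "k - s0 \<le> s" if "s \<in> P" for s using nc[OF that] short by simp
    have "int (3 * k - 2 + 1 - (k - s0) - k) \<le> 2 * int k - 4" using s0k by simp
    then have "4 * int (3 * k - 2 + 1 - (k - s0) - k) + 4 * q ^ (k - s0) \<le> q ^ k"
    proof -
      have "k - s0 + 3 \<le> k" using short k6 by simp
      then have "4 * (2 * int k - 4) + 4 * q ^ (k - s0) \<le> q ^ k" by (rule big[OF k6])
      moreover have "4 * int (3 * k - 2 + 1 - (k - s0) - k) \<le> 4 * (2 * int k - 4)"
        using \<open>int (3 * k - 2 + 1 - (k - s0) - k) \<le> 2 * int k - 4\<close> by (rule mult_left_mono) simp
      ultimately show ?thesis by (meson add_right_mono order_trans)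
    qed
    then show ?thesis using n k6 m by (intro D_nonpos_overlap[OF n1, of "3 * k - 2"]) auto
  qed
qed

text \<open>\<open>k + 2 \<le> p + s0\<close> and \<open>p < s0\<close> force
  \<open>2 * m + 3 \<le> k\<close> for \<open>m = k - s0\<close>, and all periods are at least
  \<open>m\<close>. \<open>D_nonpos_overlap\<close> then covers the range unless
  \<open>q = 2\<close> and \<open>k\<close> is 5 or 6; there \<open>m = 1\<close>, and
  \<open>p\<close> determines both period sets.\<close>

lemma D_nonpos_common:
  assumes p_def: "p = Min P" and p_less: "p < s0" and n: "n < 7 * k - 1"
  shows "D n \<le> 0"
proof -
  note facts = p_P[OF p_def p_less] p_le[OF p_def p_less] p_s0[OF p_def p_less] p_ge3[OF p_def p_less]
    one_notin_P[OF p_def p_less]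
  have n1: "1 \<notin> P" "1 \<notin> P'" using facts(5,6) agree[of 1] p_less by auto
  define m where "m = k - s0"
  have ms: "m + s0 = k" using s0_bounds by (simp add: m_def)
  then have m: "1 \<le> m" "m + 2 \<le> p" "2 * m + 3 \<le> k"
    using s0_bounds p_less facts(4) by linarith+
  have m_le: "k - s0 \<le> s" if "s \<in> P" for s using facts(3)[OF that] m by (simp add: m_def)
  have idx: "6 * k - 2 - s0 + 1 - (k - s0) - k = 4 * k - 1" using s0_bounds by simp
  have main: "D n \<le> 0" if "16 * int k - 4 + 4 * q ^ m \<le> q ^ k"
  proof -
    have "4 * int (6 * k - 2 - s0 + 1 - (k - s0) - k) + 4 * q ^ (k - s0) \<le> q ^ k"
      using that unfolding idx m_def using s0_bounds by simp
    then show ?thesis using n s0_bounds m_le by (intro D_nonpos_overlap[OF n1, of "6 * k - 2 - s0"]) auto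
  qed
  consider "7 \<le> k" | "k = 5 \<or> k = 6" "3 \<le> q" | "k = 5" "q = 2" | "k = 6" "q = 2"
    using m W.q2 by linarith
  then show ?thesis
  proof cases
    case 1
    have "2 ^ 5 * q ^ m \<le> q ^ 5 * q ^ m" using W.q2 by (intro mult_right_mono power_mono) auto
    also have "\<dots> \<le> q ^ k" unfolding power_add[symmetric] using 1 m W.q2 by (intro power_increasing) auto
    finally have "32 * q ^ m \<le> q ^ k" by simp
    moreover have "2 ^ k \<le> q ^ k" using W.q2 by (intro power_mono) auto
    ultimately have "16 * int k - 4 + 4 * q ^ m \<le> q ^ k" using exp_bound_16[OF 1] by linarith
    then show ?thesis by (rule main)
  next
    case 2
    then have "m = 1" using m by auto
    have "3 ^ 4 * q \<le> q ^ 4 * q" using 2 by (intro mult_right_mono power_mono) auto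
    also have "q ^ 4 * q = q ^ 5" by (simp add: eval_nat_numeral mult_ac)
    also have "\<dots> \<le> q ^ k" using 2 by (intro power_increasing) auto
    finally have "81 * q \<le> q ^ k" by simp
    then show ?thesis using 2 \<open>m = 1\<close> by (intro main) auto
  next
    case 3
    then have s: "s0 = 4" "p = 3" using m ms p_less by auto
    have "s \<in> {3, 4}" if "s \<in> P" for s using facts(3)[OF that] W.P_bounds[OF that] 3 s by auto
    then have "P = {3, 4}" using facts(1) s0_P s by auto
    moreover have "P' = {3}"
    proof
      show "P' \<subseteq> {3}"
      proof
        fix t assume t: "t \<in> P'"
        then have "t < 5" "t \<noteq> 4" using V.P_bounds[OF t] 3 s0_P' s by auto
        then have "t \<in> P" using agree[of t] t s by auto
        then show "t \<in> {3}" using \<open>P = {3, 4}\<close> \<open>t \<noteq> 4\<close> by auto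
      qed
    qed (use facts(2) s in auto)
    moreover have "list_all2 (\<lambda>x y. fst x \<le> fst y) (corr_table 2 5 [3, 4] 33) (corr_table 2 5 [3] 33)"
      by code_simp
    ultimately show ?thesis using 3 n by (intro D_nonpos_by_table[of "[3, 4]" "[3]" 2 5 33 n]) auto
  next
    case 4
    then have s: "s0 = 5" "p = 3 \<or> p = 4" using m ms p_less by auto
    have P: "P = {p, 5}"
    proof
      show "P \<subseteq> {p, 5}"
      proof
        fix t assume t: "t \<in> P"
        have b: "p \<le> t" "t < 6" using facts(3)[OF t] W.P_bounds[OF t] 4 by auto
        have "\<not> (p = 3 \<and> t = 4)"
        proof
          assume "p = 3 \<and> t = 4"
          then have "4 - 3 \<in> P" using W.fw[of 3 4] facts(1) t 4 by simp
          then show False using n1 by simp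
        qed
        then show "t \<in> {p, 5}" using b s by auto
      qed
    qed (use facts(1) s0_P s in auto)
    have P': "P' = {p}"
    proof
      show "P' \<subseteq> {p}"
      proof
        fix t assume t: "t \<in> P'"
        then have "t < 6" "t \<noteq> 5" using V.P_bounds[OF t] 4 s0_P' s by auto
        then have "t \<in> P" using agree[of t] t s by auto
        then show "t \<in> {p}" using P \<open>t \<noteq> 5\<close> by auto
      qed
    qed (use facts(2) in auto)
    have "list_all2 (\<lambda>x y. fst x \<le> fst y) (corr_table 2 6 [3, 5] 40) (corr_table 2 6 [3] 40)"
      "list_all2 (\<lambda>x y. fst x \<le> fst y) (corr_table 2 6 [4, 5] 40) (corr_table 2 6 [4] 40)"
      by code_simp+
    then have "list_all2 (\<lambda>x y. fst x \<le> fst y) (corr_table 2 6 [p, 5] 40) (corr_table 2 6 [p] 40)"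
      using s(2) by auto
    then show ?thesis using 4 n P P' s by (intro D_nonpos_by_table[of "[p, 5]" "[p]" 2 6 40 n]) auto
  qed
qed

lemma sign_change_equal_length:
  "\<exists>N>k. (\<forall>n<N. h n - h' n \<le> 0) \<and> (\<forall>n\<ge>N. 0 < h n - h' n)"
proof -
  have "\<exists>n. h' n < h n"
    using corr_exceeds[OF W.corr_axioms V.corr_axioms, of "k + s0"] D_first unfolding D_def by simp
  then have ex: "\<exists>n. 0 < D n" by (simp add: D_def)
  define N where "N = (LEAST n. 0 < D n)"
  have N: "0 < D N" "\<And>n. n < N \<Longrightarrow> D n \<le> 0"
    using LeastI_ex[OF ex] not_less_Least[of _ "\<lambda>n. 0 < D n"] unfolding N_def not_less by blast+
  have Nk: "k < N"
    using N(1) D_zero[of N] s0_bounds by (cases "N < k + s0") auto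
  define pk where "pk y \<longleftrightarrow> ((\<forall>m<y + k. (q - 1) * (\<Sum>i=1..<k. pos (D (m - i))) \<le> pos (D m))
      \<longrightarrow> \<delta> y \<le> (q - 1) * pos (D y))" for y
  have super1: "(\<Sum>i=1..<k. pos (D (m - i))) \<le> pos (D m)"
    if "(q - 1) * (\<Sum>i=1..<k. pos (D (m - i))) \<le> pos (D m)" for m
  proof -
    have "1 * (\<Sum>i=1..<k. pos (D (m - i))) \<le> (q - 1) * (\<Sum>i=1..<k. pos (D (m - i)))"
      using W.q2 by (intro mult_right_mono sum_nonneg) auto
    then show ?thesis using that by linarith
  qed
  \<comment> \<open>Each \<open>M\<close> is the point where a bound on \<open>\<delta>\<close> sets
    in: that bound gives \<open>pk y\<close> for \<open>M < y + k\<close>, and the matching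
    nonpositivity lemma covers the indices below \<open>M\<close>.\<close>
  have "\<exists>M\<ge>k. (\<forall>n<M. D n \<le> 0) \<and> (\<forall>y. M < y + k \<longrightarrow> pk y)"
  proof (cases "Min P < s0")
    case True
    have "pk y" if "7 * k - 1 < y + k" for y
      unfolding pk_def using that W.k1 by (intro impI \<delta>_le_common[OF refl True]) auto
    then show ?thesis using D_nonpos_common[OF refl True] W.k1 by (intro exI[of _ "7 * k - 1"]) auto
  next
    case False
    then have nc: "s0 \<le> s" if "s \<in> P" for s using that by (metis Min_le W.fin_P le_trans not_le)
    have y0: "y < y + k" for y using W.k1 by simp
    consider "s0 = 1" | "2 \<le> s0" using s0_bounds by linarith
    then show ?thesis
    proof cases
      case 1
      have "D n \<le> 0" if "n < 2 * k" for n
        using D_neg[of n] D_zero[of n] that by (cases "n < k + s0") auto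
      moreover have "pk y" if "2 * k < y + k" for y
        unfolding pk_def using that 1 y0 by (intro impI \<delta>_le_period_one super1) auto
      ultimately show ?thesis by (intro exI[of _ "2 * k"]) auto
    next
      case 2
      have n1: "1 \<notin> P" "1 \<notin> P'" using nc[of 1] agree[of 1] 2 by auto
      show ?thesis
      proof (cases "(\<Sum>i=1..<k. c' i) \<le> 1")
        case True
        have "pk y" if "2 * k + s0 - 1 < y + k" for y
          unfolding pk_def using that y0 by (intro impI \<delta>_le_one_prime nc True super1) auto
        moreover have "D n \<le> 0" if "n < 2 * k + s0 - 1" for n
          using that by (intro D_nonpos_one_prime[OF n1 2 nc]) auto
        ultimately show ?thesis using 2 by (intro exI[of _ "2 * k + s0 - 1"]) auto
      next
        case False
        have "pk y" if "4 * k + s0 - 1 < y + k" for y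
          unfolding pk_def using that y0 by (intro impI \<delta>_le_no_common nc super1) auto
        moreover have "D n \<le> 0" if "n < 4 * k + s0 - 1" for n
          using that False by (intro D_nonpos_no_common[OF n1 2 nc]) auto
        ultimately show ?thesis using 2 by (intro exI[of _ "4 * k + s0 - 1"]) auto
      qed
    qed
  qed
  then obtain M where M: "k \<le> M" "\<And>n. n < M \<Longrightarrow> D n \<le> 0" "\<And>y. M < y + k \<Longrightarrow> pk y" by blast
  have "0 < D n" if "N \<le> n" for n
    using positivity_persists[of q k M D \<delta> N n] W.q2 W.k1 M D_step N that unfolding pk_def by blast
  then show ?thesis using N Nk unfolding D_def by blast
qed

end

section \<open>Words\<close>

lemma occurs_at_iff_nth:
  "occurs_at w s j \<longleftrightarrow> j + length w \<le> length s \<and> (\<forall>i<length w. s ! (j + i) = w ! i)"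
  unfolding occurs_at_def by (auto simp: list_eq_iff_nth_eq)

lemma occurs_at_append: "occurs_at w (v @ s) (length v + j) \<longleftrightarrow> occurs_at w s j"
  by (simp add: occurs_at_def)

lemma occurs_at_0: "occurs_at w s 0 \<longleftrightarrow> (\<exists>t. s = w @ t)"
  unfolding occurs_at_def by (metis add_0 append_eq_conv_conj append_take_drop_id drop0 le_add1 length_append)

definition periods :: "'a list \<Rightarrow> nat set" where
  "periods w = {s. 1 \<le> s \<and> s < length w \<and> drop s w = take (length w - s) w}"

definition first_hit :: "'a set \<Rightarrow> 'a list \<Rightarrow> nat \<Rightarrow> 'a list set" where
  "first_hit \<Omega> w n = {s. set s \<subseteq> \<Omega> \<and> length s = n \<and> length w \<le> n
      \<and> occurs_at w s (n - length w)
      \<and> (\<forall>j. j \<noteq> n - length w \<longrightarrow> \<not> occurs_at w s j)}"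

definition returns :: "'a set \<Rightarrow> 'a list \<Rightarrow> nat \<Rightarrow> 'a list set" where
  "returns \<Omega> w L = {x. set x \<subseteq> \<Omega> \<and> length x = length w + L \<and> (\<forall>j. occurs_at w x j \<longleftrightarrow> j = 0 \<or> j = L)}"

lemma h_card: "h \<Omega> w n = card (first_hit \<Omega> w n)"
  by (simp add: h_def first_hit_def)

lemma finite_first_hit: "finite \<Omega> \<Longrightarrow> finite (first_hit \<Omega> w n)"
  by (rule finite_subset[OF _ finite_lists_length_eq[of \<Omega> n]]) (auto simp: first_hit_def)

lemma finite_returns: "finite \<Omega> \<Longrightarrow> finite (returns \<Omega> w L)"
  by (rule finite_subset[OF _ finite_lists_length_eq[of \<Omega> "length w + L"]]) (auto simp: returns_def)

section \<open>Arithmetic of periods\<close>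

lemma period_nth: "s \<in> periods w \<Longrightarrow> i + s < length w \<Longrightarrow> w ! (i + s) = w ! i"
proof -
  assume s: "s \<in> periods w" and i: "i + s < length w"
  have "drop s w ! i = take (length w - s) w ! i" using s by (simp add: periods_def)
  then show "w ! (i + s) = w ! i" using i by (simp add: add.commute)
qed

lemma periodsI:
  assumes "1 \<le> s" "s < length w" "\<And>i. i + s < length w \<Longrightarrow> w ! (i + s) = w ! i"
  shows "s \<in> periods w"
  unfolding periods_def using assms by (auto simp: list_eq_iff_nth_eq add.commute)

lemma period_decomp: "s \<in> periods w \<Longrightarrow> w = take s w @ take (length w - s) w"
  unfolding periods_def by (metis (mono_tags, lifting) append_take_drop_id mem_Collect_eq)

lemma period_extend:
  assumes "i \<in> insert 0 (periods w)"
  shows "take i w @ w = w @ drop (length w - i) w"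
proof (cases "i = 0")
  case False
  then have "w = take i w @ take (length w - i) w" using assms period_decomp by blast
  then have "w @ drop (length w - i) w = take i w @ take (length w - i) w @ drop (length w - i) w"
    by (metis append_assoc)
  then show ?thesis by simp
qed simp

text \<open>Sliding the window by one removes \<open>w ! j\<close> and adds
  \<open>w ! (j + d)\<close>, the same letter.\<close>

lemma mset_period_window:
  assumes d: "d \<in> periods w"
  shows "j + d \<le> length w \<Longrightarrow> mset (take d (drop j w)) = mset (take d w)"
proof (induction j)
  case (Suc j)
  obtain e where e: "d = Suc e" using d by (cases d) (auto simp: periods_def)
  have 1: "drop j w = w ! j # drop (Suc j) w" using Suc.prems by (simp add: Cons_nth_drop_Suc)
  have "take d (drop (Suc j) w) = take e (drop (Suc j) w) @ [w ! (j + d)]"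
    using Suc.prems e by (simp add: take_Suc_conv_app_nth)
  moreover have "w ! (j + d) = w ! j" using period_nth[OF d, of j] Suc.prems by simp
  ultimately have "mset (take d (drop (Suc j) w)) = mset (take d (drop j w))"
    unfolding 1 e by simp
  then show ?case using Suc by simp
qed simp

text \<open>Where there is room, shift by \<open>s\<close> and back by \<open>p\<close>, or in the
  opposite order. Neither is possible only for \<open>i = p - 1\<close> and
  \<open>p + s = length w + 1\<close>. Then cutting \<open>w\<close> into prefixes of lengths
  \<open>p\<close> and \<open>s - 1\<close>, or \<open>s\<close> and \<open>p - 1\<close>, and
  comparing multisets of letters shows that the prefixes of lengths \<open>p\<close> and
  \<open>s\<close> end in the same letter.\<close>

lemma period_diff:
  assumes p: "p \<in> periods w" and s: "s \<in> periods w" and ps: "p < s" "p + s \<le> length w + 1"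
  shows "s - p \<in> periods w"
proof (rule periodsI)
  have b: "1 \<le> p" "s < length w" using p s by (auto simp: periods_def)
  show "1 \<le> s - p" "s - p < length w" using ps b by auto
  fix i assume i: "i + (s - p) < length w"
  consider "i + s < length w" | "length w \<le> i + s" "p \<le> i" | "length w \<le> i + s" "i < p" by linarith
  then show "w ! (i + (s - p)) = w ! i"
  proof cases
    case 1
    then show ?thesis using period_nth[OF s, of i] period_nth[OF p, of "i + (s - p)"] ps by simp
  next
    case 2
    then show ?thesis using period_nth[OF s, of "i - p"] period_nth[OF p, of "i - p"] i ps by simp
  next
    case 3
    then have eq: "i = p - 1" "p + s = length w + 1" using ps b by auto
    have l: "length w - p = s - 1" "length w - s = p - 1" using eq ps b by auto
    have t: "mset (take r w) = mset (take (r - 1) w) + {#w ! (r - 1)#}" if "1 \<le> r" "r \<le> length w" for r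
      using that by (cases r) (auto simp: take_Suc_conv_app_nth)
    have "mset w = mset (take p w) + mset (take (s - 1) w)"
      using arg_cong[OF period_decomp[OF p], of mset] l by simp
    moreover have "mset w = mset (take s w) + mset (take (p - 1) w)"
      using arg_cong[OF period_decomp[OF s], of mset] l by simp
    ultimately have "mset (take (p - 1) w) + {#w ! (p - 1)#} + mset (take (s - 1) w)
        = mset (take (s - 1) w) + {#w ! (s - 1)#} + mset (take (p - 1) w)"
      using t[of p] t[of s] ps b by simp
    then have "w ! (p - 1) = w ! (s - 1)" by simp
    moreover have "i + (s - p) = s - 1" using eq ps b by simp
    ultimately show ?thesis using eq by simp
  qed
qed

section \<open>Counting strings by their occurrences\<close>

lemma card_first_hit_step:
  assumes fin: "finite \<Omega>" and n: "length w \<le> n"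
  shows "card \<Omega> * card (first_hit \<Omega> w n) = card (first_hit \<Omega> w (Suc n)) + card (returns \<Omega> w (Suc n - length w))"
proof -
  define L where "L = Suc n - length w"
  have L: "L = Suc (n - length w)" using n by (simp add: L_def Suc_diff_le)
  have shift: "occurs_at w (a # s) (Suc j) \<longleftrightarrow> occurs_at w s j" for a s j
    using occurs_at_append[of w "[a]" s j] by simp
  have "(\<lambda>(a, s). a # s) ` (\<Omega> \<times> first_hit \<Omega> w n) = first_hit \<Omega> w (Suc n) \<union> returns \<Omega> w L"
  proof (intro equalityI subsetI)
    fix x assume "x \<in> (\<lambda>(a, s). a # s) ` (\<Omega> \<times> first_hit \<Omega> w n)"
    then obtain a s where x: "x = a # s" "a \<in> \<Omega>" "s \<in> first_hit \<Omega> w n" by auto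
    have occ: "occurs_at w x j \<longleftrightarrow> j = L \<or> (j = 0 \<and> occurs_at w x 0)" for j
      using x(3) shift[of a s] L by (cases j) (auto simp: x(1) first_hit_def)
    show "x \<in> first_hit \<Omega> w (Suc n) \<union> returns \<Omega> w L"
    proof (cases "occurs_at w x 0")
      case True
      then have "x \<in> returns \<Omega> w L" using x n occ by (auto simp: returns_def first_hit_def L_def)
      then show ?thesis by simp
    next
      case False
      then have "x \<in> first_hit \<Omega> w (Suc n)" using x n occ by (auto simp: first_hit_def L_def)
      then show ?thesis by simp
    qed
  next
    fix x assume x: "x \<in> first_hit \<Omega> w (Suc n) \<union> returns \<Omega> w L"
    then have len: "length x = Suc n" using n by (auto simp: first_hit_def returns_def L_def)
    then obtain a s where as: "x = a # s" by (cases x) auto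
    have "occurs_at w x (Suc j) \<longleftrightarrow> Suc j = L" for j
      using x by (auto simp: first_hit_def returns_def L_def)
    then have "occurs_at w s j \<longleftrightarrow> j = n - length w" for j using shift[of a s] L by (simp add: as)
    moreover have "set x \<subseteq> \<Omega>" using x by (auto simp: first_hit_def returns_def)
    ultimately have "s \<in> first_hit \<Omega> w n" "a \<in> \<Omega>" using n len as by (auto simp: first_hit_def)
    then show "x \<in> (\<lambda>(a, s). a # s) ` (\<Omega> \<times> first_hit \<Omega> w n)" using as by auto
  qed
  moreover have "inj_on (\<lambda>(a, s). a # s) (\<Omega> \<times> first_hit \<Omega> w n)" by (auto simp: inj_on_def)
  ultimately have "card (\<Omega> \<times> first_hit \<Omega> w n) = card (first_hit \<Omega> w (Suc n) \<union> returns \<Omega> w L)"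
    by (metis card_image)
  also have "\<dots> = card (first_hit \<Omega> w (Suc n)) + card (returns \<Omega> w L)"
    using L by (intro card_Un_disjoint finite_first_hit finite_returns fin)
      (auto simp: first_hit_def returns_def L_def)
  finally show ?thesis by (simp add: card_cartesian_product L_def)
qed

text \<open>Occurrences strictly between 0 and \<open>n\<close> must overlap the initial copy of
  \<open>w\<close>. For \<open>n \<ge> length w\<close> these strings are \<open>w\<close> followed
  by a first-hit string, for smaller \<open>n\<close> self-overlaps of \<open>w\<close>, so one
  count yields both \<open>h_conv\<close> and \<open>P_conv\<close>.\<close>

definition linked :: "'a set \<Rightarrow> 'a list \<Rightarrow> nat \<Rightarrow> 'a list set" where
  "linked \<Omega> w n = {z. set z \<subseteq> \<Omega> \<and> length z = length w + n \<and> occurs_at w z 0 \<and> occurs_at w z n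
      \<and> (\<forall>j. length w \<le> j \<longrightarrow> j < n \<longrightarrow> \<not> occurs_at w z j)}"

lemma overlap_period:
  assumes "occurs_at w z 0" "occurs_at w z i" "i < length w"
  shows "i \<in> insert 0 (periods w)"
proof (cases "i = 0")
  case False
  have "w ! (j + i) = w ! j" if "j + i < length w" for j
  proof -
    have "z ! (j + i) = w ! (j + i)" using assms(1) that unfolding occurs_at_iff_nth by fastforce
    moreover have "z ! (i + j) = w ! j" using assms(2) that unfolding occurs_at_iff_nth by fastforce
    ultimately show ?thesis by (simp add: add.commute)
  qed
  then have "i \<in> periods w" using False assms(3) by (intro periodsI) auto
  then show ?thesis by simp
qed simp

text \<open>Cut at the last occurrence \<open>i < n\<close>. It overlaps the initial copy, so
  \<open>i\<close> is 0 or a period, and the rest lies in \<open>returns \<Omega> w (n - i)\<close>.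
  Conversely, \<open>period_extend\<close> restores the initial copy.\<close>

lemma card_linked:
  assumes fin: "finite \<Omega>" and w: "set w \<subseteq> \<Omega>" "1 \<le> length w" and n: "1 \<le> n"
  shows "card (linked \<Omega> w n) = (\<Sum>i\<in>{i\<in>insert 0 (periods w). i < n}. card (returns \<Omega> w (n - i)))"
proof -
  define k where "k = length w"
  define I where "I = {i\<in>insert 0 (periods w). i < n}"
  define f where "f i x = take i w @ x" for i x
  have I_k: "i < k" if "i \<in> I" for i using that w by (auto simp: I_def periods_def k_def)
  have finI: "finite I" using I_k by (meson finite_nat_set_iff_bounded)
  have len: "length (take i w) = i" if "i \<in> I" for i using I_k[OF that] by (simp add: k_def)
  have occ: "occurs_at w (f i x) (i + j) \<longleftrightarrow> occurs_at w x j" if "i \<in> I" for i x j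
    using occurs_at_append[of w "take i w" x j] len[OF that] by (simp add: f_def)
  have "linked \<Omega> w n = (\<Union>i\<in>I. f i ` returns \<Omega> w (n - i))"
  proof (intro equalityI subsetI)
    fix z assume z: "z \<in> linked \<Omega> w n"
    define J where "J = {j. j < n \<and> occurs_at w z j}"
    have J: "finite J" "0 \<in> J" using z n by (auto simp: J_def linked_def)
    define i where "i = Max J"
    have iJ: "i \<in> J" unfolding i_def using J by (intro Max_in) auto
    have ik: "i < k" using iJ z by (auto simp: J_def linked_def k_def not_le[symmetric])
    have iI: "i \<in> I" using overlap_period[of w z i] iJ z ik by (auto simp: I_def J_def linked_def k_def)
    have zw: "take i z = take i w"
      using z ik unfolding linked_def occurs_at_0 by (auto simp: k_def)
    define x where "x = drop i z"
    have zf: "z = f i x" unfolding f_def x_def zw[symmetric] by simp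
    have lz: "length z = k + n" using z by (simp add: linked_def k_def)
    have "occurs_at w x j \<longleftrightarrow> j = 0 \<or> j = n - i" for j
    proof
      assume "occurs_at w x j"
      then have o: "occurs_at w z (i + j)" using occ[OF iI] zf by simp
      then have "i + j \<le> n" using lz by (auto simp: occurs_at_def k_def)
      moreover have "i + j \<le> i" if "i + j < n" using Max_ge[OF J(1), of "i + j"] that o by (simp add: J_def i_def)
      ultimately show "j = 0 \<or> j = n - i" by auto
    next
      assume "j = 0 \<or> j = n - i"
      then have "occurs_at w z (i + j)" using iJ z by (auto simp: J_def linked_def)
      then show "occurs_at w x j" using occ[OF iI] zf by simp
    qed
    moreover have "set x \<subseteq> \<Omega>" using z set_drop_subset[of i z] by (auto simp: x_def linked_def)
    moreover have "length x = k + (n - i)" using lz iJ by (simp add: x_def J_def)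
    ultimately have "x \<in> returns \<Omega> w (n - i)" by (simp add: returns_def k_def)
    then show "z \<in> (\<Union>i\<in>I. f i ` returns \<Omega> w (n - i))" using iI zf by blast
  next
    fix z assume "z \<in> (\<Union>i\<in>I. f i ` returns \<Omega> w (n - i))"
    then obtain i x where i: "i \<in> I" and x: "x \<in> returns \<Omega> w (n - i)" and z: "z = f i x" by auto
    have o: "occurs_at w x j \<longleftrightarrow> j = 0 \<or> j = n - i" for j using x by (simp add: returns_def)
    have iln: "i < n" "i < k" using i I_k by (auto simp: I_def)
    obtain t where t: "x = w @ t" using o[of 0] occurs_at_0 by auto
    have "z = w @ drop (length w - i) w @ t"
      using period_extend[of i w] i unfolding z f_def t by (simp add: I_def)
    then have "occurs_at w z 0" using occurs_at_0 by blast
    moreover have "occurs_at w z n" using occ[OF i, of x "n - i"] o iln z by simp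
    moreover have "\<not> occurs_at w z j" if "length w \<le> j" "j < n" for j
      using occ[OF i, of x "j - i"] o[of "j - i"] that iln z by (auto simp: k_def)
    moreover have "set z \<subseteq> \<Omega>" using x w set_take_subset[of i w] by (auto simp: z f_def returns_def)
    moreover have "length z = length w + n" using x iln len[OF i] by (simp add: z f_def returns_def)
    ultimately show "z \<in> linked \<Omega> w n" by (simp add: linked_def)
  qed
  moreover have "card (\<Union>i\<in>I. f i ` returns \<Omega> w (n - i)) = (\<Sum>i\<in>I. card (f i ` returns \<Omega> w (n - i)))"
  proof (intro card_UN_disjoint finI ballI impI)
    fix i j assume ij: "i \<in> I" "j \<in> I" "i \<noteq> j"
    have disj: False if "i \<in> I" "j \<in> I" "i < j" "x \<in> returns \<Omega> w (n - i)" "y \<in> returns \<Omega> w (n - j)" "f i x = f j y" for i j x y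
    proof -
      have "occurs_at w (f j y) (j + 0)" using occ[OF that(2), of y 0] that(5) by (simp add: returns_def)
      then have "occurs_at w (f i x) (i + (j - i))" using that by simp
      then have "occurs_at w x (j - i)" using occ[OF that(1)] by blast
      then show False using that by (auto simp: returns_def I_def)
    qed
    show "f i ` returns \<Omega> w (n - i) \<inter> f j ` returns \<Omega> w (n - j) = {}"
    proof (rule ccontr)
      assume "\<not> ?thesis"
      then obtain x y where "x \<in> returns \<Omega> w (n - i)" "y \<in> returns \<Omega> w (n - j)" "f i x = f j y" by blast
      then show False using disj[of i j x y] disj[of j i y x] ij by (cases "i < j") auto
    qed
  qed (use finite_returns[OF fin] in auto)
  moreover have "card (f i ` returns \<Omega> w (n - i)) = card (returns \<Omega> w (n - i))" for i
    by (intro card_image) (auto simp: inj_on_def f_def)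
  ultimately show ?thesis by (simp add: I_def)
qed

lemma card_linked_long:
  assumes w: "set w \<subseteq> \<Omega>" and n: "length w \<le> n"
  shows "card (linked \<Omega> w n) = card (first_hit \<Omega> w n)"
proof -
  have occ: "occurs_at w (w @ u) (length w + j) \<longleftrightarrow> occurs_at w u j" for u j by (rule occurs_at_append)
  have "linked \<Omega> w n = (\<lambda>u. w @ u) ` first_hit \<Omega> w n"
  proof (intro equalityI subsetI)
    fix z assume z: "z \<in> linked \<Omega> w n"
    then obtain u where u: "z = w @ u" by (auto simp: linked_def occurs_at_0)
    have len: "length u = n" using z u by (simp add: linked_def)
    have "occurs_at w u j \<longleftrightarrow> j = n - length w" for j
    proof
      assume o: "occurs_at w u j"
      then have "occurs_at w z (length w + j)" using occ u by simp
      then have "\<not> length w + j < n" using z by (auto simp: linked_def)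
      moreover have "j + length w \<le> n" using o len by (simp add: occurs_at_def)
      ultimately show "j = n - length w" by simp
    next
      assume "j = n - length w"
      then show "occurs_at w u j" using z occ[of u j] u n by (simp add: linked_def)
    qed
    then have "u \<in> first_hit \<Omega> w n" using z u len n by (auto simp: linked_def first_hit_def)
    then show "z \<in> (\<lambda>u. w @ u) ` first_hit \<Omega> w n" using u by blast
  next
    fix z assume "z \<in> (\<lambda>u. w @ u) ` first_hit \<Omega> w n"
    then obtain u where u: "z = w @ u" "u \<in> first_hit \<Omega> w n" by auto
    have "\<not> occurs_at w z j" if "length w \<le> j" "j < n" for j
      using occ[of u "j - length w"] u that by (auto simp: first_hit_def)
    moreover have "occurs_at w z n" using occ[of u "n - length w"] u n by (simp add: first_hit_def)
    moreover have "occurs_at w z 0" using u occurs_at_0 by blast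
    ultimately show "z \<in> linked \<Omega> w n" using u w by (auto simp: linked_def first_hit_def)
  qed
  then show ?thesis by (simp add: card_image inj_on_def)
qed

lemma card_linked_short:
  assumes w: "set w \<subseteq> \<Omega>" and n: "1 \<le> n" "n < length w"
  shows "card (linked \<Omega> w n) = of_bool (n \<in> periods w)"
proof -
  have sub: "z = take n w @ w \<and> n \<in> periods w" if z: "z \<in> linked \<Omega> w n" for z
  proof
    show "n \<in> periods w" using overlap_period[of w z n] z n by (auto simp: linked_def)
    have "drop n z = w" using z by (auto simp: linked_def occurs_at_def)
    moreover have "take n z = take n w" using z n unfolding linked_def occurs_at_0 by auto
    ultimately show "z = take n w @ w" by (metis append_take_drop_id)
  qed
  show ?thesis
  proof (cases "n \<in> periods w")
    case True
    have "take n w @ w = w @ drop (length w - n) w" using True by (intro period_extend) simp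
    then have "occurs_at w (take n w @ w) 0" using occurs_at_0 by blast
    moreover have "occurs_at w (take n w @ w) n"
      using occurs_at_append[of w "take n w" w 0] n by (simp add: occurs_at_def)
    ultimately have "take n w @ w \<in> linked \<Omega> w n"
      using w n set_take_subset[of n w] by (auto simp: linked_def)
    then have "linked \<Omega> w n = {take n w @ w}" using sub by blast
    then show ?thesis using True by simp
  next
    case False
    then have "linked \<Omega> w n = {}" using sub by blast
    then show ?thesis using False by simp
  qed
qed

text \<open>If both letters complete an occurrence, the shorter shift is a period of \<open>w\<close>, and all factors
  of \<open>w\<close> of that length have the same multiset of letters.\<close>

lemma extra_occurrence_letter:
  assumes n: "length w \<le> length u"
    and o1: "occurs_at w (w @ a1 # u) i1" "1 \<le> i1" "i1 \<le> length w"
    and o2: "occurs_at w (w @ a2 # u) i2" "1 \<le> i2" "i2 \<le> length w"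
  shows "a1 = a2"
proof -
  have eq: "drop (length w - i) w = a # take (i - 1) u" if "occurs_at w (w @ a # u) i" "1 \<le> i" "i \<le> length w" for a i
  proof -
    have "w = take (length w) (drop i (w @ a # u))" using that by (simp add: occurs_at_def)
    also have "\<dots> = drop i w @ take i (a # u)" using that by simp
    finally have "drop (length w - i) w = drop (length w - i) (drop i w @ take i (a # u))" by simp
    also have "\<dots> = take i (a # u)" using that by simp
    also have "\<dots> = a # take (i - 1) u" using that by (cases i) auto
    finally show ?thesis .
  qed
  have main: "a = b" if oa: "occurs_at w (w @ a # u) i" "1 \<le> i" "i \<le> length w"
    and ob: "occurs_at w (w @ b # u) j" "1 \<le> j" "j \<le> length w" and ij: "i \<le> j" for a b i j
  proof (cases "i = j")
    case True
    then show ?thesis using eq[OF oa] eq[OF ob] by simp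
  next
    case False
    have "occurs_at w (w @ a # u) 0" using occurs_at_0 by blast
    then have per: "i \<in> periods w" using overlap_period[of w _ i] oa ob ij False by auto
    have "take i (drop (length w - j) w) = b # take (i - 1) u"
      using eq[OF ob] ij oa(2) by (cases i) auto
    moreover have "take i (drop (length w - i) w) = a # take (i - 1) u"
      using eq[OF oa] oa by (cases i) auto
    moreover have "mset (take i (drop (length w - j) w)) = mset (take i w)"
      using ij ob by (intro mset_period_window[OF per]) auto
    moreover have "mset (take i (drop (length w - i) w)) = mset (take i w)"
      using oa by (intro mset_period_window[OF per]) auto
    ultimately have "mset (b # take (i - 1) u) = mset (a # take (i - 1) u)" by metis
    then show ?thesis by simp
  qed
  show ?thesis
  proof (cases "i1 \<le> i2")
    case True then show ?thesis using main[OF o1 o2] by blast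
  next
    case False then show ?thesis using main[OF o2 o1] by simp
  qed
qed

text \<open>Put a letter \<open>a\<close> between \<open>w\<close> and a first-hit string
  \<open>u\<close>. The result is a return unless an occurrence starts at a position from 1 to
  \<open>length w\<close>, and by \<open>extra_occurrence_letter\<close> at most one
  \<open>a\<close> per \<open>u\<close> is spoilt.\<close>

lemma card_returns_lower:
  assumes fin: "finite \<Omega>" and w: "set w \<subseteq> \<Omega>" and n: "length w \<le> n"
  shows "card \<Omega> * card (first_hit \<Omega> w n) \<le> card (returns \<Omega> w (Suc n)) + card (first_hit \<Omega> w n)"
proof -
  define X where "X = \<Omega> \<times> first_hit \<Omega> w n"
  define Bad where "Bad = {(a, u) \<in> X. \<exists>i. 1 \<le> i \<and> i \<le> length w \<and> occurs_at w (w @ a # u) i}"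
  have finX: "finite X" using fin finite_first_hit by (auto simp: X_def)
  have "card Bad \<le> card (first_hit \<Omega> w n)"
  proof (rule card_inj_on_le)
    show "inj_on snd Bad"
    proof (rule inj_onI)
      fix x y assume xy: "x \<in> Bad" "y \<in> Bad" "snd x = snd y"
      obtain a u where x: "x = (a, u)" by (cases x)
      obtain b where y: "y = (b, u)" using xy(3) x by (cases y) auto
      have "length w \<le> length u" using xy(1) n by (auto simp: x Bad_def X_def first_hit_def)
      then have "a = b" using xy(1,2) extra_occurrence_letter[of w u a _ b] by (auto simp: x y Bad_def)
      then show "x = y" using x y by simp
    qed
  qed (use finite_first_hit[OF fin] in \<open>auto simp: Bad_def X_def\<close>)
  moreover have "card (X - Bad) \<le> card (returns \<Omega> w (Suc n))"
  proof (rule card_inj_on_le[of "\<lambda>(a, u). w @ a # u"])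
    show "(\<lambda>(a, u). w @ a # u) ` (X - Bad) \<subseteq> returns \<Omega> w (Suc n)"
    proof clarify
      fix a u assume au: "(a, u) \<in> X" "(a, u) \<notin> Bad"
      have u: "length u = n" "set u \<subseteq> \<Omega>" "\<And>j. occurs_at w u j \<longleftrightarrow> j = n - length w" "a \<in> \<Omega>"
        using au by (auto simp: X_def first_hit_def)
      have late: "occurs_at w (w @ a # u) (length w + 1 + j) \<longleftrightarrow> j = n - length w" for j
        using occurs_at_append[of w "w @ [a]" u j] u(3)[of j] by simp
      have "occurs_at w (w @ a # u) j \<longleftrightarrow> j = 0 \<or> j = Suc n" for j
      proof (cases "j \<le> length w")
        case True
        have "occurs_at w (w @ a # u) 0" using occurs_at_0 by blast
        moreover have "\<not> occurs_at w (w @ a # u) j" if "j \<noteq> 0"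
          using au that True by (auto simp: Bad_def)
        ultimately show ?thesis using True n by (cases "j = 0") auto
      next
        case False
        then show ?thesis using late[of "j - length w - 1"] n by auto
      qed
      then show "w @ a # u \<in> returns \<Omega> w (Suc n)" using u w by (auto simp: returns_def)
    qed
  qed (use finite_returns[OF fin] in \<open>auto simp: inj_on_def\<close>)
  moreover have "card X = card Bad + card (X - Bad)"
  proof -
    have "Bad \<subseteq> X" by (auto simp: Bad_def)
    then show ?thesis using finX card_mono[of X Bad] card_Diff_subset[of Bad X] finite_subset[of Bad X] by simp
  qed
  ultimately show ?thesis by (simp add: X_def card_cartesian_product)
qed

lemma corr_word:
  fixes w :: "'a list"
  assumes fin: "finite \<Omega>" and q: "2 \<le> card \<Omega>" and w: "set w \<subseteq> \<Omega>" "1 \<le> length w"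
  shows "corr (int (card \<Omega>)) (length w) (periods w) (\<lambda>n. int (h \<Omega> w n)) (\<lambda>n. int (card (returns \<Omega> w n)))"
proof
  have z: "0 \<notin> periods w" by (simp add: periods_def)
  have finP: "finite (periods w)"
    by (rule finite_subset[of _ "{..<length w}"]) (auto simp: periods_def)
  show "2 \<le> int (card \<Omega>)" "1 \<le> length w" using q w by auto
  show "periods w \<subseteq> {1..<length w}" by (auto simp: periods_def)
  show "int (h \<Omega> w n) = 0" if "n < length w" for n
    using that by (simp add: h_def)
  show "int (h \<Omega> w (length w)) = 1"
  proof -
    have "first_hit \<Omega> w (length w) = {w}"
      using w by (auto simp: first_hit_def occurs_at_def)
    then show ?thesis by (simp add: h_card)
  qed
  show "int (h \<Omega> w (Suc n)) = int (card \<Omega>) * int (h \<Omega> w n) - int (card (returns \<Omega> w (Suc n - length w)))"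
    if "length w \<le> n" for n
  proof -
    have "int (card \<Omega> * card (first_hit \<Omega> w n)) = int (card (first_hit \<Omega> w (Suc n)) + card (returns \<Omega> w (Suc n - length w)))"
      using card_first_hit_step[OF fin that] by simp
    then show ?thesis by (simp add: h_card)
  qed
  have set_eq: "{i \<in> insert 0 (periods w). i < n} = insert 0 {s \<in> periods w. s < n}" if "1 \<le> n" for n
    using that by auto
  show "int (h \<Omega> w n) = int (card (returns \<Omega> w n)) + (\<Sum>s\<in>periods w. int (card (returns \<Omega> w (n - s))))"
    if n: "length w \<le> n" for n
  proof -
    have n1: "1 \<le> n" using n w by simp
    have "{s \<in> periods w. s < n} = periods w" using n by (auto simp: periods_def)
    then have "card (first_hit \<Omega> w n) = card (returns \<Omega> w n) + (\<Sum>s\<in>periods w. card (returns \<Omega> w (n - s)))"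
      using card_linked[OF fin w n1] card_linked_long[OF w(1) n] set_eq[OF n1] z finP by simp
    then show ?thesis by (simp add: h_card)
  qed
  show "of_bool (n \<in> periods w) = int (card (returns \<Omega> w n)) + (\<Sum>s\<in>{s \<in> periods w. s < n}. int (card (returns \<Omega> w (n - s))))"
    if n: "1 \<le> n" "n < length w" for n
  proof -
    have "of_bool (n \<in> periods w) = card (returns \<Omega> w n) + (\<Sum>s\<in>{s \<in> periods w. s < n}. card (returns \<Omega> w (n - s)))"
      using card_linked[OF fin w n(1)] card_linked_short[OF w(1) n] set_eq[OF n(1)] z finP by simp
    then have "int (of_bool (n \<in> periods w)) = int (card (returns \<Omega> w n) + (\<Sum>s\<in>{s \<in> periods w. s < n}. card (returns \<Omega> w (n - s))))"
      by (rule arg_cong)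
    then show ?thesis by simp
  qed
  show "0 \<le> int (card (returns \<Omega> w n))" for n by simp
  show "s - p \<in> periods w" if "p \<in> periods w" "s \<in> periods w" "p < s" "p + s \<le> length w + 1" for p s
    using that by (rule period_diff)
  show "(int (card \<Omega>) - 1) * int (h \<Omega> w n) \<le> int (card (returns \<Omega> w (Suc n)))" if "length w \<le> n" for n
  proof -
    have "int (card \<Omega> * card (first_hit \<Omega> w n)) \<le> int (card (returns \<Omega> w (Suc n)) + card (first_hit \<Omega> w n))"
      using card_returns_lower[OF fin w(1) that] by (simp only: of_nat_le_iff)
    then show ?thesis by (simp add: h_card algebra_simps)
  qed
qed

section \<open>The autocorrelation as a binary number\<close>

lemma cor_eq_sum_periods:
  assumes "1 \<le> length w"
  shows "cor w = (\<Sum>s\<in>insert 0 (periods w). 2 ^ (length w - 1 - s))"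
proof -
  have "cor w = (\<Sum>s\<in>{0..<length w}. if s \<in> insert 0 (periods w) then 2 ^ (length w - 1 - s) else 0)"
    unfolding cor_def
    by (rule sum.reindex_bij_witness[of _ "\<lambda>s. length w - s" "\<lambda>i. length w - i"])
      (auto simp: periods_def)
  also have "\<dots> = (\<Sum>s\<in>{s\<in>{0..<length w}. s \<in> insert 0 (periods w)}. 2 ^ (length w - 1 - s))"
    by (rule sum.inter_filter[symmetric]) simp
  also have "{s\<in>{0..<length w}. s \<in> insert 0 (periods w)} = insert 0 (periods w)"
    using assms by (auto simp: periods_def)
  finally show ?thesis .
qed

lemma binary_sum_less:
  assumes "s0 < k" "finite A"
    and "A \<subseteq> {s0<..<k}"
  shows "(\<Sum>s\<in>A. 2 ^ (k - 1 - s)) < (2::nat) ^ (k - 1 - s0)"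
proof -
  have "(\<Sum>s\<in>A. 2 ^ (k - 1 - s)) \<le> (\<Sum>s\<in>{s0<..<k}. (2::nat) ^ (k - 1 - s))"
    using assms by (intro sum_mono2) auto
  also have "\<dots> = (\<Sum>j<k - 1 - s0. 2 ^ j)"
    by (rule sum.reindex_bij_witness[of _ "\<lambda>j. k - 1 - j" "\<lambda>s. k - 1 - s"]) auto
  also have "(\<Sum>j<m. 2 ^ j) < (2::nat) ^ m" for m by (induction m) auto
  finally show ?thesis .
qed

text \<open>The leading bit, from shift 0, is always set, so a larger autocorrelation cannot belong
  to a shorter word.\<close>

lemma cor_bounds:
  assumes "1 \<le> length w"
  shows "2 ^ (length w - 1) \<le> cor w" "cor w < 2 ^ length w"
proof -
  have fin: "finite (periods w)" by (rule finite_subset[of _ "{..<length w}"]) (auto simp: periods_def)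
  have "cor w = 2 ^ (length w - 1) + (\<Sum>s\<in>periods w. 2 ^ (length w - 1 - s))"
    unfolding cor_eq_sum_periods[OF assms] using fin by (simp add: periods_def)
  moreover have "(\<Sum>s\<in>periods w. 2 ^ (length w - 1 - s)) < (2::nat) ^ (length w - 1 - 0)"
    using assms fin by (intro binary_sum_less) (auto simp: periods_def)
  moreover have "(2::nat) ^ length w = 2 * 2 ^ (length w - 1)" using assms by (cases "length w") auto
  ultimately show "2 ^ (length w - 1) \<le> cor w" "cor w < 2 ^ length w" by auto
qed

text \<open>The first differing shift is the most significant differing bit, and by
  \<open>binary_sum_less\<close> it outweighs all later ones together.\<close>

lemma cor_less_first_difference:
  assumes w: "1 \<le> length w" "length w' = length w" and c: "cor w' < cor w"
  obtains s0 where "s0 \<in> periods w" "s0 \<notin> periods w'" "\<And>s. s < s0 \<Longrightarrow> s \<in> periods w \<longleftrightarrow> s \<in> periods w'"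
proof -
  define k where "k = length w"
  have w': "1 \<le> length w'" using w by simp
  have "\<exists>s. (s \<in> periods w) \<noteq> (s \<in> periods w')"
  proof (rule ccontr)
    assume "\<not> ?thesis"
    then have "periods w = periods w'" by blast
    then show False using c cor_eq_sum_periods[OF w(1)] cor_eq_sum_periods[OF w'] w by simp
  qed
  then obtain s0 where s0: "(s0 \<in> periods w) \<noteq> (s0 \<in> periods w')"
    and below: "\<And>s. s < s0 \<Longrightarrow> s \<in> periods w \<longleftrightarrow> s \<in> periods w'"
    using exists_least_iff[of "\<lambda>s. (s \<in> periods w) \<noteq> (s \<in> periods w')"] by blast
  have "s0 \<in> periods w"
  proof (rule ccontr)
    assume n: "s0 \<notin> periods w"
    then have i: "s0 \<in> periods w'" using s0 by simp
    have b: "1 \<le> s0" "s0 < k" using i w by (auto simp: periods_def k_def)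
    define A A' where "A = insert 0 (periods w)" and "A' = insert 0 (periods w')"
    have sub: "A \<subseteq> {..<k}" "A' \<subseteq> {..<k}" using w by (auto simp: A_def A'_def periods_def k_def)
    then have fin: "finite A" "finite A'" using finite_subset by blast+
    have "s0 \<notin> A" using n b by (simp add: A_def)
    then have "A = {s\<in>A. s < s0} \<union> {s\<in>A. s0 < s}" by (auto simp: not_less_iff_gr_or_eq)
    then have "(\<Sum>s\<in>A. 2 ^ (k - 1 - s)) = (\<Sum>s\<in>{s\<in>A. s < s0} \<union> {s\<in>A. s0 < s}. (2::nat) ^ (k - 1 - s))"
      by (rule arg_cong)
    also have "\<dots> = (\<Sum>s\<in>{s\<in>A. s < s0}. 2 ^ (k - 1 - s)) + (\<Sum>s\<in>{s\<in>A. s0 < s}. 2 ^ (k - 1 - s))"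
      using fin by (intro sum.union_disjoint) auto
    finally have "cor w = (\<Sum>s\<in>{s\<in>A. s < s0}. 2 ^ (k - 1 - s)) + (\<Sum>s\<in>{s\<in>A. s0 < s}. 2 ^ (k - 1 - s))"
      unfolding cor_eq_sum_periods[OF w(1)] A_def[symmetric] k_def[symmetric] .
    also have "(\<Sum>s\<in>{s\<in>A. s0 < s}. 2 ^ (k - 1 - s)) < (2::nat) ^ (k - 1 - s0)"
      using b sub fin by (intro binary_sum_less) auto
    also have "{s\<in>A. s < s0} = {s\<in>A'. s < s0}" using below by (auto simp: A_def A'_def)
    also have "(\<Sum>s\<in>{s\<in>A'. s < s0}. 2 ^ (k - 1 - s)) + 2 ^ (k - 1 - s0) = (\<Sum>s\<in>insert s0 {s\<in>A'. s < s0}. (2::nat) ^ (k - 1 - s))"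
      using fin by simp
    also have "\<dots> \<le> (\<Sum>s\<in>A'. 2 ^ (k - 1 - s))"
      using fin i by (intro sum_mono2) (auto simp: A'_def)
    also have "\<dots> = cor w'" unfolding cor_eq_sum_periods[OF w'] A'_def k_def using w by simp
    finally show False using c by simp
  qed
  then show thesis using that s0 below by blast
qed

theorem theorem2p1:
  fixes \<Omega> :: "'a set" and w w' :: "'a list"
  assumes "finite \<Omega>" and "card \<Omega> \<ge> 2"
    and "set w \<subseteq> \<Omega>" and "set w' \<subseteq> \<Omega>"
    and "length w \<ge> 1" and "length w' \<ge> 1"
    and "cor w > cor w'"
  shows "\<exists>N::nat. N > length w \<and>
           (\<forall>n<N. int (h \<Omega> w n) - int (h \<Omega> w' n) \<le> 0) \<and>
           (\<forall>n>N. int (h \<Omega> w n) - int (h \<Omega> w' n) > 0)"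
proof -
  have W: "corr (int (card \<Omega>)) (length w) (periods w) (\<lambda>n. int (h \<Omega> w n)) (\<lambda>n. int (card (returns \<Omega> w n)))"
    using assms by (intro corr_word)
  have V: "corr (int (card \<Omega>)) (length w') (periods w') (\<lambda>n. int (h \<Omega> w' n)) (\<lambda>n. int (card (returns \<Omega> w' n)))"
    using assms by (intro corr_word)
  have "length w' \<le> length w"
  proof (rule ccontr)
    assume "\<not> ?thesis"
    then have "(2::nat) ^ length w \<le> 2 ^ (length w' - 1)" by (intro power_increasing) auto
    then show False using cor_bounds(2)[OF assms(5)] cor_bounds(1)[OF assms(6)] assms(7) by linarith
  qed
  then consider "length w' < length w" | "length w' = length w" by linarith
  then have "\<exists>N>length w. (\<forall>n<N. int (h \<Omega> w n) - int (h \<Omega> w' n) \<le> 0)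
      \<and> (\<forall>n\<ge>N. 0 < int (h \<Omega> w n) - int (h \<Omega> w' n))"
  proof cases
    case 1
    then show ?thesis by (rule sign_change_longer[OF W V])
  next
    case 2
    obtain s0 where "s0 \<in> periods w" "s0 \<notin> periods w'" "\<And>s. s < s0 \<Longrightarrow> s \<in> periods w \<longleftrightarrow> s \<in> periods w'"
      using cor_less_first_difference[OF assms(5) 2 assms(7)] by blast
    then have "corr_pair (int (card \<Omega>)) (length w) (periods w) (\<lambda>n. int (h \<Omega> w n)) (\<lambda>n. int (card (returns \<Omega> w n)))
        (periods w') (\<lambda>n. int (h \<Omega> w' n)) (\<lambda>n. int (card (returns \<Omega> w' n))) s0"
      using W V 2 by (auto simp: corr_pair_def corr_pair_axioms_def)
    then show ?thesis by (rule corr_pair.sign_change_equal_length)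
  qed
  then show ?thesis by (meson less_imp_le)
qed

end
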